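(* Let $\lambda$ be a frequency and $(G,\beta)$ a $\lambda$-Dirichlet group. Assume that $L(\lambda)<\infty$ and that $\mathcal{D}^{ext}_{\infty}(\lambda)=\mathcal{D}_{\infty}(\lambda)$. Let $\Psi\colon \mathcal{D}^{ext}_{\infty}(\lambda)\to H^{\lambda}_{\infty}(G)$ be the injective contraction which assigns to $D$ the function $f\in H_\infty^\lambda(G)$ with $\widehat{f}(h_{\lambda_n})=a_n(D)$ for all $n\in\mathbb{N}$. Then $\Psi$ is an onto isometry, and its inverse is given by the Bohr map $$\mathcal{B}\colon H_{\infty}^{\lambda}(G)\to \mathcal{D}_{\infty}(\lambda),\qquad f\mapsto \sum \widehat{f}(h_{\lambda_n})e^{-\lambda_n s}.$$ In particular, $\mathcal{D}_{\infty}(\lambda)=\mathcal{H}_{\infty}(\lambda)$ isometrically.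
   Context: A frequency is a strictly increasing sequence $\lambda=(\lambda_n)_{n\ge1}$ of non-negative real numbers tending to $\infty$. A $\lambda$-Dirichlet series is a formal sum $D=\sum a_n e^{-\lambda_n s}$ with complex coefficients $a_n=a_n(D)$ and complex variable $s$. $L(\lambda):=\limsup_{n\to\infty}\frac{\log n}{\lambda_n}$. For $\sigma\in\mathbb{R}$, $[\mathrm{Re}>\sigma]=\{s\in\mathbb{C}:\mathrm{Re}\,s>\sigma\}$. $\mathcal{D}_\infty(\lambda)$ is the space of all $\lambda$-Dirichlet series which converge on $[\mathrm{Re}>0]$ and define there a bounded (and then necessarily holomorphic) function. $\mathcal{D}^{ext}_\infty(\lambda)$ is the space of all $\lambda$-Dirichlet series which converge at some point (hence on some half plane) and whose limit function has a bounded holomorphic extension $F$ to $[\mathrm{Re}>0]$. Both carry the norm $\|D\|_\infty=\sup_{[\mathrm{Re}>0]}|F(s)|$, and $\mathcal{D}_\infty(\lambda)\subset\mathcal{D}^{ext}_\infty(\lambda)$. A Dirichlet group is a pair $(G,\beta)$ of a compact abelian group $G$ and a continuous homomorphism $\beta\colon\mathbb{R}\to G$ with dense range. It is a $\lambda$-Dirichlet group if for every $n$ there is a (necessarily unique) character $h_{\lambda_n}\in\widehat{G}$ with $h_{\lambda_n}(\beta(t))=e^{-i\lambda_n t}$ for all $t\in\mathbb{R}$. $L_p(G)$ is taken with respect to the normalized Haar measure $m$, and $\widehat{f}(\gamma)=\int_G f\overline{\gamma}\,dm$ for $\gamma\in\widehat G$. $H_p^\lambda(G)$ is the space of all $f\in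 L_p(G)$ such that $\widehat f(\gamma)\ne0$ only if $\gamma=h_{\lambda_n}$ for some $n$. $\mathcal{H}_p(\lambda)$, $1\le p\le\infty$, is the space of all $\lambda$-Dirichlet series $\sum a_ne^{-\lambda_ns}$ for which there is $f\in H_p^\lambda(G)$ with $\widehat f(h_{\lambda_n})=a_n$ for all $n$, with norm $\|D\|_p=\|f\|_p$; it does not depend on the choice of the $\lambda$-Dirichlet group $(G,\beta)$. *)

theory Defs
  imports "HOL-Complex_Analysis.Complex_Analysis" "HOL-Probability.Probability"
begin

section \<open>General Dirichlet series\<close>

text \<open>
  Sequences are indexed from 0: \<open>lam n\<close> stands for \<open>\<lambda>\<close> with index \<open>n + 1\<close>, and likewise for
  coefficients. A formal \<open>\<lambda>\<close>-Dirichlet series is identified with its coefficient sequence.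
\<close>

type_synonym dseries = "nat \<Rightarrow> complex"

definition frequency :: "(nat \<Rightarrow> real) \<Rightarrow> bool" where
  "frequency lam \<longleftrightarrow>
     strict_mono lam \<and> (\<forall>n. 0 \<le> lam n) \<and> filterlim lam at_top sequentially"

definition freq_L :: "(nat \<Rightarrow> real) \<Rightarrow> ereal" where
  "freq_L lam = limsup (\<lambda>n. ereal (ln (real (Suc n)) / lam n))"

definition right_half_plane :: "real \<Rightarrow> complex set" where
  "right_half_plane \<sigma> = {s. \<sigma> < Re s}"

definition dterm :: "(nat \<Rightarrow> real) \<Rightarrow> dseries \<Rightarrow> complex \<Rightarrow> nat \<Rightarrow> complex" where
  "dterm lam a s n = a n * exp (- (of_real (lam n) * s))"

definition dconv :: "(nat \<Rightarrow> real) \<Rightarrow> dseries \<Rightarrow> complex \<Rightarrow> bool" where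
  "dconv lam a s \<longleftrightarrow> summable (dterm lam a s)"

definition dlimit :: "(nat \<Rightarrow> real) \<Rightarrow> dseries \<Rightarrow> complex \<Rightarrow> complex" where
  "dlimit lam a s = (\<Sum>n. dterm lam a s n)"

definition D_inf :: "(nat \<Rightarrow> real) \<Rightarrow> dseries set" where
  "D_inf lam = {a. (\<forall>s\<in>right_half_plane 0. dconv lam a s) \<and>
                   bounded (dlimit lam a ` right_half_plane 0)}"

text \<open>
  \<open>F\<close> is a bounded holomorphic function on \<open>[Re > 0]\<close> which agrees with the limit function of the
  series on every half plane contained in \<open>[Re > 0]\<close> on which the series converges. The values
  of \<open>F\<close> outside \<open>[Re > 0]\<close> are irrelevant.
\<close>

definition bdd_extension :: "(nat \<Rightarrow> real) \<Rightarrow> dseries \<Rightarrow> (complex \<Rightarrow> complex) \<Rightarrow> bool" where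
  "bdd_extension lam a F \<longleftrightarrow>
     F holomorphic_on right_half_plane 0 \<and> bounded (F ` right_half_plane 0) \<and>
     (\<forall>\<sigma>\<ge>0. (\<forall>s\<in>right_half_plane \<sigma>. dconv lam a s) \<longrightarrow>
             (\<forall>s\<in>right_half_plane \<sigma>. F s = dlimit lam a s))"

definition D_ext :: "(nat \<Rightarrow> real) \<Rightarrow> dseries set" where
  "D_ext lam = {a. (\<exists>s. dconv lam a s) \<and> (\<exists>F. bdd_extension lam a F)}"

text \<open>
  For a series in \<open>D_ext\<close> the extension is unique on \<open>[Re > 0]\<close> by the identity theorem, so the
  choice made by \<open>SOME\<close> does not affect the norm.
\<close>

definition D_norm :: "(nat \<Rightarrow> real) \<Rightarrow> dseries \<Rightarrow> real" where
  "D_norm lam a =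
     (SUP s\<in>right_half_plane 0. norm ((SOME F. bdd_extension lam a F) s))"


section \<open>Dirichlet groups\<close>

text \<open>
  Groups are written additively; a compact (Hausdorff) abelian group is a type of the
  classes \<open>topological_ab_group_add\<close> and \<open>t2_space\<close> with compact universe.
\<close>

definition dirichlet_group ::
    "(real \<Rightarrow> 'g::{topological_ab_group_add, t2_space}) \<Rightarrow> bool" where
  "dirichlet_group \<beta> \<longleftrightarrow>
     compact (UNIV :: 'g set) \<and> continuous_on UNIV \<beta> \<and>
     (\<forall>s t. \<beta> (s + t) = \<beta> s + \<beta> t) \<and> closure (range \<beta>) = UNIV"

definition character :: "('g::{topological_ab_group_add, t2_space} \<Rightarrow> complex) \<Rightarrow> bool" where
  "character \<gamma> \<longleftrightarrow>
     continuous_on UNIV \<gamma> \<and> (\<forall>x. norm (\<gamma> x) = 1) \<and> (\<forall>x y. \<gamma> (x + y) = \<gamma> x * \<gamma> y)"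

definition represents ::
    "(real \<Rightarrow> 'g::{topological_ab_group_add, t2_space}) \<Rightarrow> real \<Rightarrow> ('g \<Rightarrow> complex) \<Rightarrow> bool" where
  "represents \<beta> \<mu> \<gamma> \<longleftrightarrow>
     character \<gamma> \<and> (\<forall>t. \<gamma> (\<beta> t) = exp (- (\<i> * of_real \<mu> * of_real t)))"

definition lam_dirichlet_group ::
    "(nat \<Rightarrow> real) \<Rightarrow> (real \<Rightarrow> 'g::{topological_ab_group_add, t2_space}) \<Rightarrow> bool" where
  "lam_dirichlet_group lam \<beta> \<longleftrightarrow>
     dirichlet_group \<beta> \<and> (\<forall>n. \<exists>\<gamma>. represents \<beta> (lam n) \<gamma>)"

text \<open>\<open>h_char \<beta> \<mu>\<close> is \<open>h\<close> with index \<open>\<mu>\<close>; it is unique because \<open>\<beta>\<close> has dense range.\<close>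

definition h_char ::
    "(real \<Rightarrow> 'g::{topological_ab_group_add, t2_space}) \<Rightarrow> real \<Rightarrow> 'g \<Rightarrow> complex" where
  "h_char \<beta> \<mu> = (THE \<gamma>. represents \<beta> \<mu> \<gamma>)"

text \<open>
  The group need not be metrizable, so regularity of the Borel measure has to be required.
\<close>

definition normalized_haar :: "'g::{topological_ab_group_add, t2_space} measure \<Rightarrow> bool" where
  "normalized_haar m \<longleftrightarrow>
     sets m = sets borel \<and> emeasure m UNIV = 1 \<and>
     (\<forall>x. distr m borel (\<lambda>y. x + y) = m) \<and>
     (\<forall>A\<in>sets borel. emeasure m A = (SUP K\<in>{K. compact K \<and> K \<subseteq> A}. emeasure m K)) \<and>
     (\<forall>A\<in>sets borel. emeasure m A = (INF U\<in>{U. open U \<and> A \<subseteq> U}. emeasure m U))"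


section \<open>Essentially bounded functions and their Hardy subspace\<close>

text \<open>
  Elements of \<open>Linf m\<close> are equivalence classes of measurable functions modulo equality
  almost everywhere.
\<close>

definition ae_class :: "'g measure \<Rightarrow> ('g \<Rightarrow> complex) \<Rightarrow> ('g \<Rightarrow> complex) set" where
  "ae_class m f = {g \<in> borel_measurable m. AE x in m. g x = f x}"

definition rep :: "('g \<Rightarrow> complex) set \<Rightarrow> 'g \<Rightarrow> complex" where
  "rep u = (SOME f. f \<in> u)"

definition Linf :: "'g measure \<Rightarrow> ('g \<Rightarrow> complex) set set" where
  "Linf m = {ae_class m f | f. f \<in> borel_measurable m \<and>
               esssup m (\<lambda>x. ereal (norm (f x))) < \<infinity>}"

definition Linf_norm :: "'g measure \<Rightarrow> ('g \<Rightarrow> complex) set \<Rightarrow> real" where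
  "Linf_norm m u = real_of_ereal (esssup m (\<lambda>x. ereal (norm (rep u x))))"

definition Linf_add ::
    "'g measure \<Rightarrow> ('g \<Rightarrow> complex) set \<Rightarrow> ('g \<Rightarrow> complex) set \<Rightarrow> ('g \<Rightarrow> complex) set" where
  "Linf_add m u v = ae_class m (\<lambda>x. rep u x + rep v x)"

definition Linf_scale ::
    "'g measure \<Rightarrow> complex \<Rightarrow> ('g \<Rightarrow> complex) set \<Rightarrow> ('g \<Rightarrow> complex) set" where
  "Linf_scale m c u = ae_class m (\<lambda>x. c * rep u x)"

definition fourier_coeff ::
    "'g measure \<Rightarrow> ('g \<Rightarrow> complex) set \<Rightarrow> ('g \<Rightarrow> complex) \<Rightarrow> complex" where
  "fourier_coeff m u \<gamma> = (\<integral>x. rep u x * cnj (\<gamma> x) \<partial>m)"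

definition H_inf_group ::
    "(nat \<Rightarrow> real) \<Rightarrow> (real \<Rightarrow> 'g::{topological_ab_group_add, t2_space}) \<Rightarrow> 'g measure \<Rightarrow>
     ('g \<Rightarrow> complex) set set" where
  "H_inf_group lam \<beta> m =
     {u \<in> Linf m. \<forall>\<gamma>. character \<gamma> \<longrightarrow> fourier_coeff m u \<gamma> \<noteq> 0 \<longrightarrow>
                       (\<exists>n. \<gamma> = h_char \<beta> (lam n))}"

definition bohr_map ::
    "(nat \<Rightarrow> real) \<Rightarrow> (real \<Rightarrow> 'g::{topological_ab_group_add, t2_space}) \<Rightarrow> 'g measure \<Rightarrow>
     ('g \<Rightarrow> complex) set \<Rightarrow> dseries" where
  "bohr_map lam \<beta> m u = (\<lambda>n. fourier_coeff m u (h_char \<beta> (lam n)))"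

definition Psi ::
    "(nat \<Rightarrow> real) \<Rightarrow> (real \<Rightarrow> 'g::{topological_ab_group_add, t2_space}) \<Rightarrow> 'g measure \<Rightarrow>
     dseries \<Rightarrow> ('g \<Rightarrow> complex) set" where
  "Psi lam \<beta> m a =
     (THE u. u \<in> H_inf_group lam \<beta> m \<and> (\<forall>n. fourier_coeff m u (h_char \<beta> (lam n)) = a n))"

text \<open>The space of Dirichlet series \<open>\<H>\<close> with index \<open>\<infinity>\<close>, computed with the group \<open>(G, \<beta>)\<close>.\<close>

definition H_inf_series ::
    "(nat \<Rightarrow> real) \<Rightarrow> (real \<Rightarrow> 'g::{topological_ab_group_add, t2_space}) \<Rightarrow> 'g measure \<Rightarrow>
     dseries set" where
  "H_inf_series lam \<beta> m =
     {a. \<exists>u\<in>H_inf_group lam \<beta> m. \<forall>n. fourier_coeff m u (h_char \<beta> (lam n)) = a n}"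

definition H_inf_series_norm ::
    "(nat \<Rightarrow> real) \<Rightarrow> (real \<Rightarrow> 'g::{topological_ab_group_add, t2_space}) \<Rightarrow> 'g measure \<Rightarrow>
     dseries \<Rightarrow> real" where
  "H_inf_series_norm lam \<beta> m a =
     Linf_norm m (THE u. u \<in> H_inf_group lam \<beta> m \<and>
                         (\<forall>n. fourier_coeff m u (h_char \<beta> (lam n)) = a n))"

end

theory Submission
  imports Defs
begin

text \<open>
  Both directions of the theorem compare a series \<open>\<Sum> a\<^sub>n e\<^bsup>-\<lambda>\<^sub>n s\<^esup>\<close> with the series whose coefficients are
  damped by the Gaussian factors \<open>exp (- (d \<lambda>\<^sub>n)\<^sup>2 / 2)\<close>. Since \<open>L(\<lambda>) < \<infinity>\<close>, some
  \<open>\<Sum> e\<^bsup>-\<rho> \<lambda>\<^sub>n\<^esup>\<close> converges, so the damped series converges absolutely everywhere as soon as the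
  coefficients grow at most exponentially. Hence it lives at the same time on the half plane and, as
  \<open>\<Sum> c\<^sub>n h\<^sub>n\<close>, as a continuous function on the group; along \<open>\<beta>\<close> the group function is the restriction of
  the half plane function to the imaginary axis. The number \<open>exp (- (d \<lambda>)\<^sup>2 / 2)\<close> is the mean of
  \<open>exp (- \<i> \<lambda> d X)\<close> for a standard normal variable \<open>X\<close>, so damping is averaging over vertical
  translations, which does not increase sup norms.

  From the half plane to the group (\<open>D_ext_imp_H_inf\<close>): if \<open>F\<close> is the bounded extension, then
  \<open>s \<mapsto> E (F (s + \<i> d X))\<close> is holomorphic and, by the identity theorem, it is the damped series. So the
  damped series is bounded by \<open>\<parallel>F\<parallel>\<close> on the imaginary axis, and by density of \<open>\<beta>\<close> on the group. For
  \<open>d \<rightarrow> 0\<close> the squared \<open>L\<^sub>2\<close> norms increase and stay bounded, so the functions form a Cauchy sequence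
  in \<open>L\<^sub>2\<close>; an almost everywhere limit of a subsequence has the coefficients \<open>a\<^sub>n\<close> and the bound \<open>\<parallel>F\<parallel>\<close>.

  From the group to the half plane (\<open>H_inf_imp_D_ext\<close>): for \<open>f\<close> in the Hardy space the damped
  series is bounded by \<open>\<parallel>f\<parallel>\<close> on the group, because averaging over translations along \<open>\<beta>\<close> contracts
  \<open>L\<^sub>1\<close> and the two operations are dual to each other. A Phragmen-Lindelof argument carries the bound
  from the imaginary axis to the half plane, and Montel's theorem yields a limit for \<open>d \<rightarrow> 0\<close>. The limit
  agrees with the original series wherever that series converges, since Gaussian damping is a regular
  summation method for convergent series (\<open>monotone_summation_regular\<close>).

  That a function is determined by its Fourier coefficients (\<open>fourier_uniqueness\<close>) needs enough
  characters on the group. They arise from an extremal principle: convolution with a non-zero hermitian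
  kernel is a non-zero compact selfadjoint operator, so its square has a positive eigenvalue; among the normalised positive
  definite functions in that eigenspace there is one of maximal \<open>L\<^sub>2\<close> norm, and by strict convexity of
  the norm it is multiplicative, hence a character (\<open>eigenspace_character\<close>). The Stone-Weierstrass
  theorem and regularity of the Haar measure do the rest.

  Consequently \<open>Psi\<close> and the Bohr map are mutually inverse isometries between \<open>D_ext lam\<close> and the Hardy space,
  and the assumption \<open>D_ext lam = D_inf lam\<close> turns this into a statement about \<open>D_inf lam\<close>.
\<close>

section \<open>Haar integration on a compact abelian group\<close>

locale compact_haar =
  fixes m :: "'g::{topological_ab_group_add, t2_space} measure"
  assumes compact_group: "compact (UNIV :: 'g set)"
    and haar: "normalized_haar m"
begin

lemma sets_haar [measurable_cong, simp]: "sets m = sets borel"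
  using haar by (simp add: normalized_haar_def)

lemma space_haar [simp]: "space m = UNIV"
  using sets_eq_imp_space_eq[OF sets_haar] by simp

sublocale prob_space m
  by standard (use haar in \<open>simp add: normalized_haar_def\<close>)

sublocale pair: pair_prob_space m m
  by standard

lemma continuous_measurable:
  fixes f :: "'g \<Rightarrow> 'b::topological_space"
  assumes "continuous_on UNIV f"
  shows "f \<in> borel_measurable m"
  using borel_measurable_continuous_onI[OF assms] measurable_cong_sets[OF sets_haar refl]
  by blast

lemma continuous_bounded:
  fixes f :: "'g \<Rightarrow> 'b::real_normed_vector"
  assumes "continuous_on UNIV f"
  obtains B where "0 < B" "\<And>x. norm (f x) \<le> B"
proof -
  have "bounded (range f)"
    using compact_continuous_image[OF assms compact_group] compact_imp_bounded by blast
  then show ?thesis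
    using that by (auto simp: bounded_pos)
qed

lemma continuous_integrable:
  fixes f :: "'g \<Rightarrow> 'b::{banach, second_countable_topology}"
  assumes "continuous_on UNIV f"
  shows "integrable m f"
proof -
  obtain B where "0 < B" "\<And>x. norm (f x) \<le> B"
    using continuous_bounded[OF assms] by blast
  then show ?thesis
    by (intro integrable_const_bound[where B = B]) (auto intro: continuous_measurable assms)
qed

lemma integral_translate:
  fixes f :: "'g \<Rightarrow> 'b::{banach, second_countable_topology}"
  assumes "f \<in> borel_measurable m"
  shows "(\<integral>y. f (a + y) \<partial>m) = (\<integral>y. f y \<partial>m)"
proof -
  have "distr m borel (\<lambda>y. a + y) = m"
    using haar by (simp add: normalized_haar_def)
  moreover have "(\<lambda>y. a + y) \<in> measurable m borel"
    by (intro continuous_measurable continuous_intros)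
  moreover have "f \<in> borel_measurable borel"
    using assms measurable_cong_sets[OF sets_haar refl] by blast
  ultimately show ?thesis
    using integral_distr[of "\<lambda>y. a + y" m borel f] by simp
qed

lemma continuous_translate:
  fixes f :: "'g \<Rightarrow> 'b::topological_space"
  assumes "continuous_on UNIV f"
  shows "continuous_on UNIV (\<lambda>x. f (a + x))" "continuous_on UNIV (\<lambda>x. f (x + a))"
    "continuous_on UNIV (\<lambda>x. f (x - a))" "continuous_on UNIV (\<lambda>x. f (a - x))"
    "continuous_on UNIV (\<lambda>x. f (- x))"
  by (intro continuous_on_compose2[OF assms] continuous_intros; simp)+

lemma emeasure_translate:
  assumes "A \<in> sets borel"
  shows "emeasure m ((\<lambda>y. a + y) -` A) = emeasure m A"
proof -
  have "distr m borel (\<lambda>y. a + y) = m"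
    using haar by (simp add: normalized_haar_def)
  moreover have "(\<lambda>y. a + y) \<in> measurable m borel"
    by (intro continuous_measurable continuous_intros)
  ultimately show ?thesis
    using emeasure_distr[of "\<lambda>y. a + y" m borel A] assms by simp
qed

lemma finite_translates_cover:
  assumes "open V" "0 \<in> V"
  obtains F where "finite F" "\<And>x. \<exists>y\<in>F. x - y \<in> (V :: 'g set)"
proof -
  have "open ((\<lambda>x. x - y) -` V)" for y
    by (intro open_vimage assms continuous_intros)
  moreover have "UNIV \<subseteq> (\<Union>y. (\<lambda>x. x - y) -` V)"
  proof
    fix x :: 'g
    have "x \<in> (\<lambda>z. z - x) -` V"
      using assms(2) by simp
    then show "x \<in> (\<Union>y. (\<lambda>x. x - y) -` V)"
      by blast
  qed
  ultimately obtain F where "finite F" and F: "UNIV \<subseteq> (\<Union>y\<in>F. (\<lambda>x. x - y) -` V)"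
    by (rule compactE_image[OF compact_group, of UNIV "\<lambda>y. (\<lambda>x. x - y) -` V"])
  have "\<exists>y\<in>F. x - y \<in> V" for x
    using subsetD[OF F UNIV_I[of x]] by simp
  with \<open>finite F\<close> show ?thesis
    by (rule that)
qed

text \<open>
  Finitely many translates of a non-empty open set cover the group, and they all have the same measure.
\<close>

lemma open_measure_pos:
  assumes "open U" "x \<in> U"
  shows "emeasure m U \<noteq> 0"
proof
  assume 0: "emeasure m U = 0"
  define V where "V = (\<lambda>y. x + y) -` U"
  have V: "open V" "0 \<in> V"
    using assms by (auto simp: V_def intro!: open_vimage continuous_intros)
  obtain F where F: "finite F" "\<And>x. \<exists>y\<in>F. x - y \<in> V"
    using finite_translates_cover[OF V] by blast
  have null: "emeasure m ((\<lambda>z. - y + z) -` V) = 0" for y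
    using V 0 assms by (subst emeasure_translate) (auto simp: V_def emeasure_translate)
  have "emeasure m UNIV \<le> emeasure m (\<Union>y\<in>F. (\<lambda>z. - y + z) -` V)"
    using F(2) V
    by (intro emeasure_mono)
      (auto intro!: sets.finite_UN F(1) borel_open open_vimage continuous_intros)
  also have "\<dots> \<le> (\<Sum>y\<in>F. emeasure m ((\<lambda>z. - y + z) -` V))"
    by (intro emeasure_subadditive_finite F(1))
       (auto intro!: borel_open open_vimage continuous_intros V)
  also have "\<dots> = 0"
    using null by simp
  finally show False
    using emeasure_space_1 by simp
qed

lemma integral_zero_imp_zero:
  fixes h :: "'g \<Rightarrow> real"
  assumes "continuous_on UNIV h" "\<And>x. 0 \<le> h x" "(\<integral>x. h x \<partial>m) \<le> 0"
  shows "h x = 0"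
proof (rule ccontr)
  assume "h x \<noteq> 0"
  define U where "U = h -` (- {0})"
  have "open U"
    unfolding U_def by (rule open_vimage[OF _ assms(1)]) (simp add: open_Compl)
  then have pos: "emeasure m U \<noteq> 0"
    by (rule open_measure_pos[of _ x]) (simp add: U_def \<open>h x \<noteq> 0\<close>)
  have "(\<integral>x. h x \<partial>m) = 0"
    using assms(3) Bochner_Integration.integral_nonneg[of m h, OF assms(2)] by linarith
  then have "AE x in m. h x = 0"
    using integral_nonneg_eq_0_iff_AE[OF continuous_integrable[OF assms(1)]] assms(2) by simp
  then have "AE x in m. x \<notin> U"
    by eventually_elim (simp add: U_def)
  moreover have "U \<in> sets m"
    using \<open>open U\<close> by simp
  ultimately have "U \<in> null_sets m"
    by (simp add: AE_iff_null_sets)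
  with pos show False
    by (simp add: null_sets_def)
qed

text \<open>
  The triples at which the estimate fails form a compact set. Its projection to the last coordinate is closed and
  does not contain \<open>0\<close>, so its complement is a neighbourhood that serves all \<open>x\<close> and \<open>y\<close> at once.
\<close>

lemma uniformly_continuous_first:
  fixes f :: "'g \<times> 'g \<Rightarrow> 'b::metric_space"
  assumes "continuous_on UNIV f" "0 < e"
  obtains V where "open V" "0 \<in> V" "\<And>x y v. v \<in> V \<Longrightarrow> dist (f (x + v, y)) (f (x, y)) < e"
proof -
  define C where "C = {p :: ('g \<times> 'g) \<times> 'g. e \<le> dist (f (fst (fst p) + snd p, snd (fst p))) (f (fst p))}"
  have "closed C"
    unfolding C_def
    by (intro closed_Collect_le continuous_intros continuous_on_compose2[OF assms(1)]) auto
  moreover have "compact (UNIV :: (('g \<times> 'g) \<times> 'g) set)"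
    using compact_Times[OF compact_Times[OF compact_group compact_group] compact_group] by simp
  ultimately have "compact C"
    using compact_Int_closed[of UNIV C] by simp
  then have "closed (snd ` C)"
    by (intro compact_imp_closed compact_continuous_image continuous_intros)
  then have "open (- snd ` C)"
    by auto
  moreover have "0 \<in> - snd ` C"
    using assms(2) by (auto simp: C_def)
  moreover have "dist (f (x + v, y)) (f (x, y)) < e" if "v \<in> - snd ` C" for x y v
  proof -
    have "((x, y), v) \<notin> C"
      using that imageI[of "((x, y), v)" C snd] by auto
    then show ?thesis
      by (simp add: C_def not_le)
  qed
  ultimately show ?thesis
    by (rule that)
qed

lemma uniformly_continuous_group:
  fixes f :: "'g \<Rightarrow> 'b::metric_space"
  assumes "continuous_on UNIV f" "0 < e"
  obtains V where "open V" "0 \<in> V" "\<And>x v. v \<in> V \<Longrightarrow> dist (f (x + v)) (f x) < e"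
proof -
  have "continuous_on UNIV (\<lambda>p :: 'g \<times> 'g. f (fst p))"
    by (intro continuous_on_compose2[OF assms(1)] continuous_intros) auto
  then obtain V where "open V" "0 \<in> V"
    "\<And>x y v. v \<in> V \<Longrightarrow> dist (f (fst (x + v, y :: 'g))) (f (fst (x, y))) < e"
    by (rule uniformly_continuous_first[OF _ assms(2)]) (rule that)
  then show ?thesis
    by (intro that) simp_all
qed

lemma equicontinuous_imp_continuous:
  fixes f :: "'g \<Rightarrow> 'b::metric_space"
  assumes "\<And>e. 0 < e \<Longrightarrow> \<exists>V. open V \<and> 0 \<in> V \<and> (\<forall>x. \<forall>v\<in>V. dist (f (x + v)) (f x) \<le> e)"
  shows "continuous_on UNIV f"
  unfolding continuous_on_eq_continuous_at[OF open_UNIV]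
proof
  fix x
  show "isCont f x"
    unfolding continuous_at tendsto_iff
  proof (intro allI impI)
    fix e :: real assume "0 < e"
    then have "0 < e / 2"
      by simp
    from assms[OF this] obtain V
      where V: "open V" "0 \<in> V" "\<forall>x. \<forall>v\<in>V. dist (f (x + v)) (f x) \<le> e / 2"
      by (elim exE conjE) (rule that)
    have "open ((\<lambda>z. z - x) -` V)"
      by (rule open_vimage[OF V(1)]) (intro continuous_intros)
    moreover have "x \<in> (\<lambda>z. z - x) -` V"
      using V(2) by simp
    ultimately have "\<forall>\<^sub>F z in nhds x. z \<in> (\<lambda>z. z - x) -` V"
      by (rule eventually_nhds_in_open)
    then have "\<forall>\<^sub>F z in at x. z \<in> (\<lambda>z. z - x) -` V"
      by (simp add: eventually_nhds_conv_at)
    then show "\<forall>\<^sub>F z in at x. dist (f z) (f x) < e"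
    proof eventually_elim
      case (elim z)
      then have "dist (f (x + (z - x))) (f x) \<le> e / 2"
        using V(3) by blast
      then show ?case
        using \<open>0 < e\<close> by simp
    qed
  qed
qed

text \<open>
  The group need not be separable. Equicontinuity supplies, for each tolerance \<open>1/k\<close>, a finite net that works
  for all members of the sequence; the diagonal argument runs on the countable union of these nets.
\<close>

lemma Arzela_Ascoli_group:
  fixes f :: "nat \<Rightarrow> 'g \<Rightarrow> 'b::{heine_borel, banach}"
  assumes bound: "\<And>n x. norm (f n x) \<le> B"
    and equi: "\<And>e. 0 < e \<Longrightarrow>
      \<exists>V. open V \<and> 0 \<in> V \<and> (\<forall>n x. \<forall>v\<in>V. dist (f n (x + v)) (f n x) \<le> e)"
  obtains r g where "strict_mono (r :: nat \<Rightarrow> nat)"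
    "uniform_limit UNIV (\<lambda>n. f (r n)) g sequentially"
proof -
  have "\<exists>F. finite F \<and> (\<forall>x. \<exists>y\<in>F. \<forall>n. dist (f n x) (f n y) \<le> e)" if e: "0 < e" for e
  proof -
    obtain V where V: "open V" "0 \<in> V" "\<And>n x v. v \<in> V \<Longrightarrow> dist (f n (x + v)) (f n x) \<le> e"
      using equi[OF e] by auto
    obtain F where "finite F" "\<And>x. \<exists>y\<in>F. x - y \<in> V"
      using finite_translates_cover[OF V(1,2)] by blast
    moreover have "dist (f n x) (f n y) \<le> e" if "x - y \<in> V" for n x y
      using V(3)[OF that, of n y] by simp
    ultimately have "finite F \<and> (\<forall>x. \<exists>y\<in>F. \<forall>n. dist (f n x) (f n y) \<le> e)"
      by meson
    then show ?thesis ..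
  qed
  then have "\<forall>e\<in>{0<..}. \<exists>F. finite F \<and> (\<forall>x. \<exists>y\<in>F. \<forall>n. dist (f n x) (f n y) \<le> e)"
    by simp
  from bchoice[OF this] obtain F where
    "\<forall>e\<in>{0<..}. finite (F e) \<and> (\<forall>x. \<exists>y\<in>F e. \<forall>n. dist (f n x) (f n y) \<le> e)" ..
  then have F: "finite (F e)" "\<exists>y\<in>F e. \<forall>n. dist (f n x) (f n y) \<le> e" if "0 < e" for e x
    using that by simp_all
  define S where "S = (\<Union>k. F (inverse (real (Suc k))))"
  have "countable S"
    unfolding S_def using countable_finite[OF F(1)] by (intro countable_UN) simp_all
  obtain r where r: "strict_mono (r :: nat \<Rightarrow> nat)"
    "\<And>x. x \<in> S \<Longrightarrow> \<exists>l. (\<lambda>n. f (r n) x) \<longlonglongrightarrow> l"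
  proof (rule function_convergent_subsequence)
    show "countable S" by fact
    show "norm (f n x) \<le> B" for n x
      by (rule bound)
  next
    fix k :: "nat \<Rightarrow> nat"
    assume "strict_mono k" "\<And>x. x \<in> S \<Longrightarrow> \<exists>l. (\<lambda>n. f (k n) x) \<longlonglongrightarrow> l"
    then show thesis
      by (rule that)
  qed
  have "uniformly_Cauchy_on UNIV (\<lambda>n. f (r n))"
    unfolding uniformly_Cauchy_on_def
  proof (intro allI impI)
    fix e :: real assume "0 < e"
    then have "0 < e / 4"
      by simp
    from reals_Archimedean[OF this] obtain k where k: "inverse (real (Suc k)) < e / 4" ..
    define F' where "F' = F (inverse (real (Suc k)))"
    have "finite F'"
      unfolding F'_def by (rule F(1)) simp
    have F': "\<exists>y\<in>F'. \<forall>n. dist (f n x) (f n y) < e / 4" for x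
    proof -
      have "0 < inverse (real (Suc k))"
        by simp
      from F(2)[OF this, of x] obtain y
        where y: "y \<in> F (inverse (real (Suc k)))"
          "\<forall>n. dist (f n x) (f n y) \<le> inverse (real (Suc k))" ..
      show ?thesis
      proof (intro bexI allI)
        show "dist (f n x) (f n y) < e / 4" for n
          using spec[OF y(2), of n] k by linarith
        show "y \<in> F'"
          unfolding F'_def by (rule y(1))
      qed
    qed
    have "F' \<subseteq> S"
      by (auto simp: S_def F'_def)
    have "\<forall>y\<in>F'. \<exists>M. \<forall>i\<ge>M. \<forall>j\<ge>M. dist (f (r i) y) (f (r j) y) < e / 4"
    proof
      fix y assume "y \<in> F'"
      then have "Cauchy (\<lambda>n. f (r n) y)"
        using r(2)[of y] \<open>F' \<subseteq> S\<close> LIMSEQ_imp_Cauchy by blast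
      from this \<open>0 < e / 4\<close> show "\<exists>M. \<forall>i\<ge>M. \<forall>j\<ge>M. dist (f (r i) y) (f (r j) y) < e / 4"
        by (rule metric_CauchyD)
    qed
    from bchoice[OF this] obtain M where
      "\<forall>y\<in>F'. \<forall>i\<ge>M y. \<forall>j\<ge>M y. dist (f (r i) y) (f (r j) y) < e / 4" ..
    then have M: "dist (f (r i) y) (f (r j) y) < e / 4" if "y \<in> F'" "M y \<le> i" "M y \<le> j" for y i j
      using that by blast
    have "dist (f (r i) x) (f (r j) x) < e"
      if ij: "Max (insert 0 (M ` F')) \<le> i" "Max (insert 0 (M ` F')) \<le> j" for i j x
    proof -
      obtain y where y: "y \<in> F'" "\<And>n. dist (f n x) (f n y) < e / 4"
        using F' by blast
      have "M y \<le> Max (insert 0 (M ` F'))"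
        using \<open>finite F'\<close> y(1) by (intro Max_ge) auto
      then have "dist (f (r i) y) (f (r j) y) < e / 4"
        using ij M[OF y(1)] by auto
      moreover have "dist (f (r i) x) (f (r j) x) \<le>
          dist (f (r i) x) (f (r i) y) + dist (f (r i) y) (f (r j) y) + dist (f (r j) x) (f (r j) y)"
        using dist_triangle[of "f (r i) x" "f (r j) x" "f (r i) y"]
          dist_triangle2[of "f (r i) y" "f (r j) x" "f (r j) y"] by linarith
      ultimately show ?thesis
        using y(2)[of "r i"] y(2)[of "r j"] \<open>0 < e\<close> by linarith
    qed
    then show "\<exists>M. \<forall>x\<in>UNIV. \<forall>i\<ge>M. \<forall>j\<ge>M. dist (f (r i) x) (f (r j) x) < e"
      by blast
  qed
  then have "uniformly_convergent_on UNIV (\<lambda>n. f (r n))"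
    by (rule Cauchy_uniformly_convergent)
  then obtain g where "uniform_limit UNIV (\<lambda>n. f (r n)) g sequentially"
    unfolding uniformly_convergent_on_def ..
  with r(1) show ?thesis
    by (rule that)
qed

end

section \<open>Convolution operators\<close>

context compact_haar begin

lemma prob_UNIV [simp]: "prob UNIV = 1"
  using prob_space by simp

text \<open>
  If the group has no countable base, its square may have more Borel sets than the product
  \<open>\<sigma>\<close>-algebra, so continuity alone does not give measurability. A uniform limit argument does: the
  approximants see the first coordinate only through a measurable index with finitely many values.
\<close>

lemma continuous_pair_measurable:
  fixes f :: "'g \<times> 'g \<Rightarrow> complex"
  assumes "continuous_on UNIV f"
  shows "f \<in> borel_measurable (m \<Otimes>\<^sub>M m)"
proof -
  define e where "e n = inverse (real (Suc n))" for n
  have e: "0 < e n" for n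
    by (simp add: e_def)
  have "\<exists>g \<in> borel_measurable (m \<Otimes>\<^sub>M m). \<forall>p. dist (g p) (f p) < e n" for n
  proof -
    obtain V where V: "open V" "0 \<in> V" "\<And>x y v. v \<in> V \<Longrightarrow> dist (f (x + v, y)) (f (x, y)) < e n"
      by (rule uniformly_continuous_first[OF assms, of "e n"]) (rule e, rule that)
    obtain F where F: "finite F" "\<And>x. \<exists>y\<in>F. x - y \<in> V"
      by (rule finite_translates_cover[OF V(1,2)]) (rule that)
    obtain ys where ys: "set ys = F"
      using finite_list[OF F(1)] ..
    define i where "i x = (LEAST i. i < length ys \<and> x - ys ! i \<in> V)" for x
    have i: "x - ys ! i x \<in> V" for x
    proof -
      have "\<exists>j<length ys. x - ys ! j \<in> V"
        using F(2)[of x] unfolding ys[symmetric] by (metis in_set_conv_nth)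
      then show ?thesis
        unfolding i_def by (rule exE) (drule LeastI, elim conjE)
    qed
    have "i \<in> measurable m (count_space UNIV)"
      unfolding i_def
    proof (rule measurable_Least)
      fix j
      have "(\<lambda>x. x - ys ! j) -` V \<in> sets m"
        by (simp add: borel_open open_vimage[OF V(1)] continuous_intros)
      moreover have "{x \<in> space m. x - ys ! j \<in> V} = (\<lambda>x. x - ys ! j) -` V"
        by auto
      ultimately have "Measurable.pred m (\<lambda>x. x - ys ! j \<in> V)"
        by (simp add: Measurable.pred_def)
      then show "Measurable.pred m (\<lambda>x. j < length ys \<and> x - ys ! j \<in> V)"
        by measurable
    qed
    then have i_meas: "(\<lambda>p. i (fst p)) \<in> measurable (m \<Otimes>\<^sub>M m) (count_space UNIV)"
      by measurable
    have "(\<lambda>p. f (ys ! j, snd p)) \<in> borel_measurable (m \<Otimes>\<^sub>M m)" for j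
    proof -
      have "continuous_on UNIV (\<lambda>y. f (ys ! j, y))"
        by (rule continuous_on_compose2[OF assms]) (auto intro: continuous_intros)
      then have [measurable]: "(\<lambda>y. f (ys ! j, y)) \<in> borel_measurable m"
        by (rule continuous_measurable)
      show ?thesis
        by measurable
    qed
    then have "(\<lambda>p. f (ys ! (i (fst p)), snd p)) \<in> borel_measurable (m \<Otimes>\<^sub>M m)"
      by (rule measurable_compose_countable[OF _ i_meas])
    moreover have "dist (f (ys ! i (fst p), snd p)) (f p) < e n" for p
      using V(3)[OF i[of "fst p"], of "ys ! i (fst p)" "snd p"]
      by (simp add: dist_commute)
    ultimately show ?thesis
      by (intro bexI[where x = "\<lambda>p. f (ys ! (i (fst p)), snd p)"] allI)
  qed
  then have "\<forall>n. \<exists>g. g \<in> borel_measurable (m \<Otimes>\<^sub>M m) \<and> (\<forall>p. dist (g p) (f p) < e n)"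
    by blast
  from choice[OF this] obtain g where
    g: "\<forall>n. g n \<in> borel_measurable (m \<Otimes>\<^sub>M m) \<and> (\<forall>p. dist (g n p) (f p) < e n)" ..
  have dist_g: "dist (g n p) (f p) < e n" for n p
    using g by blast
  have "(\<lambda>n. g n p) \<longlonglongrightarrow> f p" for p
  proof (rule tendsto_dist_iff[THEN iffD2], rule tendsto_sandwich)
    show "\<forall>\<^sub>F n in sequentially. 0 \<le> dist (g n p) (f p)"
      by simp
    show "\<forall>\<^sub>F n in sequentially. dist (g n p) (f p) \<le> e n"
      using dist_g by (intro always_eventually allI less_imp_le)
    show "e \<longlonglongrightarrow> 0"
      unfolding e_def by (rule LIMSEQ_inverse_real_of_nat)
  qed simp
  then show ?thesis
    by (rule borel_measurable_LIMSEQ_metric[rotated]) (use g in blast)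
qed

lemma integral_swap:
  fixes f :: "'g \<times> 'g \<Rightarrow> complex"
  assumes "continuous_on UNIV f"
  shows "(\<integral>x. (\<integral>y. f (x, y) \<partial>m) \<partial>m) = (\<integral>y. (\<integral>x. f (x, y) \<partial>m) \<partial>m)"
proof -
  have "compact (range f)"
    using compact_Times[OF compact_group compact_group]
    by (intro compact_continuous_image assms) simp
  then obtain B where B: "\<And>p. norm (f p) \<le> B"
    using compact_imp_bounded[of "range f"] by (auto simp: bounded_iff)
  have "integrable (m \<Otimes>\<^sub>M m) f"
    by (rule pair.integrable_const_bound[OF _ continuous_pair_measurable[OF assms]])
      (use B in \<open>intro always_eventually allI\<close>)
  then have "integrable (m \<Otimes>\<^sub>M m) (case_prod (\<lambda>x y. f (x, y)))"
    by simp
  from pair.Fubini_integral[OF this] show ?thesis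
    by simp
qed

definition conv :: "('g \<Rightarrow> complex) \<Rightarrow> ('g \<Rightarrow> complex) \<Rightarrow> 'g \<Rightarrow> complex" where
  "conv k g x = (\<integral>y. k (x - y) * g y \<partial>m)"

definition sqnorm :: "('g \<Rightarrow> complex) \<Rightarrow> real" where
  "sqnorm g = (\<integral>x. (norm (g x))\<^sup>2 \<partial>m)"

lemma sqnorm_nonneg: "0 \<le> sqnorm g"
  by (simp add: sqnorm_def)

lemma conv_integrand_integrable:
  fixes k g :: "'g \<Rightarrow> complex"
  assumes "continuous_on UNIV k" "continuous_on UNIV g"
  shows "integrable m (\<lambda>y. k (x - y) * g y)"
  by (rule continuous_integrable) (rule continuous_on_mult continuous_translate(4)[OF assms(1)] assms(2))+

text \<open>
  The variance of \<open>|g|\<close> is non-negative.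
\<close>

lemma integral_norm_le_sqrt_sqnorm:
  assumes "continuous_on UNIV g"
  shows "(\<integral>x. norm (g x) \<partial>m) \<le> sqrt (sqnorm g)"
proof -
  define c where "c = (\<integral>x. norm (g x) \<partial>m)"
  have i: "integrable m (\<lambda>x. norm (g x))" "integrable m (\<lambda>x. (norm (g x))\<^sup>2)"
    by (intro continuous_integrable continuous_intros assms)+
  have "0 \<le> (\<integral>x. (norm (g x) - c)\<^sup>2 \<partial>m)"
    by simp
  also have "\<dots> = (\<integral>x. (norm (g x))\<^sup>2 - 2 * c * norm (g x) + c\<^sup>2 \<partial>m)"
    by (simp add: power2_diff algebra_simps)
  also have "\<dots> = sqnorm g - 2 * c * c + c\<^sup>2"
    using i by (simp add: sqnorm_def c_def[symmetric] prob_space)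
  finally have "c\<^sup>2 \<le> sqnorm g"
    by (simp add: power2_eq_square)
  then show ?thesis
    unfolding c_def by (rule real_le_rsqrt)
qed

lemma norm_integral_mult_le:
  fixes k g :: "'g \<Rightarrow> complex"
  assumes k: "continuous_on UNIV k" and g: "continuous_on UNIV g" and B: "\<And>y. norm (k y) \<le> B"
  shows "norm (\<integral>y. k y * g y \<partial>m) \<le> B * sqrt (sqnorm g)"
proof -
  have "0 \<le> B"
    using B[of 0] norm_ge_zero order_trans by blast
  have "norm (\<integral>y. k y * g y \<partial>m) \<le> (\<integral>y. norm (k y * g y) \<partial>m)"
    by (rule integral_norm_bound)
  also have "\<dots> \<le> (\<integral>y. B * norm (g y) \<partial>m)"
  proof (rule integral_mono)
    show "integrable m (\<lambda>y. norm (k y * g y))" "integrable m (\<lambda>y. B * norm (g y))"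
      by (intro continuous_integrable continuous_intros k g)+
    show "norm (k y * g y) \<le> B * norm (g y)" for y
      using mult_right_mono[OF B[of y] norm_ge_zero[of "g y"]] by (simp add: norm_mult)
  qed
  also have "\<dots> \<le> B * sqrt (sqnorm g)"
    using integral_norm_le_sqrt_sqnorm[OF g] \<open>0 \<le> B\<close> by (simp add: mult_left_mono)
  finally show ?thesis .
qed

text \<open>
  Uniform continuity of \<open>F\<close> in the first variable gives equicontinuity of the integral; applied below to
  \<open>F (x, y) = k (x - y)\<close> (convolution) and \<open>F (x, y) = g (x + y)\<close> (correlation).
\<close>

lemma continuous_parameter_integral:
  fixes F :: "'g \<times> 'g \<Rightarrow> complex"
  assumes F: "continuous_on UNIV F" and g: "continuous_on UNIV g"
  shows "continuous_on UNIV (\<lambda>x. \<integral>y. F (x, y) * g y \<partial>m)"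
proof (rule equicontinuous_imp_continuous)
  fix e :: real assume "0 < e"
  define s where "s = sqrt (sqnorm g)"
  have s: "0 \<le> s"
    by (simp add: s_def sqnorm_nonneg)
  define d where "d = e / (s + 1)"
  have d: "0 < d" "d * s \<le> e"
    using \<open>0 < e\<close> s by (simp_all add: d_def divide_le_eq add_nonneg_pos distrib_left)
  obtain V where V: "open V" "0 \<in> V" "\<And>x y v. v \<in> V \<Longrightarrow> dist (F (x + v, y)) (F (x, y)) < d"
    by (rule uniformly_continuous_first[OF F d(1)]) (rule that)
  have cF: "continuous_on UNIV (\<lambda>y. F (x, y))" for x
    by (rule continuous_on_compose2[OF F]) (auto intro: continuous_intros)
  have int: "integrable m (\<lambda>y. F (x, y) * g y)" for x
    by (intro continuous_integrable continuous_on_mult cF g)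
  have "dist (\<integral>y. F (x + v, y) * g y \<partial>m) (\<integral>y. F (x, y) * g y \<partial>m) \<le> e" if v: "v \<in> V" for x v
  proof -
    have "norm (\<integral>y. (F (x + v, y) - F (x, y)) * g y \<partial>m) \<le> d * sqrt (sqnorm g)"
      by (rule norm_integral_mult_le[OF continuous_on_diff[OF cF cF] g])
        (use V(3)[OF v] in \<open>simp add: dist_norm less_imp_le\<close>)
    then show ?thesis
      using d(2) int by (simp add: dist_norm left_diff_distrib s_def)
  qed
  with V(1,2) show "\<exists>V. open V \<and> 0 \<in> V \<and>
      (\<forall>x. \<forall>v\<in>V. dist (\<integral>y. F (x + v, y) * g y \<partial>m) (\<integral>y. F (x, y) * g y \<partial>m) \<le> e)"
    by (intro exI[of _ V]) simp
qed

lemma conv_bound: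
  assumes "continuous_on UNIV k" "continuous_on UNIV g" "\<And>x. norm (k x) \<le> B"
  shows "norm (conv k g x) \<le> B * sqrt (sqnorm g)"
  unfolding conv_def
  by (rule norm_integral_mult_le[OF continuous_translate(4)[OF assms(1)] assms(2,3)])

lemma conv_diff_bound:
  assumes k: "continuous_on UNIV k" and g: "continuous_on UNIV g" and e: "\<And>x. dist (k (x + v)) (k x) \<le> e"
  shows "dist (conv k g (x + v)) (conv k g x) \<le> e * sqrt (sqnorm g)"
proof -
  have shift: "x + v - y = x - y + v" for y
    by (simp add: algebra_simps)
  have "norm (k (x + v - y) - k (x - y)) \<le> e" for y
    using e[of "x - y"] by (simp only: dist_norm shift)
  then have "norm (\<integral>y. (k (x + v - y) - k (x - y)) * g y \<partial>m) \<le> e * sqrt (sqnorm g)"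
    by (intro norm_integral_mult_le continuous_on_diff continuous_translate(4)[OF k] g)
  then show ?thesis
    by (simp add: conv_def dist_norm conv_integrand_integrable k g left_diff_distrib)
qed

lemma continuous_conv:
  assumes k: "continuous_on UNIV k" and g: "continuous_on UNIV g"
  shows "continuous_on UNIV (conv k g)"
proof -
  have "continuous_on UNIV (\<lambda>p. k (fst p - snd p))"
    by (intro continuous_on_compose2[OF k] continuous_intros) auto
  from continuous_parameter_integral[OF this g] show ?thesis
    by (simp add: conv_def[abs_def])
qed

lemma conv_add:
  assumes "continuous_on UNIV k" "continuous_on UNIV g" "continuous_on UNIV h"
  shows "conv k (\<lambda>x. g x + h x) x = conv k g x + conv k h x"
  unfolding conv_def using assms by (simp add: distrib_left conv_integrand_integrable)

lemma conv_scale: "conv k (\<lambda>x. c * g x) x = c * conv k g x"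
  unfolding conv_def by (subst integral_mult_right_zero[symmetric]) (simp add: mult_ac)

lemma conv_translate:
  assumes "continuous_on UNIV k" "continuous_on UNIV g"
  shows "conv k (\<lambda>x. g (x + a)) x = conv k g (x + a)"
proof -
  have "conv k g (x + a) = (\<integral>y. k (x + a - y) * g y \<partial>m)"
    by (simp add: conv_def)
  also have "\<dots> = (\<integral>y. k (x + a - (a + y)) * g (a + y) \<partial>m)"
    by (rule integral_translate[symmetric])
      (intro continuous_measurable continuous_intros continuous_translate assms)
  finally show ?thesis
    by (simp add: conv_def add.commute diff_diff_eq)
qed

definition inner_m :: "('g \<Rightarrow> complex) \<Rightarrow> ('g \<Rightarrow> complex) \<Rightarrow> complex" where
  "inner_m g h = (\<integral>x. g x * cnj (h x) \<partial>m)"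

lemma inner_self: "inner_m g g = complex_of_real (sqnorm g)"
  unfolding inner_m_def sqnorm_def complex_norm_square[symmetric]
  by (simp flip: of_real_power)

lemma conv_selfadjoint:
  assumes "continuous_on UNIV k" "\<And>x. k (- x) = cnj (k x)" "continuous_on UNIV g" "continuous_on UNIV h"
  shows "inner_m (conv k g) h = inner_m g (conv k h)"
proof -
  have "continuous_on UNIV (\<lambda>p. k (fst p - snd p) * g (snd p) * cnj (h (fst p)))"
    by (intro continuous_intros continuous_on_compose2[OF assms(1)] continuous_on_compose2[OF assms(3)]
        continuous_on_compose2[OF assms(4)]) auto
  note swap = integral_swap[OF this]
  have "inner_m (conv k g) h = (\<integral>x. (\<integral>y. k (x - y) * g y * cnj (h x) \<partial>m) \<partial>m)"
    by (simp add: inner_m_def conv_def)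
  also have "\<dots> = (\<integral>y. (\<integral>x. k (x - y) * g y * cnj (h x) \<partial>m) \<partial>m)"
    using swap by simp
  also have "\<dots> = (\<integral>y. g y * cnj (conv k h y) \<partial>m)"
  proof (rule Bochner_Integration.integral_cong[OF refl])
    fix y
    have "(\<lambda>x. k (x - y) * g y * cnj (h x)) = (\<lambda>x. g y * cnj (k (y - x) * h x))"
    proof
      fix x
      show "k (x - y) * g y * cnj (h x) = g y * cnj (k (y - x) * h x)"
        using assms(2)[of "y - x"] by simp
    qed
    then show "(\<integral>x. k (x - y) * g y * cnj (h x) \<partial>m) = g y * cnj (conv k h y)"
      unfolding conv_def
      by (simp only: integral_mult_right_zero Bochner_Integration.integral_cnj)
  qed
  finally show ?thesis
    by (simp add: inner_m_def)
qed

lemma sqnorm_scale: "sqnorm (\<lambda>x. c * f x) = (norm c)\<^sup>2 * sqnorm f"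
  by (simp add: sqnorm_def norm_mult power_mult_distrib)

lemma sqnorm_le_bound:
  assumes "\<And>x. norm (f x) \<le> B" "continuous_on UNIV f"
  shows "sqnorm f \<le> B\<^sup>2"
proof -
  have "sqnorm f \<le> (\<integral>x. B\<^sup>2 \<partial>m)"
    unfolding sqnorm_def
    by (intro integral_mono continuous_integrable continuous_intros assms power_mono) auto
  then show ?thesis
    by (simp add: prob_space)
qed

lemma sqnorm_zero_imp:
  assumes "continuous_on UNIV f" "sqnorm f \<le> 0"
  shows "f x = 0"
  using integral_zero_imp_zero[of "\<lambda>x. (norm (f x))\<^sup>2" x] assms
  by (simp add: sqnorm_def continuous_intros)

lemma sqnorm_diff_scale:
  assumes "continuous_on UNIV f" "continuous_on UNIV g"
  shows "sqnorm (\<lambda>x. f x - complex_of_real c * g x) = sqnorm f - 2 * c * Re (inner_m f g) + c\<^sup>2 * sqnorm g"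
proof -
  have i: "integrable m (\<lambda>x. (norm (f x))\<^sup>2)" "integrable m (\<lambda>x. (norm (g x))\<^sup>2)"
    "integrable m (\<lambda>x. f x * cnj (g x))"
    by (intro continuous_integrable continuous_intros assms)+
  have "(norm (f x - complex_of_real c * g x))\<^sup>2 =
      (norm (f x))\<^sup>2 - 2 * c * Re (f x * cnj (g x)) + c\<^sup>2 * (norm (g x))\<^sup>2" for x
    unfolding cmod_power2 by (simp add: power2_eq_square algebra_simps)
  moreover have "integrable m (\<lambda>x. Re (f x * cnj (g x)))"
    using i(3) by (rule integrable_Re)
  ultimately have "sqnorm (\<lambda>x. f x - complex_of_real c * g x) =
      sqnorm f - 2 * c * (\<integral>x. Re (f x * cnj (g x)) \<partial>m) + c\<^sup>2 * sqnorm g"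
    using i by (simp add: sqnorm_def del: complex_cnj_mult times_complex.simps)
  moreover have "(\<integral>x. Re (f x * cnj (g x)) \<partial>m) = Re (inner_m f g)"
    unfolding inner_m_def by (rule integral_Re[OF i(3)])
  ultimately show ?thesis
    by simp
qed

lemma inner_m_bound:
  assumes "continuous_on UNIV f" "continuous_on UNIV g" "\<And>x. norm (f x) \<le> B"
  shows "norm (inner_m f g) \<le> B * sqrt (sqnorm g)"
  using norm_integral_mult_le[OF assms(1) continuous_on_cnj[OF assms(2)] assms(3)]
  by (simp add: inner_m_def sqnorm_def)

lemma conv_diff:
  assumes "continuous_on UNIV k" "continuous_on UNIV g" "continuous_on UNIV h"
  shows "conv k (\<lambda>x. g x - h x) x = conv k g x - conv k h x"
  unfolding conv_def using assms by (simp add: right_diff_distrib conv_integrand_integrable)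

lemma uniform_limit_conv:
  assumes k: "continuous_on UNIV k" and f: "\<And>n. continuous_on UNIV (f n)"
    and lim: "uniform_limit UNIV f h sequentially"
  shows "uniform_limit UNIV (\<lambda>n. conv k (f n)) (conv k h) sequentially"
proof (rule uniform_limitI)
  fix e :: real assume "0 < e"
  obtain B where B: "0 < B" "\<And>x. norm (k x) \<le> B"
    by (rule continuous_bounded[OF k]) (rule that)
  have h: "continuous_on UNIV h"
    by (rule uniform_limit_theorem[OF _ lim]) (simp_all add: f)
  have "0 < e / (2 * B)"
    using \<open>0 < e\<close> B(1) by simp
  from uniform_limitD[OF lim this]
  show "\<forall>\<^sub>F n in sequentially. \<forall>x\<in>UNIV. dist (conv k (f n) x) (conv k h x) < e"
  proof eventually_elim
    case (elim n)
    have "sqnorm (\<lambda>x. f n x - h x) \<le> (e / (2 * B))\<^sup>2"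
    proof (rule sqnorm_le_bound)
      show "norm (f n x - h x) \<le> e / (2 * B)" for x
        using elim by (auto simp: dist_norm intro: less_imp_le)
      show "continuous_on UNIV (\<lambda>x. f n x - h x)"
        by (intro continuous_intros f h)
    qed
    then have *: "sqrt (sqnorm (\<lambda>x. f n x - h x)) \<le> e / (2 * B)"
      using \<open>0 < e / (2 * B)\<close> by (intro real_le_lsqrt) (auto simp: sqnorm_nonneg)
    show ?case
    proof
      fix x
      have "norm (conv k (\<lambda>x. f n x - h x) x) \<le> B * sqrt (sqnorm (\<lambda>x. f n x - h x))"
        by (intro conv_bound continuous_intros k f h B(2))
      also have "\<dots> \<le> B * (e / (2 * B))"
        using * B(1) by (intro mult_left_mono) auto
      also have "\<dots> < e"
        using B(1) \<open>0 < e\<close> by simp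
      finally show "dist (conv k (f n) x) (conv k h x) < e"
        by (simp add: dist_norm conv_diff k f h)
    qed
  qed
qed

text \<open>
  Convolution with a continuous kernel is a compact operator from \<open>L\<^sub>2\<close> to the continuous functions: the
  modulus of continuity of \<open>k * g\<close> depends only on \<open>k\<close> and on the norm of \<open>g\<close>.
\<close>

lemma conv_Arzela_Ascoli:
  assumes k: "continuous_on UNIV k" and g: "\<And>n. continuous_on UNIV (g n)"
    and bound: "\<And>n. sqnorm (g n) \<le> C"
  obtains r h where "strict_mono (r :: nat \<Rightarrow> nat)"
    "uniform_limit UNIV (\<lambda>n. conv k (g (r n))) h sequentially"
proof -
  define D where "D = sqrt C + 1"
  have "0 \<le> C"
    using bound[of 0] sqnorm_nonneg order_trans by blast
  then have D: "0 < D" "\<And>n. sqrt (sqnorm (g n)) \<le> D"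
    using real_sqrt_le_mono[OF bound] unfolding D_def
    by (auto intro: add_nonneg_pos order_trans[OF _ less_imp_le[OF less_add_one]])
  obtain B where B: "0 < B" "\<And>x. norm (k x) \<le> B"
    by (rule continuous_bounded[OF k]) (rule that)
  show ?thesis
  proof (rule Arzela_Ascoli_group)
    show "norm (conv k (g n) x) \<le> B * D" for n x
      using conv_bound[OF k g B(2), of n x] mult_left_mono[OF D(2)[of n] less_imp_le[OF B(1)]]
      by linarith
  next
    fix e :: real assume "0 < e"
    then have "0 < e / D"
      using D(1) by simp
    obtain V where V: "open V" "0 \<in> V" "\<And>x v. v \<in> V \<Longrightarrow> dist (k (x + v)) (k x) < e / D"
      by (rule uniformly_continuous_group[OF k \<open>0 < e / D\<close>]) (rule that)
    have "dist (conv k (g n) (x + v)) (conv k (g n) x) \<le> e" if "v \<in> V" for n x v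
    proof -
      have "dist (conv k (g n) (x + v)) (conv k (g n) x) \<le> e / D * sqrt (sqnorm (g n))"
        by (rule conv_diff_bound[OF k g less_imp_le[OF V(3)[OF that]]])
      also have "\<dots> \<le> e / D * D"
        using \<open>0 < e / D\<close> D(2) by (intro mult_left_mono) auto
      finally show ?thesis
        using D(1) by simp
    qed
    with V(1,2) show "\<exists>V. open V \<and> 0 \<in> V \<and> (\<forall>n x. \<forall>v\<in>V. dist (conv k (g n) (x + v)) (conv k (g n) x) \<le> e)"
      by (intro exI[of _ V]) simp
  qed (rule that)
qed

text \<open>
  Let \<open>T\<close> be convolution with \<open>k\<close> and \<open>\<mu>\<close> the supremum of \<open>\<parallel>T g\<parallel>\<^sup>2\<close> over the unit ball. Since \<open>T\<close> is
  selfadjoint, \<open>\<parallel>T\<^sup>2 g - \<mu> g\<parallel>\<^sup>2 \<le> \<mu> (\<mu> - \<parallel>T g\<parallel>\<^sup>2)\<close> on the unit ball, so a maximising sequence consists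
  of approximate eigenfunctions of \<open>T\<^sup>2\<close>, and compactness turns them into a genuine one. Working with \<open>T\<^sup>2\<close>
  avoids deciding the sign of the extremal eigenvalue of \<open>T\<close>.
\<close>

lemma conv_square_eigenfunction:
  assumes k: "continuous_on UNIV k" and herm: "\<And>x. k (- x) = cnj (k x)"
    and g0: "continuous_on UNIV g0" "conv k g0 x0 \<noteq> 0"
  obtains g \<mu> where "continuous_on UNIV g" "0 < sqnorm g" "0 < \<mu>"
    "\<And>x. conv k (conv k g) x = complex_of_real \<mu> * g x"
proof -
  obtain B where B: "0 < B" "\<And>x. norm (k x) \<le> B"
    by (rule continuous_bounded[OF k]) (rule that)
  note ck = continuous_conv[OF k]
  define S where "S = {sqnorm (conv k g) | g. continuous_on UNIV g \<and> sqnorm g \<le> 1}"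
  have "sqnorm (conv k g) \<le> B\<^sup>2" if "continuous_on UNIV g" "sqnorm g \<le> 1" for g
  proof (rule sqnorm_le_bound)
    fix x
    have "sqrt (sqnorm g) \<le> 1"
      using that(2) by simp
    then have "B * sqrt (sqnorm g) \<le> B"
      using B(1) by (simp add: mult_left_le)
    then show "norm (conv k g x) \<le> B"
      using conv_bound[OF k that(1) B(2), of x] by linarith
  qed (rule ck[OF that(1)])
  then have bdd: "bdd_above S"
    by (auto simp: S_def intro!: bdd_aboveI[of _ "B\<^sup>2"])
  define \<mu> where "\<mu> = Sup S"
  have sup: "sqnorm (conv k g) \<le> \<mu> * sqnorm g" if g: "continuous_on UNIV g" for g
  proof (cases "sqnorm g = 0")
    case True
    then have "g y = 0" for y
      by (intro sqnorm_zero_imp g) simp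
    then have "conv k g = (\<lambda>_. 0)"
      by (simp add: conv_def fun_eq_iff)
    then show ?thesis
      using True by (simp add: sqnorm_def)
  next
    case False
    define c where "c = complex_of_real (1 / sqrt (sqnorm g))"
    have pos: "0 < sqnorm g"
      using False sqnorm_nonneg[of g] by simp
    then have nc: "(norm c)\<^sup>2 = 1 / sqnorm g"
      by (simp add: c_def norm_divide power_divide)
    have "sqnorm (conv k (\<lambda>x. c * g x)) \<in> S"
      unfolding S_def using g nc pos
      by (intro CollectI exI[of _ "\<lambda>x. c * g x"]) (auto simp: sqnorm_scale intro: continuous_intros)
    then have "sqnorm (conv k (\<lambda>x. c * g x)) \<le> \<mu>"
      unfolding \<mu>_def by (rule cSup_upper[OF _ bdd])
    moreover have "conv k (\<lambda>x. c * g x) = (\<lambda>x. c * conv k g x)"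
      by (simp add: conv_scale fun_eq_iff)
    ultimately have "sqnorm (conv k g) / sqnorm g \<le> \<mu>"
      by (simp add: sqnorm_scale nc)
    then show ?thesis
      using pos by (simp add: divide_le_eq)
  qed
  have "0 < sqnorm (conv k g0)"
    using sqnorm_zero_imp[OF ck[OF g0(1)], of x0] g0(2) by force
  with sup[OF g0(1)] have "0 < \<mu> * sqnorm g0"
    by linarith
  then have \<mu>: "0 < \<mu>"
    using sqnorm_nonneg[of g0] by (simp add: zero_less_mult_iff)
  have "\<exists>g. continuous_on UNIV g \<and> sqnorm g \<le> 1 \<and> \<mu> - inverse (real (Suc n)) < sqnorm (conv k g)" for n
  proof -
    have "sqnorm (conv k (\<lambda>_. 0)) \<in> S"
      unfolding S_def by (intro CollectI exI[of _ "\<lambda>_. 0"]) (simp add: sqnorm_def)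
    then have "\<exists>s\<in>S. \<mu> - inverse (real (Suc n)) < s"
      unfolding \<mu>_def by (intro less_cSupD) (auto simp del: of_nat_Suc)
    then show ?thesis
      by (auto simp: S_def)
  qed
  from choice[OF allI[OF this]] obtain g where
    "\<forall>n. continuous_on UNIV (g n) \<and> sqnorm (g n) \<le> 1 \<and> \<mu> - inverse (real (Suc n)) < sqnorm (conv k (g n))" ..
  then have g: "continuous_on UNIV (g n)" "sqnorm (g n) \<le> 1"
    "\<mu> - inverse (real (Suc n)) < sqnorm (conv k (g n))" for n
    by blast+
  define f where "f n = conv k (conv k (g n))" for n
  define d where "d n = (\<lambda>x. f n x - complex_of_real \<mu> * g n x)" for n
  have f: "continuous_on UNIV (f n)" for n
    unfolding f_def by (intro ck g)
  have d: "continuous_on UNIV (d n)" for n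
    unfolding d_def by (intro continuous_intros f g)
  have inner: "Re (inner_m (f n) (g n)) = sqnorm (conv k (g n))" for n
    unfolding f_def conv_selfadjoint[OF k herm ck[OF g(1)] g(1)] by (simp add: inner_self)
  have le: "sqnorm (conv k (g n)) \<le> \<mu>" for n
    using sup[OF g(1), of n] mult_left_mono[OF g(2)[of n] less_imp_le[OF \<mu>]] by simp
  have sqd: "sqnorm (d n) \<le> \<mu> * inverse (real (Suc n))" for n
  proof -
    have "sqnorm (d n) = sqnorm (f n) - 2 * \<mu> * sqnorm (conv k (g n)) + \<mu>\<^sup>2 * sqnorm (g n)"
      unfolding d_def by (subst sqnorm_diff_scale[OF f g(1)]) (simp add: inner)
    also have "\<dots> \<le> \<mu> * sqnorm (conv k (g n)) - 2 * \<mu> * sqnorm (conv k (g n)) + \<mu>\<^sup>2 * 1"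
      using sup[OF ck[OF g(1)], of n] mult_left_mono[OF g(2)[of n], of "\<mu>\<^sup>2"]
      unfolding f_def by simp
    also have "\<dots> = \<mu> * (\<mu> - sqnorm (conv k (g n)))"
      by (simp add: power2_eq_square algebra_simps)
    also have "\<dots> \<le> \<mu> * inverse (real (Suc n))"
      using g(3)[of n] \<mu> by (intro mult_left_mono) linarith+
    finally show ?thesis .
  qed
  obtain r h where r: "strict_mono r"
    and lim': "uniform_limit UNIV (\<lambda>n. conv k (conv k (g (r n)))) h sequentially"
    by (rule conv_Arzela_Ascoli[of k "\<lambda>n. conv k (g n)", OF k ck[OF g(1)] le]) (rule that)
  from lim' have lim: "uniform_limit UNIV (\<lambda>n. f (r n)) h sequentially"
    by (simp only: f_def)
  have h: "continuous_on UNIV h"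
    by (rule uniform_limit_theorem[OF _ lim]) (simp_all add: f)
  have inv0: "(\<lambda>n. inverse (real (Suc (r n)))) \<longlonglongrightarrow> 0"
    using LIMSEQ_subseq_LIMSEQ[OF LIMSEQ_inverse_real_of_nat r] by (simp add: o_def)
  have eig: "conv k (conv k h) x = complex_of_real \<mu> * h x" for x
  proof -
    have "uniform_limit UNIV (\<lambda>n. conv k (conv k (f (r n)))) (conv k (conv k h)) sequentially"
      by (intro uniform_limit_conv k ck f lim)
    then have 1: "(\<lambda>n. conv k (conv k (f (r n))) x) \<longlonglongrightarrow> conv k (conv k h) x"
      by (rule tendsto_uniform_limitI) simp
    have 2: "(\<lambda>n. f (r n) x) \<longlonglongrightarrow> h x"
      by (rule tendsto_uniform_limitI[OF lim]) simp
    have eq: "conv k (conv k (f n)) x - complex_of_real \<mu> * f n x = conv k (conv k (d n)) x" for n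
    proof -
      have 1: "conv k (d n) = (\<lambda>x. conv k (f n) x - complex_of_real \<mu> * conv k (g n) x)"
        unfolding d_def
        by (rule ext) (simp add: conv_diff conv_scale k f g continuous_intros)
      have "conv k (conv k (d n)) x = conv k (conv k (f n)) x - complex_of_real \<mu> * conv k (conv k (g n)) x"
        unfolding 1 by (simp add: conv_diff conv_scale k ck f g continuous_intros)
      then show ?thesis
        by (simp add: f_def)
    qed
    have bnd: "norm (conv k (conv k (d n)) x) \<le> B * sqrt (\<mu> * (\<mu> * inverse (real (Suc n))))" for n
    proof -
      have "norm (conv k (conv k (d n)) x) \<le> B * sqrt (sqnorm (conv k (d n)))"
        by (intro conv_bound k ck d B(2))
      also have "\<dots> \<le> B * sqrt (\<mu> * (\<mu> * inverse (real (Suc n))))"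
        using sup[OF d, of n] mult_left_mono[OF sqd[of n] less_imp_le[OF \<mu>]] B(1)
        by (intro mult_left_mono real_sqrt_le_mono) linarith+
      finally show ?thesis .
    qed
    have "(\<lambda>n. B * sqrt (\<mu> * (\<mu> * inverse (real (Suc (r n)))))) \<longlonglongrightarrow> B * sqrt (\<mu> * (\<mu> * 0))"
      by (intro tendsto_intros inv0)
    then have "(\<lambda>n. B * sqrt (\<mu> * (\<mu> * inverse (real (Suc (r n)))))) \<longlonglongrightarrow> 0"
      by simp
    then have 3: "(\<lambda>n. conv k (conv k (d (r n))) x) \<longlonglongrightarrow> 0"
      by (rule Lim_null_comparison[OF always_eventually[OF allI[OF bnd]]])
    have "(\<lambda>n. conv k (conv k (f (r n))) x - complex_of_real \<mu> * f (r n) x)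
        \<longlonglongrightarrow> conv k (conv k h) x - complex_of_real \<mu> * h x"
      by (intro tendsto_intros 1 2)
    with 3 have "conv k (conv k h) x - complex_of_real \<mu> * h x = 0"
      unfolding eq using LIMSEQ_unique by blast
    then show ?thesis
      by simp
  qed
  \<comment> \<open>If \<open>h\<close> vanished, then \<open>\<langle>T\<^sup>2 g, g\<rangle> = \<parallel>T g\<parallel>\<^sup>2\<close> would tend to \<open>0\<close> along the sequence.\<close>
  have "\<exists>y. h y \<noteq> 0"
  proof (rule ccontr)
    assume "\<nexists>y. h y \<noteq> 0"
    then have h0: "h y = 0" for y
      by simp
    have "0 < \<mu> / 2"
      using \<mu> by simp
    have "\<forall>\<^sub>F n in sequentially. \<mu> \<le> \<mu> / 2 + inverse (real (Suc (r n)))"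
      using uniform_limitD[OF lim \<open>0 < \<mu> / 2\<close>]
    proof eventually_elim
      case (elim n)
      have "norm (inner_m (f (r n)) (g (r n))) \<le> \<mu> / 2 * sqrt (sqnorm (g (r n)))"
        using elim by (intro inner_m_bound f g) (auto simp: h0 intro: less_imp_le)
      also have "\<dots> \<le> \<mu> / 2"
        using g(2)[of "r n"] \<mu> by (simp add: mult_left_le)
      finally have "sqnorm (conv k (g (r n))) \<le> \<mu> / 2"
        using complex_Re_le_cmod[of "inner_m (f (r n)) (g (r n))"] unfolding inner by linarith
      with g(3)[of "r n"] show ?case
        by linarith
    qed
    moreover have "(\<lambda>n. \<mu> / 2 + inverse (real (Suc (r n)))) \<longlonglongrightarrow> \<mu> / 2 + 0"
      by (intro tendsto_intros inv0)
    ultimately have "\<mu> \<le> \<mu> / 2 + 0"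
      by (intro tendsto_lowerbound[where F = sequentially]) auto
    then show False
      using \<mu> by simp
  qed
  then obtain y where "h y \<noteq> 0" ..
  then have "0 < sqnorm h"
    using sqnorm_zero_imp[OF h, of y] by force
  from that[OF h this \<mu> eig] show ?thesis .
qed

end

section \<open>Characters from positive definite eigenfunctions\<close>

text \<open>
  The finite-sum form of positive definiteness survives pointwise limits. Points are given by
  indexed families rather than sets, so that they may coincide; this matters when a family is
  joined with a translate of itself.
\<close>

definition pos_def :: "('g::ab_group_add \<Rightarrow> complex) \<Rightarrow> bool" where
  "pos_def \<phi> \<longleftrightarrow> (\<forall>x. \<phi> (- x) = cnj (\<phi> x)) \<and>
     (\<forall>n (c :: nat \<Rightarrow> complex) (x :: nat \<Rightarrow> 'g).
        0 \<le> Re (\<Sum>i<n. \<Sum>j<n. c i * cnj (c j) * \<phi> (x i - x j)))"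

lemma pos_defD:
  fixes n :: nat
  assumes "pos_def \<phi>"
  shows "\<phi> (- x) = cnj (\<phi> x)"
    "0 \<le> Re (\<Sum>i<n. \<Sum>j<n. c i * cnj (c j) * \<phi> (y i - y j))"
  using assms unfolding pos_def_def by blast+

lemma Re_complex_of_real_mult: "Re (complex_of_real t * z) = t * Re z"
  by simp

lemma pos_def_zero:
  assumes "pos_def \<phi>"
  shows "\<phi> 0 = complex_of_real (Re (\<phi> 0))"
proof -
  have "cnj (\<phi> 0) = \<phi> 0"
    using pos_defD(1)[OF assms, of 0] by simp
  then show ?thesis
    by (simp add: complex_eq_iff)
qed

text \<open>
  The quadratic form at the two points \<open>x\<close> and \<open>0\<close>, with the coefficient at \<open>0\<close> chosen to turn
  \<open>\<phi> x\<close> into \<open>- |\<phi> x|\<close>.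
\<close>

lemma pos_def_bound:
  assumes "pos_def \<phi>"
  shows "norm (\<phi> x) \<le> Re (\<phi> 0)"
proof -
  define d where "d = (if \<phi> x = 0 then 1 else - sgn (\<phi> x))"
  define c where "c i = (if i = (0 :: nat) then 1 else d)" for i
  define y where "y i = (if i = (0 :: nat) then x else 0)" for i
  have "cnj (sgn z) * z = complex_of_real (norm z)" if "z \<noteq> 0" for z
    using that complex_norm_square[of z]
    by (simp add: sgn_eq power2_eq_square mult.commute divide_eq_eq)
  then have d: "norm d = 1" "cnj d * \<phi> x = - complex_of_real (norm (\<phi> x))"
    by (simp_all add: d_def norm_sgn)
  have "0 \<le> Re (\<Sum>i<2. \<Sum>j<2. c i * cnj (c j) * \<phi> (y i - y j))"
    by (rule pos_defD(2)[OF assms])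
  also have "(\<Sum>i<2. \<Sum>j<2. c i * cnj (c j) * \<phi> (y i - y j)) =
      \<phi> 0 + cnj d * \<phi> x + d * \<phi> (- x) + d * cnj d * \<phi> 0"
    by (simp add: numeral_2_eq_2 c_def y_def)
  also have "d * \<phi> (- x) = cnj (cnj d * \<phi> x)"
    using pos_defD(1)[OF assms, of x] by simp
  also have "d * cnj d = 1"
    using d(1) by (simp flip: complex_norm_square)
  finally show ?thesis
    unfolding d(2) by simp
qed

lemma pos_def_scale:
  assumes "pos_def \<phi>" "0 \<le> t"
  shows "pos_def (\<lambda>x. complex_of_real t * \<phi> x)"
  unfolding pos_def_def
proof (intro conjI allI)
  fix n and c :: "nat \<Rightarrow> complex" and y
  have "(\<Sum>i<n. \<Sum>j<n. c i * cnj (c j) * (complex_of_real t * \<phi> (y i - y j))) =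
      complex_of_real t * (\<Sum>i<n. \<Sum>j<n. c i * cnj (c j) * \<phi> (y i - y j))"
    by (simp add: sum_distrib_left mult_ac)
  then show "0 \<le> Re (\<Sum>i<n. \<Sum>j<n. c i * cnj (c j) * (complex_of_real t * \<phi> (y i - y j)))"
    using mult_nonneg_nonneg[OF assms(2) pos_defD(2)[OF assms(1), where c = c and y = y and n = n]]
    by (simp only: Re_complex_of_real_mult)
qed (simp add: pos_defD(1)[OF assms(1)])

lemma pos_def_limit:
  assumes "\<And>n. pos_def (f n)" "\<And>x. (\<lambda>n. f n x) \<longlonglongrightarrow> \<phi> x"
  shows "pos_def \<phi>"
  unfolding pos_def_def
proof (intro conjI allI)
  fix x
  have "(\<lambda>n. f n (- x)) \<longlonglongrightarrow> cnj (\<phi> x)"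
    unfolding pos_defD(1)[OF assms(1)] by (intro tendsto_intros assms(2))
  then show "\<phi> (- x) = cnj (\<phi> x)"
    using assms(2)[of "- x"] LIMSEQ_unique by blast
next
  fix n and c :: "nat \<Rightarrow> complex" and y
  have "(\<lambda>k. Re (\<Sum>i<n. \<Sum>j<n. c i * cnj (c j) * f k (y i - y j)))
      \<longlonglongrightarrow> Re (\<Sum>i<n. \<Sum>j<n. c i * cnj (c j) * \<phi> (y i - y j))"
    by (intro tendsto_intros assms(2))
  then show "0 \<le> Re (\<Sum>i<n. \<Sum>j<n. c i * cnj (c j) * \<phi> (y i - y j))"
    by (rule tendsto_lowerbound) (intro always_eventually allI pos_defD(2) assms(1), simp)
qed

lemma sum_lessThan_add:
  fixes h :: "nat \<Rightarrow> 'b::comm_monoid_add"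
  shows "(\<Sum>i<n + k. h i) = (\<Sum>i<n. h i) + (\<Sum>i<k. h (n + i))"
  by (induction k) (simp_all add: add.assoc)

text \<open>
  If \<open>\<phi>\<close> is a sum of characters \<open>\<gamma>\<close> with non-negative weights, the new function has the weights
  multiplied by \<open>2 + 2 Re (c \<gamma>(a)) \<ge> 0\<close>. In general, its quadratic form at a family of points is
  that of \<open>\<phi>\<close> at the family joined with its translate by \<open>a\<close>, the new coefficients being multiplied by \<open>c\<close>.
\<close>

lemma pos_def_modulate:
  assumes \<phi>: "pos_def \<phi>" and c: "norm c = 1"
  shows "pos_def (\<lambda>x. 2 * \<phi> x + (c * \<phi> (x + a) + cnj c * \<phi> (x - a)))"
  unfolding pos_def_def
proof (intro conjI allI)
  fix x
  have "\<phi> (- x + a) = cnj (\<phi> (x - a))" "\<phi> (- x - a) = cnj (\<phi> (x + a))"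
  proof -
    have "- x + a = - (x - a)" "- x - a = - (x + a)"
      by simp_all
    then show "\<phi> (- x + a) = cnj (\<phi> (x - a))" "\<phi> (- x - a) = cnj (\<phi> (x + a))"
      by (simp_all only: pos_defD(1)[OF \<phi>])
  qed
  then show "2 * \<phi> (- x) + (c * \<phi> (- x + a) + cnj c * \<phi> (- x - a)) =
      cnj (2 * \<phi> x + (c * \<phi> (x + a) + cnj c * \<phi> (x - a)))"
    by (simp add: pos_defD(1)[OF \<phi>])
next
  fix n and d :: "nat \<Rightarrow> complex" and y
  define d' where "d' i = (if i < n then d i else c * d (i - n))" for i
  define y' where "y' i = (if i < n then y i else y (i - n) + a)" for i
  have cc: "c * cnj c = 1"
    using c by (simp flip: complex_norm_square)
  have "(\<Sum>i<n + n. \<Sum>j<n + n. d' i * cnj (d' j) * \<phi> (y' i - y' j)) =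
      (\<Sum>i<n. \<Sum>j<n. d i * cnj (d j) * \<phi> (y i - y j)) +
      (\<Sum>i<n. \<Sum>j<n. d i * cnj (c * d j) * \<phi> (y i - (y j + a))) +
      ((\<Sum>i<n. \<Sum>j<n. c * d i * cnj (d j) * \<phi> (y i + a - y j)) +
      (\<Sum>i<n. \<Sum>j<n. c * d i * cnj (c * d j) * \<phi> (y i + a - (y j + a))))"
    by (simp add: sum_lessThan_add d'_def y'_def sum.distrib)
  also have "\<dots> = (\<Sum>i<n. \<Sum>j<n. d i * cnj (d j) * \<phi> (y i - y j) +
      d i * cnj (c * d j) * \<phi> (y i - (y j + a)) +
      (c * d i * cnj (d j) * \<phi> (y i + a - y j) +
      c * d i * cnj (c * d j) * \<phi> (y i + a - (y j + a))))"
    by (simp add: sum.distrib)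
  also have "\<dots> = (\<Sum>i<n. \<Sum>j<n. d i * cnj (d j) *
      (2 * \<phi> (y i - y j) + (c * \<phi> (y i - y j + a) + cnj c * \<phi> (y i - y j - a))))"
  proof (intro sum.cong refl)
    fix i j
    have "c * d i * cnj (c * d j) = d i * cnj (d j)"
      using arg_cong[OF cc, of "\<lambda>z. z * (d i * cnj (d j))"] by (simp add: mult_ac)
    moreover have "y i + a - (y j + a) = y i - y j" "y i + a - y j = y i - y j + a"
      "y i - (y j + a) = y i - y j - a"
      by (simp_all add: algebra_simps)
    ultimately show "d i * cnj (d j) * \<phi> (y i - y j) + d i * cnj (c * d j) * \<phi> (y i - (y j + a)) +
      (c * d i * cnj (d j) * \<phi> (y i + a - y j) + c * d i * cnj (c * d j) * \<phi> (y i + a - (y j + a))) =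
      d i * cnj (d j) * (2 * \<phi> (y i - y j) + (c * \<phi> (y i - y j + a) + cnj c * \<phi> (y i - y j - a)))"
      by (simp only: complex_cnj_mult) (simp add: algebra_simps)
  qed
  finally show "0 \<le> Re (\<Sum>i<n. \<Sum>j<n. d i * cnj (d j) *
      (2 * \<phi> (y i - y j) + (c * \<phi> (y i - y j + a) + cnj c * \<phi> (y i - y j - a))))"
    using pos_defD(2)[OF \<phi>, where n = "n + n" and c = d' and y = y'] by (simp only:)
qed

lemma characterI_multiplicative:
  assumes "continuous_on UNIV \<phi>" "\<phi> 0 = 1" "\<And>x. \<phi> (- x) = cnj (\<phi> x)"
    "\<And>x y. \<phi> (x + y) = \<phi> x * \<phi> y"
  shows "character \<phi>"
  unfolding character_def
proof (intro conjI allI assms(1,4))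
  fix x
  have "\<phi> x * cnj (\<phi> x) = 1"
    using assms(4)[of x "- x"] assms(2,3) by simp
  then have "(norm (\<phi> x))\<^sup>2 = 1"
    by (metis complex_norm_square of_real_eq_1_iff)
  then show "norm (\<phi> x) = 1"
    by (metis abs_norm_cancel power2_eq_1_iff abs_1 abs_minus_cancel)
qed

context compact_haar begin

definition corr :: "('g \<Rightarrow> complex) \<Rightarrow> ('g \<Rightarrow> complex) \<Rightarrow> 'g \<Rightarrow> complex" where
  "corr g h x = (\<integral>z. g (x + z) * cnj (h z) \<partial>m)"

lemma corr_integrable:
  assumes "continuous_on UNIV g" "continuous_on UNIV h"
  shows "integrable m (\<lambda>z. g (x + z) * cnj (h z))"
  by (rule continuous_integrable)
    (intro continuous_on_mult continuous_on_cnj continuous_translate(1)[OF assms(1)] assms(2))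

lemma continuous_corr:
  assumes g: "continuous_on UNIV g" and h: "continuous_on UNIV h"
  shows "continuous_on UNIV (corr g h)"
proof -
  have "continuous_on UNIV (\<lambda>p. g (fst p + snd p))"
    by (intro continuous_on_compose2[OF g] continuous_intros) auto
  from continuous_parameter_integral[OF this continuous_on_cnj[OF h]] show ?thesis
    by (simp add: corr_def[abs_def])
qed

lemma conv_corr:
  assumes k: "continuous_on UNIV k" and g: "continuous_on UNIV g" and h: "continuous_on UNIV h"
  shows "conv k (corr g h) = corr (conv k g) h"
proof
  fix x
  have "continuous_on UNIV (\<lambda>p. k (x - fst p) * (g (fst p + snd p) * cnj (h (snd p))))"
    by (intro continuous_intros continuous_on_compose2[OF k] continuous_on_compose2[OF g]
        continuous_on_compose2[OF h]) auto
  note swap = integral_swap[OF this]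
  have "conv k (corr g h) x = (\<integral>y. (\<integral>z. k (x - y) * (g (y + z) * cnj (h z)) \<partial>m) \<partial>m)"
    by (simp add: conv_def corr_def)
  also have "\<dots> = (\<integral>z. (\<integral>y. k (x - y) * (g (y + z) * cnj (h z)) \<partial>m) \<partial>m)"
    using swap by simp
  also have "\<dots> = (\<integral>z. conv k g (x + z) * cnj (h z) \<partial>m)"
  proof (rule Bochner_Integration.integral_cong[OF refl])
    fix z
    have "(\<integral>y. k (x - y) * (g (y + z) * cnj (h z)) \<partial>m) = (\<integral>y. k (x - y) * g (y + z) * cnj (h z) \<partial>m)"
      by (simp only: mult.assoc)
    also have "\<dots> = conv k (\<lambda>y. g (y + z)) x * cnj (h z)"
      by (simp add: conv_def)
    finally show "(\<integral>y. k (x - y) * (g (y + z) * cnj (h z)) \<partial>m) = conv k g (x + z) * cnj (h z)"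
      by (simp add: conv_translate k g)
  qed
  finally show "conv k (corr g h) x = corr (conv k g) h x"
    by (simp add: corr_def)
qed

lemma pos_def_corr:
  assumes g: "continuous_on UNIV g"
  shows "pos_def (corr g g)"
  unfolding pos_def_def
proof (intro conjI allI)
  fix x
  have "corr g g (- x) = (\<integral>z. g (- x + (x + z)) * cnj (g (x + z)) \<partial>m)"
    unfolding corr_def
    by (rule integral_translate[symmetric, of "\<lambda>z. g (- x + z) * cnj (g z)"])
      (rule borel_measurable_integrable[OF corr_integrable[OF g g]])
  also have "\<dots> = (\<integral>z. cnj (g (x + z) * cnj (g z)) \<partial>m)"
    by (simp add: mult.commute)
  also have "\<dots> = cnj (corr g g x)"
    unfolding corr_def by (rule Bochner_Integration.integral_cnj)
  finally show "corr g g (- x) = cnj (corr g g x)" .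
next
  fix n and c :: "nat \<Rightarrow> complex" and x
  have cont: "continuous_on UNIV (\<lambda>z. c i * g (x i + z))" for i
    by (intro continuous_intros continuous_translate(1)[OF g])
  have int: "integrable m (\<lambda>z. (c i * g (x i + z)) * cnj (c j * g (x j + z)))" for i j
    by (rule continuous_integrable) (intro continuous_on_mult continuous_on_cnj cont)
  have "c i * cnj (c j) * corr g g (x i - x j) =
      (\<integral>z. (c i * g (x i + z)) * cnj (c j * g (x j + z)) \<partial>m)" for i j
  proof -
    have "corr g g (x i - x j) = (\<integral>z. g (x i - x j + (x j + z)) * cnj (g (x j + z)) \<partial>m)"
      unfolding corr_def
      by (rule integral_translate[symmetric, of "\<lambda>z. g (x i - x j + z) * cnj (g z)"])
        (rule borel_measurable_integrable[OF corr_integrable[OF g g]])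
    also have "\<dots> = (\<integral>z. g (x i + z) * cnj (g (x j + z)) \<partial>m)"
      by (simp add: algebra_simps)
    finally have "c i * cnj (c j) * corr g g (x i - x j) =
        (\<integral>z. c i * cnj (c j) * (g (x i + z) * cnj (g (x j + z))) \<partial>m)"
      by simp
    then show ?thesis
      by (simp add: mult_ac)
  qed
  then have "(\<Sum>i<n. \<Sum>j<n. c i * cnj (c j) * corr g g (x i - x j)) =
      (\<integral>z. (\<Sum>i<n. \<Sum>j<n. (c i * g (x i + z)) * cnj (c j * g (x j + z))) \<partial>m)"
    using int by (simp del: complex_cnj_mult)
  also have "\<dots> = (\<integral>z. complex_of_real ((norm (\<Sum>i<n. c i * g (x i + z)))\<^sup>2) \<partial>m)"
  proof (rule Bochner_Integration.integral_cong[OF refl])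
    fix z
    show "(\<Sum>i<n. \<Sum>j<n. (c i * g (x i + z)) * cnj (c j * g (x j + z))) =
        complex_of_real ((norm (\<Sum>i<n. c i * g (x i + z)))\<^sup>2)"
      unfolding complex_norm_square cnj_sum sum_product ..
  qed
  finally show "0 \<le> Re (\<Sum>i<n. \<Sum>j<n. c i * cnj (c j) * corr g g (x i - x j))"
    by (simp only: integral_complex_of_real Re_complex_of_real) simp
qed

text \<open>
  These functions form a cone that is stable under the modulations of \<open>pos_def_modulate\<close>, since convolution
  commutes with translations. The extremal argument below takes place in this cone.
\<close>

definition eigen_pd :: "('g \<Rightarrow> complex) \<Rightarrow> real \<Rightarrow> ('g \<Rightarrow> complex) \<Rightarrow> bool" where
  "eigen_pd k \<mu> \<phi> \<longleftrightarrow> continuous_on UNIV \<phi> \<and> pos_def \<phi> \<and>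
     (\<forall>x. conv k (conv k \<phi>) x = complex_of_real \<mu> * \<phi> x)"

lemma eigen_pdD:
  assumes "eigen_pd k \<mu> \<phi>"
  shows "continuous_on UNIV \<phi>" "pos_def \<phi>" "conv k (conv k \<phi>) x = complex_of_real \<mu> * \<phi> x"
  using assms by (auto simp: eigen_pd_def)

lemma eigen_pd_scale:
  assumes "continuous_on UNIV k" "eigen_pd k \<mu> \<phi>" "0 \<le> t"
  shows "eigen_pd k \<mu> (\<lambda>x. complex_of_real t * \<phi> x)"
  unfolding eigen_pd_def
proof (intro conjI allI)
  fix x
  have "conv k (\<lambda>x. complex_of_real t * \<phi> x) = (\<lambda>x. complex_of_real t * conv k \<phi> x)"
    by (simp add: conv_scale fun_eq_iff)
  then show "conv k (conv k (\<lambda>x. complex_of_real t * \<phi> x)) x = complex_of_real \<mu> * (complex_of_real t * \<phi> x)"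
    by (simp add: conv_scale eigen_pdD(3)[OF assms(2)])
qed (intro continuous_intros eigen_pdD[OF assms(2)] pos_def_scale assms(3))+

lemma eigen_pd_modulate:
  assumes k: "continuous_on UNIV k" and \<phi>: "eigen_pd k \<mu> \<phi>" and c: "norm c = 1"
  shows "eigen_pd k \<mu> (\<lambda>x. 2 * \<phi> x + (c * \<phi> (x + a) + cnj c * \<phi> (x - a)))"
  unfolding eigen_pd_def
proof (intro conjI allI)
  note cont = eigen_pdD(1)[OF \<phi>]
  have comb: "conv k (\<lambda>x. 2 * g x + (c * g (x + a) + cnj c * g (x - a))) =
      (\<lambda>x. 2 * conv k g x + (c * conv k g (x + a) + cnj c * conv k g (x - a)))"
    if g: "continuous_on UNIV g" for g
  proof
    fix x
    have g': "continuous_on UNIV (\<lambda>x. g (x + a))" "continuous_on UNIV (\<lambda>x. g (x - a))"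
      by (rule continuous_translate[OF g])+
    have "conv k (\<lambda>x. g (x - a)) x = conv k g (x - a)"
      using conv_translate[OF k g, of "- a" x] by simp
    then show "conv k (\<lambda>x. 2 * g x + (c * g (x + a) + cnj c * g (x - a))) x =
        2 * conv k g x + (c * conv k g (x + a) + cnj c * conv k g (x - a))"
      using g g' by (simp add: conv_add conv_scale conv_translate k continuous_intros)
  qed
  fix x
  show "conv k (conv k (\<lambda>x. 2 * \<phi> x + (c * \<phi> (x + a) + cnj c * \<phi> (x - a)))) x =
      complex_of_real \<mu> * (2 * \<phi> x + (c * \<phi> (x + a) + cnj c * \<phi> (x - a)))"
    unfolding comb[OF cont] comb[OF continuous_conv[OF k cont]] eigen_pdD(3)[OF \<phi>]
    by (simp add: algebra_simps)
next
  show "continuous_on UNIV (\<lambda>x. 2 * \<phi> x + (c * \<phi> (x + a) + cnj c * \<phi> (x - a)))"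
    by (intro continuous_intros continuous_translate(2,3)[OF eigen_pdD(1)[OF \<phi>]] eigen_pdD(1)[OF \<phi>])
qed (rule pos_def_modulate[OF eigen_pdD(2)[OF \<phi>] c])

text \<open>
  The eigenvalue equation \<open>\<phi> = T\<^sup>2 \<phi> / \<mu>\<close> makes the normalised members of the cone an
  equicontinuous family, so a maximising sequence for the \<open>L\<^sub>2\<close> norm has a uniform limit. The bound is
  stated in homogeneous form, so that it applies to members of the cone without normalising them.
\<close>

lemma eigen_pd_maximiser:
  assumes k: "continuous_on UNIV k" and \<mu>: "0 < \<mu>"
    and \<phi>0: "eigen_pd k \<mu> \<phi>0" "\<phi>0 0 = 1"
  obtains \<phi> where "eigen_pd k \<mu> \<phi>" "\<phi> 0 = 1"
    "\<And>\<psi>. eigen_pd k \<mu> \<psi> \<Longrightarrow> sqnorm \<psi> \<le> sqnorm \<phi> * (Re (\<psi> 0))\<^sup>2"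
proof -
  obtain B where B: "0 < B" "\<And>x. norm (k x) \<le> B"
    by (rule continuous_bounded[OF k]) (rule that)
  note ck = continuous_conv[OF k]
  define S where "S = {sqnorm \<phi> | \<phi>. eigen_pd k \<mu> \<phi> \<and> \<phi> 0 = 1}"
  have b1: "norm (\<phi> x) \<le> 1" if "eigen_pd k \<mu> \<phi>" "\<phi> 0 = 1" for \<phi> x
    using pos_def_bound[OF eigen_pdD(2)[OF that(1)], of x] that(2) by simp
  have sq1: "sqnorm \<phi> \<le> 1" if "eigen_pd k \<mu> \<phi>" "\<phi> 0 = 1" for \<phi>
    using sqnorm_le_bound[OF b1[OF that] eigen_pdD(1)[OF that(1)]] by simp
  have bdd: "bdd_above S"
    by (auto simp: S_def intro!: bdd_aboveI[of _ 1] sq1)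
  have "S \<noteq> {}"
    using \<phi>0 by (auto simp: S_def)
  have "\<exists>\<phi>. eigen_pd k \<mu> \<phi> \<and> \<phi> 0 = 1 \<and> Sup S - inverse (real (Suc n)) < sqnorm \<phi>" for n
  proof -
    have "\<exists>s\<in>S. Sup S - inverse (real (Suc n)) < s"
      using \<open>S \<noteq> {}\<close> by (intro less_cSupD) (auto simp del: of_nat_Suc)
    then show ?thesis
      by (auto simp: S_def)
  qed
  from choice[OF allI[OF this]] obtain f where
    "\<forall>n. eigen_pd k \<mu> (f n) \<and> f n 0 = 1 \<and> Sup S - inverse (real (Suc n)) < sqnorm (f n)" ..
  then have f: "eigen_pd k \<mu> (f n)" "f n 0 = 1" "Sup S - inverse (real (Suc n)) < sqnorm (f n)" for n
    by blast+
  note cf = eigen_pdD(1)[OF f(1)]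
  have "sqnorm (conv k (f n)) \<le> B\<^sup>2" for n
  proof (rule sqnorm_le_bound[OF _ ck[OF cf]])
    fix x
    have "B * sqrt (sqnorm (f n)) \<le> B * 1"
      using sq1[OF f(1,2), of n] B(1) by (intro mult_left_mono) auto
    then show "norm (conv k (f n) x) \<le> B"
      using conv_bound[OF k cf B(2), of n x] by linarith
  qed
  note bound = this
  obtain r h where r: "strict_mono r"
    and lim: "uniform_limit UNIV (\<lambda>n. conv k (conv k (f (r n)))) h sequentially"
    by (rule conv_Arzela_Ascoli[of k "\<lambda>n. conv k (f n)", OF k ck[OF cf] bound]) (rule that)
  define \<phi> where "\<phi> x = complex_of_real (1 / \<mu>) * h x" for x
  have lim2: "uniform_limit UNIV (\<lambda>n. f (r n)) \<phi> sequentially"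
  proof -
    have "bounded_linear (\<lambda>z. complex_of_real (1 / \<mu>) * z)"
      by (rule bounded_linear_mult_right)
    from bounded_linear.uniform_limit[OF this lim]
    have "uniform_limit UNIV (\<lambda>n x. complex_of_real (1 / \<mu>) * conv k (conv k (f (r n))) x) \<phi> sequentially"
      by (simp add: \<phi>_def[abs_def])
    moreover have "(\<lambda>n x. complex_of_real (1 / \<mu>) * conv k (conv k (f (r n))) x) = (\<lambda>n. f (r n))"
      using \<mu> by (simp add: eigen_pdD(3)[OF f(1)] fun_eq_iff)
    ultimately show ?thesis
      by simp
  qed
  have ptw: "(\<lambda>n. f (r n) x) \<longlonglongrightarrow> \<phi> x" for x
    by (rule tendsto_uniform_limitI[OF lim2]) simp
  have c\<phi>: "continuous_on UNIV \<phi>"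
    by (rule uniform_limit_theorem[OF _ lim2]) (simp_all add: cf)
  have "conv k (conv k \<phi>) x = complex_of_real \<mu> * \<phi> x" for x
  proof -
    have "uniform_limit UNIV (\<lambda>n. conv k (conv k (f (r n)))) (conv k (conv k \<phi>)) sequentially"
      by (intro uniform_limit_conv k ck cf lim2)
    then have "(\<lambda>n. conv k (conv k (f (r n))) x) \<longlonglongrightarrow> conv k (conv k \<phi>) x"
      by (rule tendsto_uniform_limitI) simp
    moreover have "(\<lambda>n. complex_of_real \<mu> * f (r n) x) \<longlonglongrightarrow> complex_of_real \<mu> * \<phi> x"
      by (intro tendsto_intros ptw)
    ultimately show ?thesis
      unfolding eigen_pdD(3)[OF f(1)] by (rule LIMSEQ_unique)
  qed
  moreover have "pos_def \<phi>"
    by (rule pos_def_limit[OF eigen_pdD(2)[OF f(1)] ptw])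
  ultimately have e\<phi>: "eigen_pd k \<mu> \<phi>"
    using c\<phi> by (simp add: eigen_pd_def)
  have "\<phi> 0 = 1"
    using ptw[of 0] by (simp add: f(2) LIMSEQ_const_iff)
  have "(\<lambda>n. sqnorm (f (r n))) \<longlonglongrightarrow> sqnorm \<phi>"
    unfolding sqnorm_def
  proof (rule integral_dominated_convergence[where w = "\<lambda>_. 1"])
    show "AE x in m. (\<lambda>n. (norm (f (r n) x))\<^sup>2) \<longlonglongrightarrow> (norm (\<phi> x))\<^sup>2"
      by (intro always_eventually allI tendsto_intros ptw)
    show "AE x in m. norm ((norm (f (r n) x))\<^sup>2) \<le> 1" for n
      using b1[OF f(1,2)] by (simp add: power_le_one)
  qed (auto intro!: continuous_measurable continuous_intros cf c\<phi>)
  moreover have "(\<lambda>n. Sup S - inverse (real (Suc (r n)))) \<longlonglongrightarrow> Sup S - 0"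
    using LIMSEQ_subseq_LIMSEQ[OF LIMSEQ_inverse_real_of_nat r]
    by (intro tendsto_intros) (simp add: o_def)
  ultimately have sup: "Sup S \<le> sqnorm \<phi>"
    using f(3) by (intro LIMSEQ_le[of _ "Sup S" _ "sqnorm \<phi>"]) (auto intro: less_imp_le)
  have "sqnorm \<psi> \<le> sqnorm \<phi> * (Re (\<psi> 0))\<^sup>2" if \<psi>: "eigen_pd k \<mu> \<psi>" for \<psi>
  proof (cases "Re (\<psi> 0) = 0")
    case True
    then have "\<psi> x = 0" for x
      using pos_def_bound[OF eigen_pdD(2)[OF \<psi>], of x] by simp
    then show ?thesis
      using True by (simp add: sqnorm_def)
  next
    case False
    have "0 \<le> Re (\<psi> 0)"
      using pos_def_bound[OF eigen_pdD(2)[OF \<psi>], of 0] norm_ge_zero order_trans by blast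
    define t where "t = 1 / Re (\<psi> 0)"
    have t: "0 \<le> t" "t * Re (\<psi> 0) = 1"
      using \<open>0 \<le> Re (\<psi> 0)\<close> False by (auto simp: t_def)
    have "complex_of_real t * \<psi> 0 = 1"
      using t(2) by (subst pos_def_zero[OF eigen_pdD(2)[OF \<psi>]]) (simp flip: of_real_mult)
    then have "sqnorm (\<lambda>x. complex_of_real t * \<psi> x) \<in> S"
      unfolding S_def using eigen_pd_scale[OF k \<psi> t(1)] by blast
    then have "sqnorm (\<lambda>x. complex_of_real t * \<psi> x) \<le> sqnorm \<phi>"
      using cSup_upper[OF _ bdd] sup order_trans by blast
    then have "t\<^sup>2 * sqnorm \<psi> \<le> sqnorm \<phi>"
      by (simp add: sqnorm_scale)
    then have le: "(Re (\<psi> 0))\<^sup>2 * (t\<^sup>2 * sqnorm \<psi>) \<le> (Re (\<psi> 0))\<^sup>2 * sqnorm \<phi>"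
      by (intro mult_left_mono) auto
    have eq: "(Re (\<psi> 0))\<^sup>2 * (t\<^sup>2 * sqnorm \<psi>) = (t * Re (\<psi> 0))\<^sup>2 * sqnorm \<psi>"
      by (simp only: power_mult_distrib mult_ac)
    show ?thesis
      using le unfolding eq t(2) by (simp add: mult.commute)
  qed
  from that[OF e\<phi> \<open>\<phi> 0 = 1\<close> this] show ?thesis .
qed

text \<open>
  Write \<open>D = c \<phi>(\<cdot> + a) + cnj c \<phi>(\<cdot> - a)\<close> and \<open>r = Re (c \<phi>(a))\<close>. Both \<open>2 \<phi> + D\<close> and \<open>2 \<phi> - D\<close> lie in the cone,
  and \<open>\<phi>\<close> is a convex combination of their normalisations. A maximiser \<open>\<phi>\<close> of a strictly convex functional
  cannot lie strictly between two different points, so \<open>D = 2 r \<phi>\<close>. For \<open>c = 1\<close> and \<open>c = \<i>\<close> this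
  amounts to \<open>\<phi>(x + a) = \<phi>(x) \<phi>(a)\<close>.
\<close>

lemma eigenspace_character:
  assumes k: "continuous_on UNIV k" and \<mu>: "0 < \<mu>"
    and \<phi>0: "eigen_pd k \<mu> \<phi>0" "\<phi>0 0 = 1"
  obtains \<gamma> where "character \<gamma>" "\<And>x. conv k (conv k \<gamma>) x = complex_of_real \<mu> * \<gamma> x"
proof -
  obtain \<phi> where \<phi>: "eigen_pd k \<mu> \<phi>" "\<phi> 0 = 1"
    and max: "\<And>\<psi>. eigen_pd k \<mu> \<psi> \<Longrightarrow> sqnorm \<psi> \<le> sqnorm \<phi> * (Re (\<psi> 0))\<^sup>2"
    by (rule eigen_pd_maximiser[OF k \<mu> \<phi>0]) (rule that)
  note c\<phi> = eigen_pdD(1)[OF \<phi>(1)]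
  note pd = eigen_pdD(2)[OF \<phi>(1)]
  have key: "c * \<phi> (x + a) + cnj c * \<phi> (x - a) = complex_of_real (2 * Re (c * \<phi> a)) * \<phi> x"
    if c: "norm c = 1" for a c x
  proof -
    define D where "D x = c * \<phi> (x + a) + cnj c * \<phi> (x - a)" for x
    define r where "r = Re (c * \<phi> a)"
    define q where "q = sqnorm \<phi>"
    define I where "I = Re (inner_m D \<phi>)"
    have cD: "continuous_on UNIV D"
      unfolding D_def by (intro continuous_intros continuous_translate(2,3)[OF c\<phi>])
    have D0: "D 0 = complex_of_real (2 * r)"
      using pos_defD(1)[OF pd, of a] by (simp add: D_def r_def complex_eq_iff)
    have W: "sqnorm (\<lambda>x. D x - complex_of_real t * \<phi> x) = sqnorm D - 2 * t * I + t\<^sup>2 * q" for t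
      unfolding I_def q_def by (rule sqnorm_diff_scale[OF cD c\<phi>])
    have "norm (c * \<phi> a) \<le> 1"
      using pos_def_bound[OF pd, of a] c \<phi>(2) by (simp add: norm_mult)
    then have r: "\<bar>r\<bar> \<le> 1"
      unfolding r_def using abs_Re_le_cmod order_trans by blast
    have "eigen_pd k \<mu> (\<lambda>x. 2 * \<phi> x + D x)"
      unfolding D_def by (rule eigen_pd_modulate[OF k \<phi>(1) c])
    from max[OF this] have 1: "sqnorm D + 4 * I + 4 * q \<le> q * (2 + 2 * r)\<^sup>2"
      using W[of "- 2"] by (simp add: D0 \<phi>(2) q_def add.commute)
    have "eigen_pd k \<mu> (\<lambda>x. 2 * \<phi> x + (- c * \<phi> (x + a) + cnj (- c) * \<phi> (x - a)))"
      by (rule eigen_pd_modulate[OF k \<phi>(1)]) (simp add: c)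
    moreover have "(\<lambda>x. 2 * \<phi> x + (- c * \<phi> (x + a) + cnj (- c) * \<phi> (x - a))) = (\<lambda>x. 2 * \<phi> x - D x)"
      by (simp add: D_def algebra_simps)
    ultimately have "eigen_pd k \<mu> (\<lambda>x. 2 * \<phi> x - D x)"
      by simp
    from max[OF this] have 2: "sqnorm D - 4 * I + 4 * q \<le> q * (2 - 2 * r)\<^sup>2"
      using W[of 2] by (simp add: D0 \<phi>(2) q_def sqnorm_def norm_minus_commute)
    \<comment> \<open>These weights turn the two inner product terms into \<open>- 8 r I\<close>, as the square of \<open>D - 2 r \<phi>\<close> requires.\<close>
    have "(1 - r) * (sqnorm D + 4 * I + 4 * q) + (1 + r) * (sqnorm D - 4 * I + 4 * q) \<le>
        (1 - r) * (q * (2 + 2 * r)\<^sup>2) + (1 + r) * (q * (2 - 2 * r)\<^sup>2)"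
      using r by (intro add_mono mult_left_mono 1 2) auto
    then have "sqnorm D - 2 * (2 * r) * I + (2 * r)\<^sup>2 * q \<le> 0"
      by (simp add: power2_eq_square algebra_simps)
    then have "sqnorm (\<lambda>x. D x - complex_of_real (2 * r) * \<phi> x) \<le> 0"
      unfolding W .
    then have "D x - complex_of_real (2 * r) * \<phi> x = 0"
      by (intro sqnorm_zero_imp[of "\<lambda>x. D x - complex_of_real (2 * r) * \<phi> x"] continuous_intros cD c\<phi>)
    then show ?thesis
      by (simp add: D_def r_def)
  qed
  have "\<phi> (x + a) = \<phi> x * \<phi> a" for x a
  proof -
    have 1: "\<phi> (x + a) + \<phi> (x - a) = complex_of_real (2 * Re (\<phi> a)) * \<phi> x"
      using key[of 1 x a] by simp
    have 2: "\<i> * \<phi> (x + a) - \<i> * \<phi> (x - a) = - complex_of_real (2 * Im (\<phi> a)) * \<phi> x"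
      using key[of \<i> x a] by simp
    have "\<phi> (x + a) + \<phi> (x - a) - \<i> * (\<i> * \<phi> (x + a) - \<i> * \<phi> (x - a)) =
        2 * ((complex_of_real (Re (\<phi> a)) + \<i> * complex_of_real (Im (\<phi> a))) * \<phi> x)"
      unfolding 1 2 by (simp add: algebra_simps)
    moreover have "\<phi> (x + a) + \<phi> (x - a) - \<i> * (\<i> * \<phi> (x + a) - \<i> * \<phi> (x - a)) = 2 * \<phi> (x + a)"
      by (simp add: algebra_simps flip: mult.assoc)
    moreover have "complex_of_real (Re (\<phi> a)) + \<i> * complex_of_real (Im (\<phi> a)) = \<phi> a"
      by (rule complex_eq[symmetric])
    ultimately show ?thesis
      by (simp add: mult.commute)
  qed
  then have "character \<phi>"
    by (intro characterI_multiplicative c\<phi> \<phi>(2) pos_defD(1)[OF pd])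
  with eigen_pdD(3)[OF \<phi>(1)] show ?thesis
    by (intro that)
qed

text \<open>
  The autocorrelation of an eigenfunction of \<open>T\<^sup>2\<close> is a positive definite eigenfunction, so the eigenspace
  contains a character \<open>\<gamma>\<close>. As \<open>T \<gamma>\<close> is the conjugate Fourier coefficient of \<open>k\<close> times \<open>\<gamma>\<close>, that
  coefficient cannot vanish.
\<close>

lemma hermitian_nonzero_coefficient:
  assumes k: "continuous_on UNIV k" and herm: "\<And>x. k (- x) = cnj (k x)" and "k x0 \<noteq> 0"
  obtains \<gamma> where "character \<gamma>" "(\<integral>x. k x * cnj (\<gamma> x) \<partial>m) \<noteq> 0"
proof -
  have "conv k k 0 = inner_m k k"
    by (simp add: conv_def inner_m_def herm mult.commute)
  moreover have "sqnorm k \<noteq> 0"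
    using sqnorm_zero_imp[OF k, of x0] \<open>k x0 \<noteq> 0\<close> by force
  ultimately have "conv k k 0 \<noteq> 0"
    by (simp add: inner_self)
  then obtain g \<mu> where g: "continuous_on UNIV g" "0 < sqnorm g" and \<mu>: "0 < \<mu>"
    and eig: "\<And>x. conv k (conv k g) x = complex_of_real \<mu> * g x"
    by (rule conv_square_eigenfunction[OF k herm k]) (rule that)
  have "conv k (conv k (corr g g)) x = complex_of_real \<mu> * corr g g x" for x
  proof -
    have "conv k (conv k (corr g g)) = corr (\<lambda>x. complex_of_real \<mu> * g x) g"
      unfolding conv_corr[OF k g(1) g(1)] conv_corr[OF k continuous_conv[OF k g(1)] g(1)] eig[abs_def] ..
    then show ?thesis
      by (simp add: corr_def mult.assoc)
  qed
  then have "eigen_pd k \<mu> (corr g g)"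
    using continuous_corr[OF g(1) g(1)] pos_def_corr[OF g(1)] by (simp add: eigen_pd_def)
  then have "eigen_pd k \<mu> (\<lambda>x. complex_of_real (1 / sqnorm g) * corr g g x)"
    using g(2) by (intro eigen_pd_scale k) auto
  moreover have "complex_of_real (1 / sqnorm g) * corr g g 0 = 1"
    using inner_self[of g] g(2) by (simp add: corr_def inner_m_def)
  ultimately obtain \<gamma> where \<gamma>: "character \<gamma>" "\<And>x. conv k (conv k \<gamma>) x = complex_of_real \<mu> * \<gamma> x"
    by (rule eigenspace_character[OF k \<mu>]) (rule that)
  have c\<gamma>: "continuous_on UNIV \<gamma>" and mult: "\<And>x y. \<gamma> (x + y) = \<gamma> x * \<gamma> y" and n1: "norm (\<gamma> 0) = 1"
    using \<gamma>(1) by (auto simp: character_def)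
  have "(\<integral>x. k x * cnj (\<gamma> x) \<partial>m) \<noteq> 0"
  proof
    assume 0: "(\<integral>x. k x * cnj (\<gamma> x) \<partial>m) = 0"
    have "conv k \<gamma> 0 = (\<integral>y. cnj (k y * cnj (\<gamma> y)) \<partial>m)"
      by (simp add: conv_def herm)
    also have "\<dots> = 0"
      unfolding Bochner_Integration.integral_cnj 0 by simp
    finally have z: "conv k \<gamma> 0 = 0" .
    have "conv k \<gamma> x = 0" for x
    proof -
      have "conv k \<gamma> (0 + x) = conv k (\<lambda>y. \<gamma> (y + x)) 0"
        by (rule conv_translate[OF k c\<gamma>, symmetric])
      also have "\<dots> = conv k (\<lambda>y. \<gamma> x * \<gamma> y) 0"
        by (simp add: mult mult.commute)
      finally show ?thesis
        by (simp add: conv_scale z)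
    qed
    then have "conv k (conv k \<gamma>) 0 = 0"
      by (simp add: conv_def)
    with \<gamma>(2)[of 0] \<mu> n1 show False
      by auto
  qed
  with \<gamma>(1) show ?thesis
    by (rule that)
qed

end

section \<open>Trigonometric polynomials and uniqueness of Fourier coefficients\<close>

lemma characterD:
  assumes "character \<gamma>"
  shows "continuous_on UNIV \<gamma>" "norm (\<gamma> x) = 1" "\<gamma> (x + y) = \<gamma> x * \<gamma> y"
    "\<gamma> 0 = 1" "\<gamma> (- x) = cnj (\<gamma> x)" "\<gamma> (x - y) = \<gamma> x * cnj (\<gamma> y)"
    "\<gamma> x * cnj (\<gamma> x) = 1"
proof -
  show c: "continuous_on UNIV \<gamma>" and n: "\<And>x. norm (\<gamma> x) = 1" and m: "\<And>x y. \<gamma> (x + y) = \<gamma> x * \<gamma> y"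
    using assms by (auto simp: character_def)
  show u: "\<And>x. \<gamma> x * cnj (\<gamma> x) = 1"
    using n by (simp flip: complex_norm_square)
  have "\<gamma> 0 * \<gamma> 0 = \<gamma> 0" "\<gamma> 0 \<noteq> 0"
    using m[of 0 0] n[of 0] by auto
  then show z: "\<gamma> 0 = 1"
    by simp
  show i: "\<And>x. \<gamma> (- x) = cnj (\<gamma> x)"
  proof -
    fix x
    have "\<gamma> (- x) * \<gamma> x = 1"
      using m[of "- x" x] z by simp
    then have "\<gamma> (- x) * (\<gamma> x * cnj (\<gamma> x)) = cnj (\<gamma> x)"
      by (simp flip: mult.assoc)
    then show "\<gamma> (- x) = cnj (\<gamma> x)"
      by (simp add: u)
  qed
  show "\<gamma> (x - y) = \<gamma> x * cnj (\<gamma> y)"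
    using m[of x "- y"] i[of y] by simp
qed

lemma character_one: "character (\<lambda>_. 1)"
  by (simp add: character_def)

lemma character_cnj: "character \<gamma> \<Longrightarrow> character (\<lambda>x. cnj (\<gamma> x))"
  by (simp add: character_def continuous_intros)

lemma character_mult: "character \<gamma> \<Longrightarrow> character \<delta> \<Longrightarrow> character (\<lambda>x. \<gamma> x * \<delta> x)"
  by (simp add: character_def continuous_intros norm_mult mult_ac)

inductive trig_poly :: "('g::{topological_ab_group_add, t2_space} \<Rightarrow> complex) \<Rightarrow> bool" where
  character: "character \<gamma> \<Longrightarrow> trig_poly \<gamma>"
| scale: "trig_poly p \<Longrightarrow> trig_poly (\<lambda>x. c * p x)"
| add: "trig_poly p \<Longrightarrow> trig_poly q \<Longrightarrow> trig_poly (\<lambda>x. p x + q x)"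

lemma trig_poly_continuous: "trig_poly p \<Longrightarrow> continuous_on UNIV p"
  by (induction rule: trig_poly.induct) (auto intro!: continuous_intros dest: characterD(1))

lemma trig_poly_const: "trig_poly (\<lambda>_. c)"
  using trig_poly.scale[OF trig_poly.character[OF character_one], of c] by simp

lemma trig_poly_character_mult:
  assumes "trig_poly p" "character \<gamma>"
  shows "trig_poly (\<lambda>x. \<gamma> x * p x)"
  using assms
proof (induction rule: trig_poly.induct)
  case (character \<delta>)
  then show ?case
    by (intro trig_poly.character character_mult)
next
  case (scale p c)
  from trig_poly.scale[OF scale.IH[OF scale.prems], of c] show ?case
    by (simp add: mult_ac)
next
  case (add p q)
  from trig_poly.add[OF add.IH(1)[OF add.prems] add.IH(2)[OF add.prems]] show ?case
    by (simp add: distrib_left)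
qed

lemma trig_poly_mult:
  assumes "trig_poly p" "trig_poly q"
  shows "trig_poly (\<lambda>x. p x * q x)"
  using assms
proof (induction rule: trig_poly.induct)
  case (character \<gamma>)
  then show ?case
    by (intro trig_poly_character_mult)
next
  case (scale p c)
  from trig_poly.scale[OF scale.IH[OF scale.prems], of c] show ?case
    by (simp add: mult_ac)
next
  case (add p r)
  from trig_poly.add[OF add.IH(1)[OF add.prems] add.IH(2)[OF add.prems]] show ?case
    by (simp add: distrib_right)
qed

lemma le_zero_if_le_mult_eps:
  fixes x C :: real
  assumes "0 \<le> C" "\<And>e. 0 < e \<Longrightarrow> x \<le> C * e"
  shows "x \<le> 0"
proof (rule ccontr)
  assume "\<not> x \<le> 0"
  then have "0 < x / (C + 1)"
    using assms(1) by simp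
  from assms(2)[OF this] have "x * (C + 1) \<le> C * x"
    using assms(1) by (simp add: field_simps)
  then show False
    using \<open>\<not> x \<le> 0\<close> by (simp add: algebra_simps)
qed

context compact_haar begin

lemma Urysohn_group:
  fixes S T :: "'g set"
  assumes "closed S" "closed T" "S \<inter> T = {}"
  obtains f :: "'g \<Rightarrow> real" where "continuous_on UNIV f" "\<And>x. 0 \<le> f x" "\<And>x. f x \<le> 1"
    "\<And>x. x \<in> S \<Longrightarrow> f x = 0" "\<And>x. x \<in> T \<Longrightarrow> f x = 1"
proof -
  have "Hausdorff_space (euclidean :: 'g topology)"
    unfolding Hausdorff_space_def disjnt_def by simp (meson hausdorff)
  moreover have "compact_space (euclidean :: 'g topology)"
    using compact_group by (simp add: compact_space_def)
  ultimately have "normal_space (euclidean :: 'g topology)"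
    by (intro compact_Hausdorff_or_regular_imp_normal_space) auto
  then obtain f :: "'g \<Rightarrow> real" where
    f: "continuous_map euclidean (top_of_set {0..1}) f" "f ` S \<subseteq> {0}" "f ` T \<subseteq> {1}"
    using assms unfolding normal_space_iff_Urysohn disjnt_def by (metis closed_closedin)
  then have "continuous_on UNIV f" "range f \<subseteq> {0..1}"
    by (auto simp: continuous_map_in_subtopology)
  show ?thesis
  proof (rule that)
    show "continuous_on UNIV f" by fact
    show "0 \<le> f x" "f x \<le> 1" for x
      using subsetD[OF \<open>range f \<subseteq> {0..1}\<close> rangeI[of f x]] by simp_all
    show "f x = 0" if "x \<in> S" for x
      using subsetD[OF f(2) imageI[OF that]] by simp
    show "f x = 1" if "x \<in> T" for x
      using subsetD[OF f(3) imageI[OF that]] by simp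
  qed
qed

text \<open>
  Suppose every character is \<open>1\<close> at \<open>x0\<close>. Then the second difference \<open>2 v - v(\<cdot> + x0) - v(\<cdot> - x0)\<close> of any
  continuous \<open>v\<close> has vanishing Fourier coefficients. For a real even \<open>v\<close> that is \<open>1\<close> at \<open>0\<close> and \<open>0\<close> at
  \<open>x0\<close> it is a hermitian function with value \<open>2\<close> at \<open>0\<close>, a contradiction.
\<close>

lemma characters_separate:
  assumes "x0 \<noteq> (0 :: 'g)"
  obtains \<gamma> where "character \<gamma>" "\<gamma> x0 \<noteq> 1"
proof (rule ccontr)
  assume "\<not> thesis"
  then have triv: "\<gamma> x0 = 1" if "character \<gamma>" for \<gamma>
    using that \<open>\<And>\<gamma>. character \<gamma> \<Longrightarrow> \<gamma> x0 \<noteq> 1 \<Longrightarrow> thesis\<close> by blast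
  obtain b :: "'g \<Rightarrow> real" where b: "continuous_on UNIV b" "b x0 = 0" "b 0 = 1"
    by (rule Urysohn_group[of "{x0}" "{0}"]) (use assms in auto)
  define v where "v y = complex_of_real (b y * b (- y))" for y
  define f where "f y = 2 * v y - v (y + x0) - v (y - x0)" for y
  have cv: "continuous_on UNIV v"
    unfolding v_def by (intro continuous_intros b(1) continuous_translate(5)[OF b(1)])
  have cf: "continuous_on UNIV f"
    unfolding f_def by (intro continuous_intros cv continuous_translate(2,3)[OF cv])
  have even: "v (- y) = v y" "cnj (v y) = v y" for y
    by (simp_all add: v_def mult.commute)
  have "f (- y) = cnj (f y)" for y
    using even(1)[of "y - x0"] even(1)[of "y + x0"] by (simp add: f_def even)
  moreover have "f 0 \<noteq> 0"
    using b(2,3) by (simp add: f_def v_def)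
  ultimately obtain \<gamma> where \<gamma>: "character \<gamma>" "(\<integral>y. f y * cnj (\<gamma> y) \<partial>m) \<noteq> 0"
    by (rule hermitian_nonzero_coefficient[OF cf]) (rule that)
  note c\<gamma> = characterD(1)[OF \<gamma>(1)]
  have int: "integrable m (\<lambda>y. v y * cnj (\<gamma> y))" "integrable m (\<lambda>y. v (y + a) * cnj (\<gamma> y))" for a
    by (intro continuous_integrable continuous_intros cv c\<gamma> continuous_translate(2)[OF cv])+
  have shift: "(\<integral>y. v (y + a) * cnj (\<gamma> y) \<partial>m) = (\<integral>y. v y * cnj (\<gamma> y) \<partial>m)" if a: "\<gamma> a = 1" for a
  proof -
    have "v (y + a) * cnj (\<gamma> y) = v (a + y) * cnj (\<gamma> (a + y))" for y
      using a by (simp add: characterD(3)[OF \<gamma>(1)] add.commute)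
    then show ?thesis
      using integral_translate[OF borel_measurable_integrable[OF int(1)], of a] by simp
  qed
  have "\<gamma> x0 = 1" "\<gamma> (- x0) = 1"
    using triv[OF \<gamma>(1)] characterD(5)[OF \<gamma>(1)] by auto
  have "(\<integral>y. f y * cnj (\<gamma> y) \<partial>m) =
      (\<integral>y. 2 * (v y * cnj (\<gamma> y)) - v (y + x0) * cnj (\<gamma> y) - v (y + - x0) * cnj (\<gamma> y) \<partial>m)"
    by (simp add: f_def algebra_simps)
  also have "\<dots> = 2 * (\<integral>y. v y * cnj (\<gamma> y) \<partial>m) - (\<integral>y. v (y + x0) * cnj (\<gamma> y) \<partial>m)
      - (\<integral>y. v (y + - x0) * cnj (\<gamma> y) \<partial>m)"
    using int(1) int(2)[of x0] int(2)[of "- x0"] by simp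
  also have "\<dots> = 0"
    unfolding shift[OF \<open>\<gamma> x0 = 1\<close>] shift[OF \<open>\<gamma> (- x0) = 1\<close>] by simp
  finally show False
    using \<gamma>(2) by simp
qed

lemma trig_poly_dense_real:
  fixes f :: "'g \<Rightarrow> real"
  assumes "continuous_on UNIV f" "0 < e"
  obtains r where "trig_poly (\<lambda>x. complex_of_real (r x))" "\<And>x. \<bar>f x - r x\<bar> < e"
proof -
  define R where "R = {r :: 'g \<Rightarrow> real. trig_poly (\<lambda>x. complex_of_real (r x))}"
  interpret function_ring_on R UNIV
  proof
    fix f assume "f \<in> R"
    then have "continuous_on UNIV (\<lambda>x. Re (complex_of_real (f x)))"
      unfolding R_def by (intro continuous_on_Re trig_poly_continuous) simp
    then show "continuous_on UNIV f"
      by simp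
  next
    fix x y :: 'g assume "x \<noteq> y"
    then have "x - y \<noteq> 0"
      by simp
    then obtain \<gamma> where \<gamma>: "character \<gamma>" "\<gamma> (x - y) \<noteq> 1"
      by (rule characters_separate) (rule that)
    have "\<gamma> x \<noteq> \<gamma> y"
      using \<gamma>(2) characterD(6,7)[OF \<gamma>(1)] by auto
    then have disj: "Re (\<gamma> x) \<noteq> Re (\<gamma> y) \<or> Im (\<gamma> x) \<noteq> Im (\<gamma> y)"
      by (auto simp: complex_eq_iff)
    have re: "(\<lambda>x. Re (\<gamma> x)) \<in> R"
    proof -
      have "trig_poly (\<lambda>x. 1 / 2 * (\<gamma> x + cnj (\<gamma> x)))"
        by (intro trig_poly.intros character_cnj \<gamma>(1))
      moreover have "(\<lambda>x. 1 / 2 * (\<gamma> x + cnj (\<gamma> x))) = (\<lambda>x. complex_of_real (Re (\<gamma> x)))"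
        by (simp add: fun_eq_iff complex_eq_iff)
      ultimately show ?thesis
        by (simp add: R_def)
    qed
    have im: "(\<lambda>x. Im (\<gamma> x)) \<in> R"
    proof -
      have "trig_poly (\<lambda>x. - \<i> / 2 * (\<gamma> x + - 1 * cnj (\<gamma> x)))"
        by (intro trig_poly.intros character_cnj \<gamma>(1))
      moreover have "(\<lambda>x. - \<i> / 2 * (\<gamma> x + - 1 * cnj (\<gamma> x))) = (\<lambda>x. complex_of_real (Im (\<gamma> x)))"
        by (simp add: fun_eq_iff complex_eq_iff)
      ultimately show ?thesis
        by (simp add: R_def)
    qed
    from disj show "\<exists>f\<in>R. f x \<noteq> f y"
    proof
      assume "Re (\<gamma> x) \<noteq> Re (\<gamma> y)"
      with re show ?thesis
        by (intro bexI[where x = "\<lambda>x. Re (\<gamma> x)"])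
    next
      assume "Im (\<gamma> x) \<noteq> Im (\<gamma> y)"
      with im show ?thesis
        by (intro bexI[where x = "\<lambda>x. Im (\<gamma> x)"])
    qed
  qed (use compact_group in \<open>auto simp: R_def trig_poly_const trig_poly_mult trig_poly.add\<close>)
  from Stone_Weierstrass_basic[OF assms] obtain r where "r \<in> R" "\<forall>x\<in>UNIV. \<bar>f x - r x\<bar> < e" ..
  then show ?thesis
    by (intro that[of r]) (simp_all add: R_def)
qed

lemma trig_poly_dense:
  fixes f :: "'g \<Rightarrow> complex"
  assumes "continuous_on UNIV f" "0 < e"
  obtains p where "trig_poly p" "\<And>x. norm (f x - p x) < e"
proof -
  have "0 < e / 2"
    using assms(2) by simp
  obtain r where r: "trig_poly (\<lambda>x. complex_of_real (r x))" "\<And>x. \<bar>Re (f x) - r x\<bar> < e / 2"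
    by (rule trig_poly_dense_real[OF continuous_on_Re[OF assms(1)] \<open>0 < e / 2\<close>]) (rule that)
  obtain s where s: "trig_poly (\<lambda>x. complex_of_real (s x))" "\<And>x. \<bar>Im (f x) - s x\<bar> < e / 2"
    by (rule trig_poly_dense_real[OF continuous_on_Im[OF assms(1)] \<open>0 < e / 2\<close>]) (rule that)
  show ?thesis
  proof (rule that)
    show "trig_poly (\<lambda>x. complex_of_real (r x) + \<i> * complex_of_real (s x))"
      by (intro trig_poly.add trig_poly.scale r(1) s(1))
    show "norm (f x - (complex_of_real (r x) + \<i> * complex_of_real (s x))) < e" for x
      using cmod_le[of "f x - (complex_of_real (r x) + \<i> * complex_of_real (s x))"] r(2)[of x] s(2)[of x]
      by simp
  qed
qed

lemma bounded_mult_integrable: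
  fixes f :: "'g \<Rightarrow> complex"
  assumes "f \<in> borel_measurable m" "AE x in m. norm (f x) \<le> C"
    and "h \<in> borel_measurable m" "\<And>x. norm (h x) \<le> B"
  shows "integrable m (\<lambda>x. f x * h x)"
proof (rule integrable_const_bound)
  show "AE x in m. norm (f x * h x) \<le> C * B"
    using assms(2)
  proof eventually_elim
    case (elim x)
    then show ?case
      unfolding norm_mult using assms(4)[of x] order_trans[OF norm_ge_zero elim] by (intro mult_mono) auto
  qed
qed (use assms(1,3) in measurable)

lemma integral_mult_bound:
  fixes f h :: "'g \<Rightarrow> complex"
  assumes "f \<in> borel_measurable m" "AE x in m. norm (f x) \<le> C"
    and "h \<in> borel_measurable m" "\<And>x. norm (h x) \<le> B"
  shows "norm (\<integral>x. f x * h x \<partial>m) \<le> C * (\<integral>x. norm (h x) \<partial>m)"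
proof -
  have "norm (\<integral>x. f x * h x \<partial>m) \<le> (\<integral>x. norm (f x * h x) \<partial>m)"
    by (rule integral_norm_bound)
  also have "\<dots> \<le> (\<integral>x. C * norm (h x) \<partial>m)"
  proof (rule integral_mono_AE)
    show "integrable m (\<lambda>x. norm (f x * h x))"
      by (intro integrable_norm bounded_mult_integrable[OF assms])
    show "integrable m (\<lambda>x. C * norm (h x))"
      using assms(3,4) by (intro integrable_mult_right integrable_norm integrable_const_bound[where B = B]) auto
    show "AE x in m. norm (f x * h x) \<le> C * norm (h x)"
      using assms(2) by eventually_elim (simp add: norm_mult mult_right_mono)
  qed
  finally show ?thesis
    by simp
qed

lemma trig_poly_integral_zero:
  assumes f: "f \<in> borel_measurable m" "AE x in m. norm (f x) \<le> C"
    and zero: "\<And>\<gamma>. character \<gamma> \<Longrightarrow> (\<integral>x. f x * cnj (\<gamma> x) \<partial>m) = 0" and p: "trig_poly p"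
  shows "(\<integral>x. f x * p x \<partial>m) = 0"
  using p
proof (induction rule: trig_poly.induct)
  case (character \<gamma>)
  from zero[OF character_cnj[OF character]] show ?case
    by simp
next
  case (scale p c)
  then show ?case
    by (simp add: mult.left_commute)
next
  case (add p q)
  have int: "integrable m (\<lambda>x. f x * p x)" if tp: "trig_poly p" for p
  proof -
    obtain B where "0 < B" "\<And>x. norm (p x) \<le> B"
      by (rule continuous_bounded[OF trig_poly_continuous[OF tp]]) (rule that)
    then show ?thesis
      by (intro bounded_mult_integrable[OF f] continuous_measurable trig_poly_continuous tp)
  qed
  show ?case
    using add int[OF add.hyps(1)] int[OF add.hyps(2)] by (simp add: distrib_left)
qed

lemma outer_regular_prob:
  assumes "A \<in> sets borel" "0 < e"
  obtains U where "open U" "A \<subseteq> U" "prob U < prob A + e"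
proof -
  have "emeasure m A = (INF U\<in>{U. open U \<and> A \<subseteq> U}. emeasure m U)"
    using haar assms(1) unfolding normalized_haar_def by blast
  moreover have "emeasure m A < ennreal (prob A + e)"
    using assms(2) by (simp add: emeasure_eq_measure)
  ultimately have "(INF U\<in>{U. open U \<and> A \<subseteq> U}. emeasure m U) < ennreal (prob A + e)"
    by simp
  then have "\<exists>U\<in>{U. open U \<and> A \<subseteq> U}. emeasure m U < ennreal (prob A + e)"
    by (simp only: INF_less_iff)
  then obtain U where "open U" "A \<subseteq> U" "emeasure m U < ennreal (prob A + e)"
    by (elim bexE CollectE conjE) (rule that)
  moreover from this have "prob U < prob A + e"
    unfolding emeasure_eq_measure by (subst (asm) ennreal_less_iff) simp_all
  ultimately show ?thesis
    by (intro that)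
qed

text \<open>
  By density of the trigonometric polynomials \<open>f\<close> is orthogonal to all continuous functions.
  Regularity gives, for a Borel set \<open>A\<close>, closed and open sets \<open>- W \<subseteq> A \<subseteq> U\<close> that differ by small
  measure, and a Urysohn function between them shows that the integral of \<open>f\<close> over \<open>A\<close> is zero.
\<close>

theorem fourier_uniqueness:
  assumes f: "f \<in> borel_measurable m" "AE x in m. norm (f x) \<le> C"
    and zero: "\<And>\<gamma>. character \<gamma> \<Longrightarrow> (\<integral>x. f x * cnj (\<gamma> x) \<partial>m) = 0"
  shows "AE x in m. f x = 0"
proof -
  have C: "0 \<le> C"
  proof (rule ccontr)
    assume "\<not> 0 \<le> C"
    have "AE x in m. False"
    proof (rule eventually_mono[OF f(2)])
      fix x assume "norm (f x) \<le> C"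
      with \<open>\<not> 0 \<le> C\<close> show False
        using norm_ge_zero[of "f x"] by linarith
    qed
    then show False
      by simp
  qed
  have small: "norm (\<integral>x. f x * h x \<partial>m) = 0" if h: "continuous_on UNIV h" for h
  proof -
    obtain B where B: "0 < B" "\<And>x. norm (h x) \<le> B"
      by (rule continuous_bounded[OF h]) (rule that)
    have "norm (\<integral>x. f x * h x \<partial>m) \<le> C * e" if "0 < e" for e
    proof -
      obtain p where p: "trig_poly p" "\<And>x. norm (h x - p x) < e"
        by (rule trig_poly_dense[OF h \<open>0 < e\<close>]) (rule that)
      note cp = trig_poly_continuous[OF p(1)]
      obtain D where D: "0 < D" "\<And>x. norm (p x) \<le> D"
        by (rule continuous_bounded[OF cp]) (rule that)
      have "(\<integral>x. f x * h x \<partial>m) = (\<integral>x. f x * h x \<partial>m) - (\<integral>x. f x * p x \<partial>m)"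
        using trig_poly_integral_zero[OF f zero p(1)] by simp
      also have "\<dots> = (\<integral>x. f x * (h x - p x) \<partial>m)"
        using bounded_mult_integrable[OF f continuous_measurable[OF h] B(2)]
          bounded_mult_integrable[OF f continuous_measurable[OF cp] D(2)]
        by (simp add: right_diff_distrib)
      also have "norm \<dots> \<le> C * (\<integral>x. norm (h x - p x) \<partial>m)"
        by (rule integral_mult_bound[OF f, where B = e])
          (use p(2) in \<open>auto intro!: continuous_measurable continuous_intros h cp intro: less_imp_le\<close>)
      also have "(\<integral>x. norm (h x - p x) \<partial>m) \<le> (\<integral>x. e \<partial>m)"
        by (intro integral_mono continuous_integrable continuous_intros h cp less_imp_le p(2))
      finally show ?thesis
        using C by (simp add: mult_left_mono)
    qed
    then have "norm (\<integral>x. f x * h x \<partial>m) \<le> 0"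
      by (rule le_zero_if_le_mult_eps[OF C])
    then show ?thesis
      by simp
  qed
  have int_f: "integrable m f"
    using integrable_const_bound[OF f(2,1)] .
  have "set_lebesgue_integral m A f = 0" if A: "A \<in> sets m" for A
  proof -
    have "norm (set_lebesgue_integral m A f) \<le> (C * 2) * e" if e: "0 < e" for e
    proof -
      obtain U where U: "open U" "A \<subseteq> U" "prob U < prob A + e"
        by (rule outer_regular_prob[OF _ e, of A]) (use A in simp, rule that)
      obtain W where W: "open W" "- A \<subseteq> W" "prob W < prob (- A) + e"
        by (rule outer_regular_prob[OF _ e, of "- A"]) (use A in simp, rule that)
      have "prob (- A) = 1 - prob A"
        using prob_compl[OF A] by (simp add: Compl_eq_Diff_UNIV)
      moreover have "prob (- W) = 1 - prob W"
        using prob_compl[of W] W(1) by (simp add: Compl_eq_Diff_UNIV)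
      moreover have "prob (U - - W) = prob U - prob (- W)"
        using U(1,2) W(1,2) by (intro finite_measure_Diff) auto
      ultimately have small_diff: "prob (U - - W) < 2 * e"
        using U(3) W(3) by simp
      obtain h where h: "continuous_on UNIV h" "\<And>x. 0 \<le> h x" "\<And>x. h x \<le> (1 :: real)"
        "\<And>x. x \<in> - U \<Longrightarrow> h x = 0" "\<And>x. x \<in> - W \<Longrightarrow> h x = 1"
      proof (rule Urysohn_group[of "- U" "- W"])
        show "closed (- U)" "closed (- W)"
          using U(1) W(1) by (simp_all add: closed_Compl)
        show "- U \<inter> - W = {}"
          using U(2) W(2) by blast
      qed (rule that)
      define d where "d x = complex_of_real (indicator A x - h x)" for x
      have ch: "continuous_on UNIV (\<lambda>x. complex_of_real (h x))"
        by (intro continuous_intros h(1))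
      have [measurable]: "A \<in> sets m" "h \<in> borel_measurable m"
        using A by (auto intro: continuous_measurable h(1))
      have d: "d \<in> borel_measurable m"
        unfolding d_def by measurable
      have nd: "norm (d x) \<le> indicator (U - - W) x" for x
      proof -
        have eq: "norm (d x) = \<bar>indicator A x - h x\<bar>"
          unfolding d_def norm_of_real ..
        consider "x \<in> - U" | "x \<in> - W" | "x \<in> U - - W"
          by blast
        then show ?thesis
        proof cases
          case 1
          then have "x \<notin> A"
            using U(2) by blast
          with h(4)[OF 1] show ?thesis
            unfolding eq by simp
        next
          case 2
          then have "x \<in> A"
            using W(2) by blast
          with h(5)[OF 2] show ?thesis
            unfolding eq by simp
        next
          case 3
          moreover have "\<bar>indicator A x - h x\<bar> \<le> 1"
            using h(2,3)[of x] by (cases "x \<in> A") (auto simp: abs_le_iff)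
          ultimately show ?thesis
            unfolding eq by simp
        qed
      qed
      have nd1: "norm (d x) \<le> 1" for x
        using nd[of x] by (rule order_trans) (simp add: indicator_def)
      have nh: "norm (complex_of_real (h x)) \<le> 1" for x
        using h(2,3)[of x] by simp
      have "set_lebesgue_integral m A f = (\<integral>x. f x * d x + f x * complex_of_real (h x) \<partial>m)"
        unfolding set_lebesgue_integral_def
        by (intro Bochner_Integration.integral_cong refl)
          (simp add: d_def scaleR_conv_of_real algebra_simps)
      also have "\<dots> = (\<integral>x. f x * d x \<partial>m)"
        using small[OF ch] bounded_mult_integrable[OF f d nd1]
          bounded_mult_integrable[OF f continuous_measurable[OF ch] nh] by simp
      also have "norm \<dots> \<le> C * (\<integral>x. norm (d x) \<partial>m)"
        by (rule integral_mult_bound[OF f d nd1])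
      also have "(\<integral>x. norm (d x) \<partial>m) \<le> (\<integral>x. indicator (U - - W) x \<partial>m)"
      proof (rule integral_mono)
        show "integrable m (\<lambda>x. norm (d x))"
          using d nd1 by (intro integrable_norm integrable_const_bound[where B = 1]) auto
        show "integrable m (indicator (U - - W) :: _ \<Rightarrow> real)"
          using U(1) W(1) by (intro integrable_real_indicator) (auto simp: less_top[symmetric])
      qed (rule nd)
      also have "\<dots> = prob (U - - W)"
        using U(1) W(1) by simp
      finally have "norm (set_lebesgue_integral m A f) \<le> C * prob (U - - W)"
        using C by (simp add: mult_left_mono)
      also have "\<dots> \<le> C * (2 * e)"
        using C small_diff by (intro mult_left_mono) auto
      finally show ?thesis
        by simp
    qed
    then have "norm (set_lebesgue_integral m A f) \<le> 0"
      using C by (intro le_zero_if_le_mult_eps[of "C * 2"]) auto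
    then show ?thesis
      by simp
  qed
  then show ?thesis
    by (rule density_zero[OF int_f])
qed

end

section \<open>Absolutely convergent Dirichlet series and Gaussian damping\<close>

lemma frequency_summable:
  assumes "frequency lam" "freq_L lam < \<infinity>"
  obtains \<rho> where "0 < \<rho>" "summable (\<lambda>n. exp (- (\<rho> * lam n)))"
proof -
  from ereal_dense2[OF assms(2)[unfolded freq_L_def]]
  obtain l :: real where l: "limsup (\<lambda>n. ereal (ln (real (Suc n)) / lam n)) < ereal l"
    by (elim exE conjE) (rule that)
  define L where "L = max l 1"
  have L: "0 < L" "l \<le> L"
    by (auto simp: L_def)
  \<comment> \<open>From \<open>ln (n + 1) \<le> L \<lambda>\<^sub>n\<close> it follows that \<open>e\<^bsup>-2 L \<lambda>\<^sub>n\<^esup> \<le> (n + 1)\<^bsup>-2\<^esup>\<close>.\<close>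
  have "\<forall>\<^sub>F n in sequentially. ereal (ln (real (Suc n)) / lam n) < ereal l"
    using Limsup_lessD[OF l] .
  moreover have "\<forall>\<^sub>F n in sequentially. 1 \<le> lam n"
    using assms(1) unfolding frequency_def filterlim_at_top by blast
  ultimately have "\<forall>\<^sub>F n in sequentially. exp (- (2 * L * lam n)) \<le> inverse (real (Suc n) ^ 2)"
  proof eventually_elim
    case (elim n)
    have "ln (real (Suc n)) \<le> l * lam n"
      using elim by (simp add: divide_less_eq less_imp_le)
    also have "\<dots> \<le> L * lam n"
      using L(2) elim by (intro mult_right_mono) auto
    finally have "exp (- (2 * L * lam n)) \<le> exp (- (2 * ln (real (Suc n))))"
      by simp
    also have "\<dots> = inverse (real (Suc n) ^ 2)"
      by (simp add: exp_minus exp_double del: of_nat_Suc)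
    finally show ?case .
  qed
  moreover have "summable (\<lambda>n. inverse (real (Suc n) ^ 2))"
    using inverse_power_summable[of 2, where 'a = real] summable_Suc_iff[of "\<lambda>n. inverse (real n ^ 2)"] by simp
  ultimately have "summable (\<lambda>n. exp (- (2 * L * lam n)))"
    by (intro summable_comparison_test_ev[of "\<lambda>n. exp (- (2 * L * lam n))"]) auto
  then show ?thesis
    using L(1) by (intro that[of "2 * L"]) auto
qed

text \<open>
  The damping factor is the characteristic function of the standard normal distribution at
  \<open>d \<lambda>\<^sub>n\<close>. It beats every exponential in \<open>\<lambda>\<^sub>n\<close> and decreases in \<open>n\<close>.
\<close>

definition gauss :: "(nat \<Rightarrow> real) \<Rightarrow> dseries \<Rightarrow> real \<Rightarrow> dseries" where
  "gauss lam a d n = a n * complex_of_real (exp (- ((d * lam n)\<^sup>2 / 2)))"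

lemma gauss_summable:
  assumes "frequency lam" "summable (\<lambda>n. exp (- (\<rho> * lam n)))"
    and "\<And>n. norm (a n) \<le> A * exp (\<sigma> * lam n)" "0 < d"
  shows "summable (\<lambda>n. norm (gauss lam a d n))"
proof -
  have A: "0 \<le> A"
    using order_trans[OF norm_ge_zero assms(3)[of 0]] by (simp add: zero_le_mult_iff)
  have "\<forall>\<^sub>F n in sequentially. 2 * (\<rho> + \<sigma>) / d\<^sup>2 \<le> lam n"
    using assms(1) unfolding frequency_def filterlim_at_top by blast
  then have "\<forall>\<^sub>F n in sequentially. norm (norm (gauss lam a d n)) \<le> A * exp (- (\<rho> * lam n))"
  proof eventually_elim
    case (elim n)
    have "0 \<le> lam n"
      using assms(1) by (simp add: frequency_def)
    have "2 * (\<rho> + \<sigma>) \<le> lam n * d\<^sup>2"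
      using elim assms(4) by (simp add: divide_le_eq)
    then have "2 * (\<rho> + \<sigma>) * lam n \<le> (lam n * d\<^sup>2) * lam n"
      using \<open>0 \<le> lam n\<close> by (rule mult_right_mono)
    then have "\<sigma> * lam n + - ((d * lam n)\<^sup>2 / 2) \<le> - (\<rho> * lam n)"
      by (simp add: power2_eq_square algebra_simps)
    then have "A * exp (\<sigma> * lam n) * exp (- ((d * lam n)\<^sup>2 / 2)) \<le> A * exp (- (\<rho> * lam n))"
      using A unfolding mult.assoc exp_add[symmetric] by (intro mult_left_mono) auto
    moreover have "norm (gauss lam a d n) \<le> A * exp (\<sigma> * lam n) * exp (- ((d * lam n)\<^sup>2 / 2))"
      unfolding gauss_def norm_mult norm_of_real using assms(3)[of n] by (simp add: mult_right_mono)
    ultimately show ?case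
      by simp
  qed
  then show ?thesis
    by (rule summable_comparison_test_ev) (intro summable_mult assms(2))
qed

lemma norm_dterm: "norm (dterm lam a s n) = norm (a n) * exp (- (lam n * Re s))"
  by (simp add: dterm_def norm_mult)

lemma dconv_coefficient_bound:
  assumes "dconv lam a s"
  obtains A where "\<And>n. norm (a n) \<le> A * exp (Re s * lam n)"
proof -
  have "dterm lam a s \<longlonglongrightarrow> 0"
    using assms unfolding dconv_def by (rule summable_LIMSEQ_zero)
  then have "Bseq (dterm lam a s)"
    by (intro convergent_imp_Bseq convergentI)
  then obtain A where "\<forall>n. norm (dterm lam a s n) \<le> A"
    unfolding Bseq_def by (elim exE conjE) (rule that)
  then have A: "norm (dterm lam a s n) \<le> A" for n
    by simp
  have "norm (a n) \<le> A * exp (Re s * lam n)" for n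
  proof -
    have "norm (a n) = norm (dterm lam a s n) * exp (Re s * lam n)"
      unfolding norm_dterm by (simp add: mult.assoc mult.commute flip: exp_add)
    then show ?thesis
      using mult_right_mono[OF A[of n], of "exp (Re s * lam n)"] by simp
  qed
  then show ?thesis
    by (rule that)
qed

lemma dterm_abs_summable:
  assumes "\<And>n. 0 \<le> lam n" "summable (\<lambda>n. exp (- (\<rho> * lam n)))"
    and "\<And>n. norm (a n) \<le> A * exp (\<sigma> * lam n)" "\<sigma> + \<rho> \<le> Re s"
  shows "summable (\<lambda>n. norm (dterm lam a s n))"
proof (rule summable_comparison_test')
  have A: "0 \<le> A"
    using order_trans[OF norm_ge_zero assms(3)[of 0]] by (simp add: zero_le_mult_iff)
  show "summable (\<lambda>n. A * exp (- (\<rho> * lam n)))"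
    by (intro summable_mult assms(2))
  show "norm (norm (dterm lam a s n)) \<le> A * exp (- (\<rho> * lam n))" for n
  proof -
    have "norm (dterm lam a s n) \<le> A * exp (\<sigma> * lam n) * exp (- (lam n * Re s))"
      unfolding norm_dterm by (intro mult_right_mono assms(3)) simp
    also have "\<dots> \<le> A * exp (- (\<rho> * lam n))"
      unfolding mult.assoc exp_add[symmetric]
      using mult_right_mono[OF assms(4) assms(1)[of n]] A
      by (intro mult_left_mono) (simp_all add: algebra_simps)
    finally show ?thesis
      by simp
  qed
qed

lemma abs_dirichlet_uniform:
  assumes "\<And>n. 0 \<le> lam n" "summable (\<lambda>n. norm (c n))"
  shows "uniform_limit {s. 0 \<le> Re s} (\<lambda>n s. \<Sum>i<n. dterm lam c s i) (dlimit lam c) sequentially"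
  unfolding dlimit_def[abs_def]
proof (rule Weierstrass_m_test[OF _ assms(2)])
  fix n s assume "s \<in> {s. 0 \<le> Re s}"
  then have "exp (- (lam n * Re s)) \<le> 1"
    using assms(1)[of n] by simp
  then show "norm (dterm lam c s n) \<le> norm (c n)"
    unfolding norm_dterm by (intro mult_left_le) auto
qed

lemma abs_dirichlet_continuous:
  assumes "\<And>n. 0 \<le> lam n" "summable (\<lambda>n. norm (c n))"
  shows "continuous_on {s. 0 \<le> Re s} (dlimit lam c)"
  by (rule uniform_limit_theorem[OF _ abs_dirichlet_uniform[OF assms]])
    (auto simp: dterm_def intro!: always_eventually continuous_intros)

lemma right_half_plane_topology:
  "open (right_half_plane \<sigma>)" "convex (right_half_plane \<sigma>)" "connected (right_half_plane \<sigma>)"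
  "right_half_plane \<sigma> \<noteq> {}"
proof -
  show "open (right_half_plane \<sigma>)"
    unfolding right_half_plane_def by (rule open_halfspace_Re_gt)
  show "convex (right_half_plane \<sigma>)"
    unfolding right_half_plane_def by (rule convex_halfspace_Re_gt)
  then show "connected (right_half_plane \<sigma>)"
    by (rule convex_connected)
  have "complex_of_real (\<sigma> + 1) \<in> right_half_plane \<sigma>"
    by (simp add: right_half_plane_def)
  then show "right_half_plane \<sigma> \<noteq> {}"
    by blast
qed

lemma abs_dirichlet_holomorphic:
  assumes "\<And>n. 0 \<le> lam n" "summable (\<lambda>n. norm (c n))"
  shows "dlimit lam c holomorphic_on right_half_plane 0"
proof (rule holomorphic_uniform_sequence[where f = "\<lambda>n s. \<Sum>i<n. dterm lam c s i"])
  show "open (right_half_plane 0)"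
    by (rule right_half_plane_topology)
  show "(\<lambda>s. \<Sum>i<n. dterm lam c s i) holomorphic_on right_half_plane 0" for n
    unfolding dterm_def by (intro holomorphic_intros)
  fix x assume "x \<in> right_half_plane 0"
  then obtain d where d: "0 < d" "cball x d \<subseteq> right_half_plane 0"
    using right_half_plane_topology(1) open_contains_cball by blast
  then have "cball x d \<subseteq> {s. 0 \<le> Re s}"
    by (force simp: right_half_plane_def)
  then have "uniform_limit (cball x d) (\<lambda>n s. \<Sum>i<n. dterm lam c s i) (dlimit lam c) sequentially"
    by (rule uniform_limit_on_subset[OF abs_dirichlet_uniform[OF assms]])
  with d show "\<exists>d>0. cball x d \<subseteq> right_half_plane 0 \<and>
      uniform_limit (cball x d) (\<lambda>n s. \<Sum>i<n. dterm lam c s i) (dlimit lam c) sequentially"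
    by (intro exI[of _ d] conjI)
qed

lemma abs_dirichlet_bound:
  assumes "\<And>n. 0 \<le> lam n" "summable (\<lambda>n. norm (c n))" "0 \<le> Re s"
  shows "norm (dlimit lam c s) \<le> (\<Sum>n. norm (c n))"
proof -
  have *: "norm (dterm lam c s n) \<le> norm (c n)" for n
    unfolding norm_dterm using assms(1)[of n] assms(3) by (intro mult_left_le) auto
  have sm: "summable (\<lambda>n. norm (dterm lam c s n))"
    by (rule summable_comparison_test'[OF assms(2)]) (simp add: *)
  have "norm (dlimit lam c s) \<le> (\<Sum>n. norm (dterm lam c s n))"
    unfolding dlimit_def by (rule summable_norm[OF sm])
  also have "\<dots> \<le> (\<Sum>n. norm (c n))"
    by (rule suminf_le[OF * sm assms(2)])
  finally show ?thesis .
qed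

text \<open>
  Dividing by \<open>1 + \<epsilon> z\<close>, whose modulus is at least \<open>1\<close> and at least \<open>\<epsilon> |z|\<close> on the half plane, makes the
  function small on large semicircles, so the maximum principle applies to half discs. Then \<open>\<epsilon> \<rightarrow> 0\<close>.
\<close>

lemma Phragmen_Lindelof_half_plane:
  assumes hol: "g holomorphic_on right_half_plane 0" and cont: "continuous_on {s. 0 \<le> Re s} g"
    and bdd: "\<And>s. 0 \<le> Re s \<Longrightarrow> norm (g s) \<le> B" and im: "\<And>s. Re s = 0 \<Longrightarrow> norm (g s) \<le> M"
    and s: "0 < Re s"
  shows "norm (g s) \<le> M"
proof -
  have M: "0 \<le> M"
    using order_trans[OF norm_ge_zero im[of 0]] by simp
  have B: "0 \<le> B"
    using order_trans[OF norm_ge_zero bdd[of 0]] by simp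
  have main: "norm (g s) \<le> M' * norm (1 + complex_of_real \<epsilon> * s)" if M': "M < M'" and \<epsilon>: "0 < \<epsilon>" for \<epsilon> M'
  proof -
    define h where "h z = g z / (1 + complex_of_real \<epsilon> * z)" for z
    have low: "1 \<le> norm (1 + complex_of_real \<epsilon> * z)" "\<epsilon> * norm z \<le> norm (1 + complex_of_real \<epsilon> * z)"
      if "0 \<le> Re z" for z
    proof -
      have "0 \<le> \<epsilon> * Re z"
        using \<epsilon> that by simp
      then show "1 \<le> norm (1 + complex_of_real \<epsilon> * z)"
        using complex_Re_le_cmod[of "1 + complex_of_real \<epsilon> * z"] by simp
      have "(norm (complex_of_real \<epsilon> * z))\<^sup>2 \<le> (norm (1 + complex_of_real \<epsilon> * z))\<^sup>2"
        unfolding cmod_power2 using \<open>0 \<le> \<epsilon> * Re z\<close> by (simp add: power2_sum)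
      then have "norm (complex_of_real \<epsilon> * z) \<le> norm (1 + complex_of_real \<epsilon> * z)"
        by (rule power2_le_imp_le) simp
      then show "\<epsilon> * norm z \<le> norm (1 + complex_of_real \<epsilon> * z)"
        using \<epsilon> by (simp add: norm_mult)
    qed
    have nz: "1 + complex_of_real \<epsilon> * z \<noteq> 0" if "0 \<le> Re z" for z
      using low(1)[OF that] by auto
    \<comment> \<open>On the semicircle of this radius the quotient is at most \<open>M'\<close>; the second term puts \<open>s\<close> inside.\<close>
    define R where "R = max (B / (\<epsilon> * M')) (norm s + 1)"
    have "0 < M'"
      using M M' by simp
    have R: "norm s < R" "B / (\<epsilon> * R) \<le> M'"
    proof -
      show "norm s < R"
        by (simp add: R_def)
      have "0 < R"
        unfolding R_def by (simp add: less_max_iff_disj add_nonneg_pos)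
      have "B / (\<epsilon> * M') \<le> R"
        by (simp add: R_def)
      then show "B / (\<epsilon> * R) \<le> M'"
        using \<open>0 < R\<close> \<open>0 < M'\<close> \<epsilon> by (simp add: field_simps)
    qed
    define S where "S = right_half_plane 0 \<inter> ball 0 R"
    have oS: "open S"
      unfolding S_def by (intro open_Int right_half_plane_topology open_ball)
    have clS: "closure S \<subseteq> {s. 0 \<le> Re s} \<inter> cball 0 R"
    proof (rule closure_minimal)
      show "S \<subseteq> {s. 0 \<le> Re s} \<inter> cball 0 R"
        by (auto simp: S_def right_half_plane_def)
      show "closed ({s. 0 \<le> Re s} \<inter> cball 0 R)"
        by (intro closed_Int closed_halfspace_Re_ge closed_cball)
    qed
    have "norm (h s) \<le> M'"
    proof (rule maximum_modulus_frontier[where S = S and f = h])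
      show "h holomorphic_on interior S"
        unfolding interior_open[OF oS] h_def
        by (intro holomorphic_intros holomorphic_on_subset[OF hol])
          (use nz in \<open>auto simp: S_def right_half_plane_def\<close>)
      show "continuous_on (closure S) h"
        unfolding h_def using clS nz
        by (intro continuous_intros continuous_on_subset[OF cont]) auto
      show "bounded S"
        unfolding S_def by (rule bounded_Int) simp
      show "s \<in> S"
        using s R(1) by (simp add: S_def right_half_plane_def)
      fix z assume "z \<in> frontier S"
      then have z: "z \<in> closure S" "z \<notin> S"
        using oS by (auto simp: frontier_def interior_open)
      then have Rez: "0 \<le> Re z" and zR: "norm z \<le> R"
        using clS by auto
      have hz: "norm (h z) = norm (g z) / norm (1 + complex_of_real \<epsilon> * z)"
        by (simp add: h_def norm_divide)
      consider "Re z = 0" | "norm z = R"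
        using z(2) Rez zR by (fastforce simp: S_def right_half_plane_def)
      then show "norm (h z) \<le> M'"
      proof cases
        case 1
        have "norm (g z) / norm (1 + complex_of_real \<epsilon> * z) \<le> norm (g z) / 1"
          using low(1)[OF Rez] by (intro divide_left_mono) auto
        then show ?thesis
          using im[OF 1] M' hz by simp
      next
        case 2
        have "norm (g z) / norm (1 + complex_of_real \<epsilon> * z) \<le> B / (\<epsilon> * R)"
        proof (rule frac_le[OF B bdd[OF Rez]])
          show "0 < \<epsilon> * R"
            using \<epsilon> order.strict_trans1[OF norm_ge_zero R(1)] by (rule mult_pos_pos)
          show "\<epsilon> * R \<le> norm (1 + complex_of_real \<epsilon> * z)"
            using low(2)[OF Rez] unfolding 2 .
        qed
        then show ?thesis
          using R(2) hz by simp
      qed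
    qed
    then show ?thesis
      using nz[of s] s by (simp add: h_def norm_divide divide_le_eq)
  qed
  have "norm (g s) \<le> M'" if "M < M'" for M'
  proof -
    have "((\<lambda>\<epsilon>. M' * norm (1 + complex_of_real \<epsilon> * s)) \<longlongrightarrow> M' * norm (1 + complex_of_real 0 * s)) (at_right 0)"
      by (intro tendsto_intros)
    moreover have "\<forall>\<^sub>F \<epsilon> in at_right 0. norm (g s) \<le> M' * norm (1 + complex_of_real \<epsilon> * s)"
      using eventually_at_right_less[of 0] by eventually_elim (rule main[OF that])
    ultimately have "norm (g s) \<le> M' * norm (1 + complex_of_real 0 * s)"
      by (rule tendsto_lowerbound) simp
    then show ?thesis
      by simp
  qed
  then show ?thesis
    by (rule dense_ge)
qed

text \<open>
  Summation by parts expresses the weighted sum through the partial sums of \<open>c\<close>, with the non-negative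
  weights \<open>w i - w (Suc i)\<close> and \<open>w N\<close>, which add up to \<open>w 0\<close>.
\<close>

lemma Abel_inequality:
  fixes c :: "nat \<Rightarrow> complex" and w :: "nat \<Rightarrow> real"
  assumes "\<And>i. w (Suc i) \<le> w i" "\<And>i. 0 \<le> w i" "\<And>j. norm (\<Sum>i<j. c i) \<le> e"
  shows "norm (\<Sum>i<N. c i * complex_of_real (w i)) \<le> e * w 0"
proof -
  define C where "C j = (\<Sum>i<j. c i)" for j
  have parts: "(\<Sum>i<N. c i * complex_of_real (w i)) =
      C N * complex_of_real (w N) + (\<Sum>i<N. C (Suc i) * complex_of_real (w i - w (Suc i)))" for N
    by (induction N) (simp_all add: C_def algebra_simps)
  have tele: "(\<Sum>i<N. w i - w (Suc i)) = w 0 - w N" for N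
    by (rule sum_lessThan_telescope')
  have "norm (\<Sum>i<N. c i * complex_of_real (w i)) \<le>
      norm (C N * complex_of_real (w N)) + norm (\<Sum>i<N. C (Suc i) * complex_of_real (w i - w (Suc i)))"
    unfolding parts by (rule norm_triangle_ineq)
  also have "norm (C N * complex_of_real (w N)) \<le> e * w N"
    unfolding norm_mult norm_of_real C_def
    using mult_right_mono[OF assms(3)[of N] assms(2)[of N]] assms(2)[of N] by simp
  also have "norm (\<Sum>i<N. C (Suc i) * complex_of_real (w i - w (Suc i))) \<le> (\<Sum>i<N. e * (w i - w (Suc i)))"
  proof (rule sum_norm_le)
    fix i
    have "0 \<le> w i - w (Suc i)"
      using assms(1)[of i] by simp
    then show "norm (C (Suc i) * complex_of_real (w i - w (Suc i))) \<le> e * (w i - w (Suc i))"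
      unfolding norm_mult norm_of_real C_def
      using mult_right_mono[OF assms(3)[of "Suc i"]] by simp
  qed
  also have "\<dots> = e * (w 0 - w N)"
    unfolding sum_distrib_left[symmetric] tele ..
  finally show ?thesis
    by (simp add: algebra_simps)
qed

text \<open>
  Abel's inequality bounds the tails of the damped series by the tails of the given convergent series, uniformly in
  \<open>k\<close>; on the initial segment the weights converge to \<open>1\<close>.
\<close>

lemma monotone_summation_regular:
  fixes b :: "nat \<Rightarrow> complex" and w :: "nat \<Rightarrow> nat \<Rightarrow> real"
  assumes mono: "\<And>k i. w k (Suc i) \<le> w k i" and pos: "\<And>k i. 0 \<le> w k i" and le1: "\<And>k i. w k i \<le> 1"
    and lim: "\<And>i. (\<lambda>k. w k i) \<longlonglongrightarrow> 1"
    and b: "summable b" and bw: "\<And>k. summable (\<lambda>n. b n * complex_of_real (w k n))"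
  shows "(\<lambda>k. \<Sum>n. b n * complex_of_real (w k n)) \<longlonglongrightarrow> suminf b"
proof (rule LIMSEQ_I)
  fix e :: real assume e: "0 < e"
  define e' where "e' = e / 4"
  have e': "0 < e'"
    using e by (simp add: e'_def)
  from b[unfolded summable_Cauchy, rule_format, OF e'] obtain N
    where "\<forall>m\<ge>N. \<forall>n. norm (sum b {m..<n}) < e'" ..
  then have N: "norm (sum b {N..<k}) < e'" for k
    by blast
  have tail_b: "norm (\<Sum>i<j. b (i + N)) \<le> e'" for j
    using N[of "N + j"] sum.shift_bounds_nat_ivl[of b 0 N j]
    by (simp add: lessThan_atLeast0 add.commute less_imp_le)
  have t1: "norm (\<Sum>i. b (i + N)) \<le> e'"
  proof (rule tendsto_upperbound[OF tendsto_norm])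
    show "(\<lambda>j. \<Sum>i<j. b (i + N)) \<longlonglongrightarrow> (\<Sum>i. b (i + N))"
      by (rule summable_LIMSEQ) (use b in simp)
  qed (use tail_b in auto)
  have t2: "norm (\<Sum>i. b (i + N) * complex_of_real (w k (i + N))) \<le> e'" for k
  proof (rule tendsto_upperbound[OF tendsto_norm])
    show "(\<lambda>j. \<Sum>i<j. b (i + N) * complex_of_real (w k (i + N))) \<longlonglongrightarrow>
        (\<Sum>i. b (i + N) * complex_of_real (w k (i + N)))"
      by (rule summable_LIMSEQ) (rule summable_ignore_initial_segment[OF bw])
    have "norm (\<Sum>i<j. b (i + N) * complex_of_real (w k (i + N))) \<le> e' * w k (0 + N)" for j
      using mono pos by (intro Abel_inequality[where w = "\<lambda>i. w k (i + N)"] tail_b) auto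
    also have "e' * w k (0 + N) \<le> e'"
      using le1 e' by (simp add: mult_left_le)
    finally show "\<forall>\<^sub>F j in sequentially. norm (\<Sum>i<j. b (i + N) * complex_of_real (w k (i + N))) \<le> e'"
      by simp
  qed simp
  have "(\<lambda>k. \<Sum>n<N. b n * complex_of_real (w k n)) \<longlonglongrightarrow> (\<Sum>n<N. b n * complex_of_real 1)"
    by (intro tendsto_intros lim)
  from LIMSEQ_D[OF this e'] obtain K where K: "\<And>k. K \<le> k \<Longrightarrow>
      norm ((\<Sum>n<N. b n * complex_of_real (w k n)) - (\<Sum>n<N. b n)) < e'"
    by auto
  have "norm ((\<Sum>n. b n * complex_of_real (w k n)) - suminf b) < e" if "K \<le> k" for k
  proof -
    define x where "x = (\<Sum>n<N. b n * complex_of_real (w k n)) - (\<Sum>n<N. b n)"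
    define y where "y = (\<Sum>i. b (i + N) * complex_of_real (w k (i + N)))"
    define z where "z = (\<Sum>i. b (i + N))"
    have eq: "(\<Sum>n. b n * complex_of_real (w k n)) - suminf b = x + (y - z)"
      unfolding suminf_split_initial_segment[OF b, of N] suminf_split_initial_segment[OF bw[of k], of N]
        x_def y_def z_def by simp
    have "norm (x + (y - z)) \<le> norm x + (norm y + norm z)"
      by (intro order_trans[OF norm_triangle_ineq] add_left_mono norm_triangle_ineq4)
    moreover have "norm x < e'" "norm y \<le> e'" "norm z \<le> e'"
      unfolding x_def y_def z_def by (rule K[OF that], rule t2, rule t1)
    ultimately show ?thesis
      unfolding eq using e by (simp add: e'_def)
  qed
  then show "\<exists>no. \<forall>n\<ge>no. norm ((\<Sum>na. b na * complex_of_real (w n na)) - suminf b) < e"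
    by blast
qed

section \<open>Bounded extensions and damped series\<close>

text \<open>
  The damped series are bounded by \<open>M\<close> on the half plane by Phragmen-Lindelof, hence a normal family. A
  limit for \<open>d \<rightarrow> 0\<close> equals the undamped series wherever that converges, also where the
  convergence is only conditional, by regularity of the damping.
\<close>

lemma gauss_bound_imp_extension:
  assumes freq: "frequency lam" and \<rho>: "summable (\<lambda>n. exp (- (\<rho> * lam n)))"
    and a: "\<And>n. norm (a n) \<le> A * exp (\<sigma>0 * lam n)"
    and bound: "\<And>d t. 0 < d \<Longrightarrow> norm (dlimit lam (gauss lam a d) (\<i> * complex_of_real t)) \<le> M"
  obtains F where "bdd_extension lam a F" "\<And>s. s \<in> right_half_plane 0 \<Longrightarrow> norm (F s) \<le> M"
proof -
  have lam: "\<And>n. 0 \<le> lam n" and inc: "strict_mono lam"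
    using freq by (auto simp: frequency_def)
  define d where "d k = inverse (real (Suc k))" for k
  have d: "0 < d k" for k
    by (simp add: d_def)
  have sm: "summable (\<lambda>n. norm (gauss lam a (d k) n))" for k
    by (rule gauss_summable[OF freq \<rho> a d])
  define G where "G k = dlimit lam (gauss lam a (d k))" for k
  have hol: "G k holomorphic_on right_half_plane 0" for k
    unfolding G_def by (rule abs_dirichlet_holomorphic[OF lam sm])
  have le: "norm (G k s) \<le> M" if "s \<in> right_half_plane 0" for k s
  proof (rule Phragmen_Lindelof_half_plane[OF hol])
    show "continuous_on {s. 0 \<le> Re s} (G k)"
      unfolding G_def by (rule abs_dirichlet_continuous[OF lam sm])
    show "norm (G k s) \<le> (\<Sum>n. norm (gauss lam a (d k) n))" if "0 \<le> Re s" for s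
      unfolding G_def by (rule abs_dirichlet_bound[OF lam sm that])
    show "norm (G k s) \<le> M" if "Re s = 0" for s
    proof -
      have "s = \<i> * complex_of_real (Im s)"
        using that by (simp add: complex_eq_iff)
      then show ?thesis
        unfolding G_def using bound[OF d, of k "Im s"] by simp
    qed
    show "0 < Re s"
      using that by (simp add: right_half_plane_def)
  qed
  define H where "H = {h. h holomorphic_on right_half_plane 0 \<and> (\<forall>z\<in>right_half_plane 0. norm (h z) \<le> M)}"
  obtain F r where F: "F holomorphic_on right_half_plane 0" and r: "strict_mono (r :: nat \<Rightarrow> nat)"
    and lim: "\<And>x. x \<in> right_half_plane 0 \<Longrightarrow> (\<lambda>n. G (r n) x) \<longlonglongrightarrow> F x"
  proof (rule Montel[of "right_half_plane 0" H G])
    show "open (right_half_plane 0)"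
      by (rule right_half_plane_topology)
    show "h holomorphic_on right_half_plane 0" if "h \<in> H" for h
      using that by (simp add: H_def)
    show "\<exists>B. \<forall>h\<in>H. \<forall>z\<in>K. norm (h z) \<le> B" if "compact K" "K \<subseteq> right_half_plane 0" for K
      using that(2) by (intro exI[of _ M]) (auto simp: H_def)
    show "range G \<subseteq> H"
      using hol le by (auto simp: H_def)
  qed (rule that)
  have Fle: "norm (F s) \<le> M" if s: "s \<in> right_half_plane 0" for s
    by (rule tendsto_upperbound[OF tendsto_norm[OF lim[OF s]]]) (simp_all add: le[OF s])
  have "F s = dlimit lam a s" if s: "s \<in> right_half_plane 0" and conv: "dconv lam a s" for s
  proof -
    define w where "w k n = exp (- ((d k * lam n)\<^sup>2 / 2))" for k n
    have dt: "dterm lam (gauss lam a (d k)) s n = dterm lam a s n * complex_of_real (w k n)" for k n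
      by (simp add: dterm_def gauss_def w_def)
    have "(\<lambda>k. \<Sum>n. dterm lam a s n * complex_of_real (w k n)) \<longlonglongrightarrow> suminf (dterm lam a s)"
    proof (rule monotone_summation_regular)
      show "w k (Suc i) \<le> w k i" for k i
      proof -
        have "d k * lam i \<le> d k * lam (Suc i)"
          using strict_mono_less_eq[OF inc, of i "Suc i"] d[of k] by (intro mult_left_mono) auto
        then have "(d k * lam i)\<^sup>2 \<le> (d k * lam (Suc i))\<^sup>2"
          using d[of k] lam[of i] by (intro power_mono) auto
        then show ?thesis
          by (simp add: w_def)
      qed
      show "0 \<le> w k i" "w k i \<le> 1" for k i
        by (simp_all add: w_def)
      show "(\<lambda>k. w k i) \<longlonglongrightarrow> 1" for i
      proof -
        have "d \<longlonglongrightarrow> 0"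
          unfolding d_def by (rule LIMSEQ_inverse_real_of_nat)
        then have "(\<lambda>k. w k i) \<longlonglongrightarrow> exp (- ((0 * lam i)\<^sup>2 / 2))"
          unfolding w_def by (intro tendsto_intros) auto
        then show ?thesis
          by simp
      qed
      show "summable (dterm lam a s)"
        using conv by (simp add: dconv_def)
      show "summable (\<lambda>n. dterm lam a s n * complex_of_real (w k n))" for k
      proof (rule summable_norm_cancel, rule summable_comparison_test'[OF sm[of k]])
        fix n
        have "exp (- (lam n * Re s)) \<le> 1"
          using s lam[of n] by (simp add: right_half_plane_def)
        then show "norm (norm (dterm lam a s n * complex_of_real (w k n))) \<le> norm (gauss lam a (d k) n)"
          unfolding dt[symmetric] by (simp add: norm_dterm mult_left_le)
      qed
    qed
    then have "(\<lambda>k. G k s) \<longlonglongrightarrow> dlimit lam a s"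
      unfolding G_def dlimit_def dt[abs_def] .
    then have "(\<lambda>n. G (r n) s) \<longlonglongrightarrow> dlimit lam a s"
      using LIMSEQ_subseq_LIMSEQ[OF _ r] by (simp add: o_def)
    with lim[OF s] show ?thesis
      by (rule LIMSEQ_unique)
  qed
  then have "bdd_extension lam a F"
    unfolding bdd_extension_def using F Fle
    by (auto simp: bounded_iff right_half_plane_def)
  from that[OF this Fle] show ?thesis .
qed

text \<open>
  Convergence at one point bounds the coefficients exponentially, and \<open>\<Sum> e\<^bsup>-\<rho> \<lambda>\<^sub>n\<^esup> < \<infinity>\<close> then gives
  absolute convergence far enough to the right. There every extension is the limit function, which is
  the starting point for the identity theorem.
\<close>

lemma abs_convergent_half_plane:
  assumes "\<And>n. 0 \<le> lam n" "summable (\<lambda>n. exp (- (\<rho> * lam n)))" "dconv lam a s0"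
  obtains \<sigma> where "0 \<le> \<sigma>" "\<And>s. s \<in> right_half_plane \<sigma> \<Longrightarrow> summable (\<lambda>n. norm (dterm lam a s n))"
    "\<And>F s. bdd_extension lam a F \<Longrightarrow> s \<in> right_half_plane \<sigma> \<Longrightarrow> F s = dlimit lam a s"
proof -
  obtain A where A: "\<And>n. norm (a n) \<le> A * exp (Re s0 * lam n)"
    by (rule dconv_coefficient_bound[OF assms(3)]) (rule that)
  define \<sigma> where "\<sigma> = max 0 (Re s0 + \<rho>)"
  have 0: "0 \<le> \<sigma>"
    by (simp add: \<sigma>_def)
  have 1: "summable (\<lambda>n. norm (dterm lam a s n))" if "s \<in> right_half_plane \<sigma>" for s
    by (rule dterm_abs_summable[OF assms(1,2) A]) (use that in \<open>simp add: right_half_plane_def \<sigma>_def\<close>)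
  have "\<forall>s\<in>right_half_plane \<sigma>. dconv lam a s"
    using summable_norm_cancel[OF 1] by (auto simp: dconv_def)
  then have 2: "F s = dlimit lam a s" if "bdd_extension lam a F" "s \<in> right_half_plane \<sigma>" for F s
    using that 0 unfolding bdd_extension_def by blast
  show ?thesis
  proof (rule that[of \<sigma>])
    show "summable (\<lambda>n. norm (dterm lam a s n))" if "s \<in> right_half_plane \<sigma>" for s
      by (rule 1[OF that])
    show "F s = dlimit lam a s" if "bdd_extension lam a F" "s \<in> right_half_plane \<sigma>" for F s
      by (rule 2[OF that])
  qed (rule 0)
qed

lemma bdd_extension_unique:
  assumes "\<And>n. 0 \<le> lam n" "summable (\<lambda>n. exp (- (\<rho> * lam n)))" "dconv lam a s0"
    and "bdd_extension lam a F" "bdd_extension lam a F'" "s \<in> right_half_plane 0"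
  shows "F s = F' s"
proof -
  obtain \<sigma> where \<sigma>: "0 \<le> \<sigma>" "\<And>F s. bdd_extension lam a F \<Longrightarrow> s \<in> right_half_plane \<sigma> \<Longrightarrow> F s = dlimit lam a s"
    by (rule abs_convergent_half_plane[OF assms(1-3)]) (rule that)
  show ?thesis
  proof (rule analytic_continuation_open[of "right_half_plane \<sigma>" "right_half_plane 0" F F'])
    show "right_half_plane \<sigma> \<subseteq> right_half_plane 0"
      using \<sigma>(1) by (auto simp: right_half_plane_def)
    show "F holomorphic_on right_half_plane 0" "F' holomorphic_on right_half_plane 0"
      using assms(4,5) by (simp_all add: bdd_extension_def)
    show "F z = F' z" if "z \<in> right_half_plane \<sigma>" for z
      using \<sigma>(2)[OF assms(4) that] \<sigma>(2)[OF assms(5) that] by simp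
  qed (simp_all add: right_half_plane_topology assms(6))
qed

lemma D_norm_attains:
  assumes "a \<in> D_ext lam"
  obtains F s0 where "dconv lam a s0" "bdd_extension lam a F"
    "\<And>s. s \<in> right_half_plane 0 \<Longrightarrow> norm (F s) \<le> D_norm lam a"
proof -
  obtain s0 where s0: "dconv lam a s0" and ex: "\<exists>F. bdd_extension lam a F"
    using assms by (auto simp: D_ext_def)
  define F where "F = (SOME F. bdd_extension lam a F)"
  have F: "bdd_extension lam a F"
    unfolding F_def by (rule someI_ex[OF ex])
  have "bounded (F ` right_half_plane 0)"
    using F by (simp add: bdd_extension_def)
  then have "bdd_above ((\<lambda>s. norm (F s)) ` right_half_plane 0)"
    unfolding bounded_iff by (auto intro: bdd_aboveI2)
  then have "norm (F s) \<le> D_norm lam a" if "s \<in> right_half_plane 0" for s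
    unfolding D_norm_def F_def[symmetric] using that by (rule cSUP_upper[rotated])
  from that[OF s0 F this] show ?thesis .
qed

lemma D_norm_le:
  assumes "\<And>n. 0 \<le> lam n" "summable (\<lambda>n. exp (- (\<rho> * lam n)))" "dconv lam a s0"
    and F: "bdd_extension lam a F" "\<And>s. s \<in> right_half_plane 0 \<Longrightarrow> norm (F s) \<le> M"
  shows "D_norm lam a \<le> M"
  unfolding D_norm_def
proof (rule cSUP_least)
  fix s assume s: "s \<in> right_half_plane 0"
  have "bdd_extension lam a (SOME F. bdd_extension lam a F)"
    by (rule someI[of "bdd_extension lam a", OF F(1)])
  from bdd_extension_unique[OF assms(1-3) this F(1) s]
  show "norm ((SOME F. bdd_extension lam a F) s) \<le> M"
    using F(2)[OF s] by simp
qed (rule right_half_plane_topology)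

text \<open>
  Cauchy's estimate for the derivative on discs of radius \<open>\<eta> / 2\<close>. The Lipschitz bound dominates the difference
  quotients in \<open>gaussian_average_derivative\<close>.
\<close>

lemma bounded_holomorphic_Lipschitz:
  assumes hol: "F holomorphic_on right_half_plane 0"
    and C: "\<And>s. s \<in> right_half_plane 0 \<Longrightarrow> norm (F s) \<le> C"
    and \<eta>: "0 < \<eta>" "z \<in> right_half_plane \<eta>" "w \<in> right_half_plane \<eta>"
  shows "norm (F z - F w) \<le> 2 * C / \<eta> * norm (z - w)"
proof (rule field_differentiable_bound[OF right_half_plane_topology(2)[of \<eta>] _ _ \<eta>(2,3)])
  fix u assume u: "u \<in> right_half_plane \<eta>"
  have sub: "cball u (\<eta> / 2) \<subseteq> right_half_plane 0"
  proof
    fix v assume "v \<in> cball u (\<eta> / 2)"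
    then have "Re (u - v) \<le> \<eta> / 2"
      using complex_Re_le_cmod[of "u - v"] by (simp add: dist_norm)
    then show "v \<in> right_half_plane 0"
      using u \<eta>(1) by (simp add: right_half_plane_def)
  qed
  have "u \<in> right_half_plane 0"
    using u \<eta>(1) by (simp add: right_half_plane_def)
  then show "(F has_field_derivative deriv F u) (at u within right_half_plane \<eta>)"
    using holomorphic_derivI[OF hol right_half_plane_topology(1)] has_field_derivative_at_within by blast
  have "norm ((deriv ^^ 1) F u) \<le> fact 1 * C / (\<eta> / 2) ^ 1"
  proof (rule Cauchy_inequality)
    show "F holomorphic_on ball u (\<eta> / 2)"
      using sub ball_subset_cball by (intro holomorphic_on_subset[OF hol]) blast
    show "continuous_on (cball u (\<eta> / 2)) F"
      by (rule continuous_on_subset[OF holomorphic_on_imp_continuous_on[OF hol] sub])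
    show "norm (F x) \<le> C" if "norm (u - x) = \<eta> / 2" for x
    proof -
      have "x \<in> cball u (\<eta> / 2)"
        using that by (simp add: dist_norm)
      then show ?thesis
        using sub by (intro C) blast
    qed
  qed (use \<eta>(1) in simp)
  then show "norm (deriv F u) \<le> 2 * C / \<eta>"
    by (simp add: mult.commute)
qed

lemma prob_space_std_normal: "prob_space std_normal_distribution"
  using prob_space_normal_density[of 1 0] by simp

lemma gaussian_average_derivative:
  fixes d :: real
  assumes hol: "F holomorphic_on right_half_plane 0"
    and C: "\<And>s. s \<in> right_half_plane 0 \<Longrightarrow> norm (F s) \<le> C" and s: "s \<in> right_half_plane 0"
  shows "((\<lambda>s. LINT x|std_normal_distribution. F (s + \<i> * complex_of_real (d * x))) has_field_derivative
      (LINT x|std_normal_distribution. deriv F (s + \<i> * complex_of_real (d * x)))) (at s)"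
proof -
  interpret N: prob_space std_normal_distribution
    by (rule prob_space_std_normal)
  define c where "c x = \<i> * complex_of_real (d * x)" for x
  have Rec: "z + c x \<in> right_half_plane \<sigma> \<longleftrightarrow> z \<in> right_half_plane \<sigma>" for z x \<sigma>
    by (simp add: right_half_plane_def c_def)
  have meas: "(\<lambda>x. g (z + c x)) \<in> borel_measurable std_normal_distribution"
    if g: "continuous_on (right_half_plane 0) g" and z: "z \<in> right_half_plane 0" for g :: "complex \<Rightarrow> complex" and z
  proof -
    have "continuous_on UNIV (\<lambda>x. g (z + c x))"
      by (rule continuous_on_compose2[OF g]) (use z Rec in \<open>auto simp: c_def intro!: continuous_intros\<close>)
    then show ?thesis
      by (simp add: borel_measurable_continuous_onI)
  qed
  have cF: "continuous_on (right_half_plane 0) F"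
    by (rule holomorphic_on_imp_continuous_on[OF hol])
  have cF': "continuous_on (right_half_plane 0) (deriv F)"
    by (intro holomorphic_on_imp_continuous_on holomorphic_deriv hol right_half_plane_topology)
  have int: "integrable std_normal_distribution (\<lambda>x. F (z + c x))" if "z \<in> right_half_plane 0" for z
    by (rule N.integrable_const_bound[where B = C, OF _ meas[OF cF that]])
      (use that Rec in \<open>auto intro!: C\<close>)
  define \<eta> where "\<eta> = Re s / 2"
  have \<eta>: "0 < \<eta>"
    using s by (simp add: \<eta>_def right_half_plane_def)
  have ball: "z \<in> right_half_plane \<eta>" if "z \<in> ball s \<eta>" for z
    using that complex_Re_le_cmod[of "s - z"] by (simp add: dist_norm right_half_plane_def \<eta>_def)
  have rhp: "z \<in> right_half_plane 0" if "z \<in> right_half_plane \<eta>" for z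
    using that \<eta> by (simp add: right_half_plane_def)
  have s': "s \<in> ball s \<eta>"
    using \<eta> by simp
  have "((\<lambda>z. LINT x|std_normal_distribution. F (z + c x)) has_field_derivative
      (LINT x|std_normal_distribution. deriv F (s + c x))) (at s within ball s \<eta>)"
    unfolding has_field_derivative_iff tendsto_at_iff_sequentially o_def
  proof (intro allI impI)
    fix X assume X: "\<forall>i. X i \<in> ball s \<eta> - {s}" "X \<longlonglongrightarrow> s"
    have Xb: "X i \<in> right_half_plane \<eta>" "X i \<noteq> s" for i
      using X(1) ball by auto
    have "(\<lambda>i. LINT x|std_normal_distribution. (F (X i + c x) - F (s + c x)) / (X i - s))
        \<longlonglongrightarrow> (LINT x|std_normal_distribution. deriv F (s + c x))"
    proof (rule integral_dominated_convergence[where w = "\<lambda>_. 2 * C / \<eta>"])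
      show "(\<lambda>x. deriv F (s + c x)) \<in> borel_measurable std_normal_distribution"
        by (rule meas[OF cF' s])
      show "(\<lambda>x. (F (X i + c x) - F (s + c x)) / (X i - s)) \<in> borel_measurable std_normal_distribution" for i
        by (intro borel_measurable_divide borel_measurable_diff meas[OF cF] s rhp Xb measurable_const)
          simp
      show "AE x in std_normal_distribution. (\<lambda>i. (F (X i + c x) - F (s + c x)) / (X i - s)) \<longlonglongrightarrow> deriv F (s + c x)"
      proof (intro always_eventually allI)
        fix x
        have "(F has_field_derivative deriv F (s + c x)) (at (s + c x))"
          by (rule holomorphic_derivI[OF hol right_half_plane_topology(1)]) (use s Rec in simp)
        then have "((\<lambda>z. F (z + c x)) has_field_derivative deriv F (s + c x)) (at s)"
          by (simp add: DERIV_shift)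
        then show "(\<lambda>i. (F (X i + c x) - F (s + c x)) / (X i - s)) \<longlonglongrightarrow> deriv F (s + c x)"
          unfolding has_field_derivative_iff tendsto_at_iff_sequentially o_def
          using X(2) Xb(2) by simp
      qed
      show "AE x in std_normal_distribution. norm ((F (X i + c x) - F (s + c x)) / (X i - s)) \<le> 2 * C / \<eta>" for i
      proof (intro always_eventually allI)
        fix x
        have "norm (F (X i + c x) - F (s + c x)) \<le> 2 * C / \<eta> * norm ((X i + c x) - (s + c x))"
          by (rule bounded_holomorphic_Lipschitz[OF hol C \<eta>]) (use Xb ball[OF s'] Rec in auto)
        then show "norm ((F (X i + c x) - F (s + c x)) / (X i - s)) \<le> 2 * C / \<eta>"
          using Xb(2)[of i] by (simp add: norm_divide divide_le_eq)
      qed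
    qed simp
    moreover have "(LINT x|std_normal_distribution. (F (X i + c x) - F (s + c x)) / (X i - s)) =
        ((LINT x|std_normal_distribution. F (X i + c x)) - (LINT x|std_normal_distribution. F (s + c x))) / (X i - s)" for i
      using int[OF rhp[OF Xb(1)[of i]]] int[OF s] by simp
    ultimately show "(\<lambda>i. ((LINT x|std_normal_distribution. F (X i + c x)) -
        (LINT x|std_normal_distribution. F (s + c x))) / (X i - s)) \<longlonglongrightarrow>
        (LINT x|std_normal_distribution. deriv F (s + c x))"
      by (simp only:)
  qed
  then show ?thesis
    unfolding at_within_open[OF s' open_ball] c_def .
qed

lemma gaussian_average_series:
  fixes d :: real
  assumes sm: "summable (\<lambda>n. norm (dterm lam a s n))"
  shows "(LINT x|std_normal_distribution. dlimit lam a (s + \<i> * complex_of_real (d * x))) =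
    dlimit lam (gauss lam a d) s"
proof -
  interpret N: prob_space std_normal_distribution
    by (rule prob_space_std_normal)
  define e where "e n x = exp (\<i> * complex_of_real (- (d * lam n) * x))" for n x
  have dt: "dterm lam a (s + \<i> * complex_of_real (d * x)) n = dterm lam a s n * e n x" for n x
  proof -
    have "- (complex_of_real (lam n) * (s + \<i> * complex_of_real (d * x))) =
        - (complex_of_real (lam n) * s) + \<i> * complex_of_real (- (d * lam n) * x)"
      by (simp add: algebra_simps)
    then show ?thesis
      unfolding dterm_def e_def by (simp only: exp_add mult.assoc)
  qed
  have ne: "norm (e n x) = 1" for n x
    unfolding e_def by (rule norm_exp_i_times)
  have me: "e n \<in> borel_measurable std_normal_distribution" for n
    unfolding e_def by simp
  have int: "integrable std_normal_distribution (\<lambda>x. dterm lam a s n * e n x)" for n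
    by (intro integrable_mult_right N.integrable_const_bound[where B = 1, OF _ me]) (simp add: ne)
  have "(LINT x|std_normal_distribution. dlimit lam a (s + \<i> * complex_of_real (d * x))) =
      (LINT x|std_normal_distribution. (\<Sum>n. dterm lam a s n * e n x))"
    unfolding dlimit_def dt ..
  also have "\<dots> = (\<Sum>n. LINT x|std_normal_distribution. dterm lam a s n * e n x)"
  proof (rule integral_suminf[OF int])
    show "AE x in std_normal_distribution. summable (\<lambda>n. norm (dterm lam a s n * e n x))"
      by (simp add: norm_mult ne sm)
    show "summable (\<lambda>n. LINT x|std_normal_distribution. norm (dterm lam a s n * e n x))"
      using N.prob_space by (simp add: norm_mult ne sm)
  qed
  also have "\<dots> = (\<Sum>n. dterm lam (gauss lam a d) s n)"
  proof (rule suminf_cong)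
    fix n
    have "(LINT x|std_normal_distribution. e n x) = char std_normal_distribution (- (d * lam n))"
      by (simp add: char_def e_def)
    also have "\<dots> = complex_of_real (exp (- ((d * lam n)\<^sup>2 / 2)))"
      unfolding char_std_normal_distribution by simp
    finally show "(LINT x|std_normal_distribution. dterm lam a s n * e n x) = dterm lam (gauss lam a d) s n"
      by (simp add: dterm_def gauss_def)
  qed
  finally show ?thesis
    by (simp add: dlimit_def)
qed

text \<open>
  The Gaussian average of the extension over vertical lines is holomorphic and bounded by \<open>C\<close>. Far to the right
  it can be computed term by term and is the damped series; by the identity theorem this holds on
  the whole half plane, and the bound passes to the imaginary axis by continuity.
\<close>

lemma extension_imp_gauss_bound:
  assumes freq: "frequency lam" and \<rho>: "summable (\<lambda>n. exp (- (\<rho> * lam n)))"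
    and conv: "dconv lam a s0" and F: "bdd_extension lam a F"
    and C: "\<And>s. s \<in> right_half_plane 0 \<Longrightarrow> norm (F s) \<le> C" and d: "0 < d"
  shows "norm (dlimit lam (gauss lam a d) (\<i> * complex_of_real t)) \<le> C"
proof -
  interpret N: prob_space std_normal_distribution
    by (rule prob_space_std_normal)
  have lam: "0 \<le> lam n" for n
    using freq by (simp add: frequency_def)
  have hol: "F holomorphic_on right_half_plane 0"
    using F by (simp add: bdd_extension_def)
  obtain A where A: "\<And>n. norm (a n) \<le> A * exp (Re s0 * lam n)"
    by (rule dconv_coefficient_bound[OF conv]) (rule that)
  note sm = gauss_summable[OF freq \<rho> A d]
  obtain \<sigma> where \<sigma>: "0 \<le> \<sigma>" "\<And>s. s \<in> right_half_plane \<sigma> \<Longrightarrow> summable (\<lambda>n. norm (dterm lam a s n))"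
    "\<And>F s. bdd_extension lam a F \<Longrightarrow> s \<in> right_half_plane \<sigma> \<Longrightarrow> F s = dlimit lam a s"
    by (rule abs_convergent_half_plane[OF lam \<rho> conv]) (rule that)
  define P where "P s = (LINT x|std_normal_distribution. F (s + \<i> * complex_of_real (d * x)))" for s
  have holP: "P holomorphic_on right_half_plane 0"
    unfolding P_def holomorphic_on_open[OF right_half_plane_topology(1)]
    using gaussian_average_derivative[OF hol C] by blast
  have eq: "P s = dlimit lam (gauss lam a d) s" if s: "s \<in> right_half_plane 0" for s
  proof (rule analytic_continuation_open[of "right_half_plane \<sigma>" "right_half_plane 0" P])
    show "right_half_plane \<sigma> \<subseteq> right_half_plane 0"
      using \<sigma>(1) by (auto simp: right_half_plane_def)
    show "dlimit lam (gauss lam a d) holomorphic_on right_half_plane 0"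
      by (rule abs_dirichlet_holomorphic[OF lam sm])
    show "P z = dlimit lam (gauss lam a d) z" if z: "z \<in> right_half_plane \<sigma>" for z
    proof -
      have "F (z + \<i> * complex_of_real (d * x)) = dlimit lam a (z + \<i> * complex_of_real (d * x))" for x
        by (rule \<sigma>(3)[OF F]) (use z in \<open>simp add: right_half_plane_def\<close>)
      then show ?thesis
        unfolding P_def using gaussian_average_series[OF \<sigma>(2)[OF z]] by simp
    qed
  qed (simp_all add: right_half_plane_topology holP s)
  have le: "norm (dlimit lam (gauss lam a d) s) \<le> C" if s: "s \<in> right_half_plane 0" for s
  proof -
    have "norm (P s) \<le> (LINT x|std_normal_distribution. C)"
      unfolding P_def
    proof (rule order_trans[OF integral_norm_bound integral_mono'])
      show "norm (F (s + \<i> * complex_of_real (d * x))) \<le> C" for x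
        by (rule C) (use s in \<open>simp add: right_half_plane_def\<close>)
    qed (use order_trans[OF norm_ge_zero C[OF s]] in simp_all)
    then show ?thesis
      unfolding eq[OF s, symmetric] using N.prob_space by simp
  qed
  define z where "z n = complex_of_real (inverse (real (Suc n))) + \<i> * complex_of_real t" for n
  have z: "z n \<in> right_half_plane 0" for n
    unfolding z_def right_half_plane_def by (simp del: of_nat_Suc)
  have "z \<longlonglongrightarrow> complex_of_real 0 + \<i> * complex_of_real t"
    unfolding z_def by (intro tendsto_intros LIMSEQ_inverse_real_of_nat)
  then have lim: "z \<longlonglongrightarrow> \<i> * complex_of_real t"
    by simp
  have "(\<lambda>n. dlimit lam (gauss lam a d) (z n)) \<longlonglongrightarrow> dlimit lam (gauss lam a d) (\<i> * complex_of_real t)"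
  proof (rule continuous_on_tendsto_compose[OF abs_dirichlet_continuous[OF lam sm] lim])
    show "\<forall>\<^sub>F n in sequentially. z n \<in> {s. 0 \<le> Re s}"
      using z by (intro always_eventually) (simp add: right_half_plane_def less_imp_le)
  qed simp
  from tendsto_norm[OF this] show ?thesis
    by (rule tendsto_upperbound) (simp_all add: le[OF z])
qed

section \<open>Classes of essentially bounded functions\<close>

context compact_haar begin

lemma Linf_norm_bounds:
  assumes f: "rep u \<in> borel_measurable m" and fin: "esssup m (\<lambda>x. ereal (norm (rep u x))) < \<infinity>"
  shows "AE x in m. norm (rep u x) \<le> Linf_norm m u" "0 \<le> Linf_norm m u"
proof -
  define e where "e = esssup m (\<lambda>x. ereal (norm (rep u x)))"
  have AE: "AE x in m. ereal (norm (rep u x)) \<le> e"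
    unfolding e_def by (rule esssup_AE)
  have "0 \<le> e"
  proof (rule ccontr)
    assume neg: "\<not> 0 \<le> e"
    have "AE x in m. False"
    proof (rule eventually_mono[OF AE])
      fix x assume "ereal (norm (rep u x)) \<le> e"
      then have "0 \<le> e"
        by (rule order_trans[rotated]) simp
      with neg show False ..
    qed
    then show False
      by simp
  qed
  with fin have "\<bar>e\<bar> \<noteq> \<infinity>"
    unfolding e_def by auto
  then have e: "e = ereal (Linf_norm m u)"
    unfolding Linf_norm_def e_def[symmetric] by (simp add: ereal_real)
  show "AE x in m. norm (rep u x) \<le> Linf_norm m u"
    using AE unfolding e by simp
  show "0 \<le> Linf_norm m u"
    using \<open>0 \<le> e\<close> unfolding e by simp
qed

lemma rep_ae_class:
  assumes "f \<in> borel_measurable m"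
  shows "rep (ae_class m f) \<in> borel_measurable m" "AE x in m. rep (ae_class m f) x = f x"
proof -
  have "f \<in> ae_class m f"
    using assms by (simp add: ae_class_def)
  then have "rep (ae_class m f) \<in> ae_class m f"
    unfolding rep_def by (rule someI[of "\<lambda>k. k \<in> ae_class m f" f])
  then show "rep (ae_class m f) \<in> borel_measurable m" "AE x in m. rep (ae_class m f) x = f x"
    by (simp_all add: ae_class_def)
qed

lemma ae_class_cong:
  assumes "AE x in m. f x = g x"
  shows "ae_class m f = ae_class m g"
proof -
  have "(AE x in m. k x = f x) \<longleftrightarrow> (AE x in m. k x = g x)" for k
  proof
    assume "AE x in m. k x = f x"
    with assms show "AE x in m. k x = g x"
      by eventually_elim simp
  next
    assume "AE x in m. k x = g x"
    with assms show "AE x in m. k x = f x"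
      by eventually_elim simp
  qed
  then show ?thesis
    by (simp add: ae_class_def)
qed

lemma Linf_rep:
  assumes "u \<in> Linf m"
  shows "rep u \<in> borel_measurable m" "ae_class m (rep u) = u"
    "AE x in m. norm (rep u x) \<le> Linf_norm m u" "0 \<le> Linf_norm m u"
proof -
  obtain f where u: "u = ae_class m f" and f: "f \<in> borel_measurable m"
    and fin: "esssup m (\<lambda>x. ereal (norm (f x))) < \<infinity>"
    using assms by (auto simp: Linf_def)
  have AE: "AE x in m. rep u x = f x"
    unfolding u by (rule rep_ae_class(2)[OF f])
  show meas: "rep u \<in> borel_measurable m"
    unfolding u by (rule rep_ae_class(1)[OF f])
  show "ae_class m (rep u) = u"
    unfolding ae_class_cong[OF AE] by (rule u[symmetric])
  have "esssup m (\<lambda>x. ereal (norm (rep u x))) = esssup m (\<lambda>x. ereal (norm (f x)))"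
    by (rule esssup_AE_cong) (use AE meas f in auto)
  with fin have "esssup m (\<lambda>x. ereal (norm (rep u x))) < \<infinity>"
    by simp
  then show "AE x in m. norm (rep u x) \<le> Linf_norm m u" "0 \<le> Linf_norm m u"
    using Linf_norm_bounds[OF meas] by blast+
qed

lemma ae_class_Linf:
  assumes f: "f \<in> borel_measurable m" and C: "AE x in m. norm (f x) \<le> C"
  shows "ae_class m f \<in> Linf m" "Linf_norm m (ae_class m f) \<le> C"
proof -
  have le: "esssup m (\<lambda>x. ereal (norm (g x))) \<le> ereal C"
    if "g \<in> borel_measurable m" "AE x in m. norm (g x) \<le> C" for g :: "'g \<Rightarrow> complex"
    using that by (intro esssup_I) auto
  have fin: "esssup m (\<lambda>x. ereal (norm (f x))) < \<infinity>"
    using le[OF f C] by (rule order.strict_trans1) simp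
  then show L: "ae_class m f \<in> Linf m"
    unfolding Linf_def using f by blast
  have "AE x in m. norm (rep (ae_class m f) x) \<le> C"
    using rep_ae_class(2)[OF f] C by eventually_elim simp
  then have "esssup m (\<lambda>x. ereal (norm (rep (ae_class m f) x))) \<le> ereal C"
    by (rule le[OF rep_ae_class(1)[OF f]])
  moreover have "0 \<le> C"
  proof (rule ccontr)
    assume "\<not> 0 \<le> C"
    have "AE x in m. False"
    proof (rule eventually_mono[OF C])
      fix x assume "norm (f x) \<le> C"
      with \<open>\<not> 0 \<le> C\<close> show False
        using norm_ge_zero[of "f x"] by linarith
    qed
    then show False
      by simp
  qed
  ultimately show "Linf_norm m (ae_class m f) \<le> C"
    unfolding Linf_norm_def
    by (cases "esssup m (\<lambda>x. ereal (norm (rep (ae_class m f) x)))") auto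
qed

lemma fourier_coeff_ae_class:
  assumes f: "f \<in> borel_measurable m" and \<gamma>: "character \<gamma>"
  shows "fourier_coeff m (ae_class m f) \<gamma> = (\<integral>x. f x * cnj (\<gamma> x) \<partial>m)"
  unfolding fourier_coeff_def
proof (rule integral_cong_AE)
  have m\<gamma>: "(\<lambda>x. cnj (\<gamma> x)) \<in> borel_measurable m"
    by (intro continuous_measurable continuous_intros characterD(1)[OF \<gamma>])
  show "(\<lambda>x. rep (ae_class m f) x * cnj (\<gamma> x)) \<in> borel_measurable m"
    "(\<lambda>x. f x * cnj (\<gamma> x)) \<in> borel_measurable m"
    by (intro borel_measurable_times m\<gamma> f rep_ae_class(1))+
  show "AE x in m. rep (ae_class m f) x * cnj (\<gamma> x) = f x * cnj (\<gamma> x)"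
    using rep_ae_class(2)[OF f] by eventually_elim simp
qed

lemma character_integrable:
  assumes f: "f \<in> borel_measurable m" "AE x in m. norm (f x) \<le> C" and \<gamma>: "character \<gamma>"
  shows "integrable m (\<lambda>x. f x * cnj (\<gamma> x))"
  using characterD(1,2)[OF \<gamma>]
  by (intro bounded_mult_integrable[OF f, where B = 1] continuous_measurable continuous_intros) auto

text \<open>
  Translation by \<open>y\<close> multiplies the integral by \<open>\<gamma> y * cnj (\<delta> y)\<close>, which is not \<open>1\<close> for a suitable \<open>y\<close> if the
  characters differ.
\<close>

lemma character_orthogonal:
  assumes \<gamma>: "character \<gamma>" and \<delta>: "character \<delta>"
  shows "(\<integral>x. \<gamma> x * cnj (\<delta> x) \<partial>m) = (if \<gamma> = \<delta> then 1 else 0)"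
proof (cases "\<gamma> = \<delta>")
  case True
  then show ?thesis
    by (simp add: characterD(7)[OF \<delta>])
next
  case False
  then obtain y where y: "\<gamma> y \<noteq> \<delta> y"
    by blast
  have "continuous_on UNIV (\<lambda>x. \<gamma> x * cnj (\<delta> x))"
    by (intro continuous_intros characterD(1) \<gamma> \<delta>)
  then have "(\<integral>x. \<gamma> (y + x) * cnj (\<delta> (y + x)) \<partial>m) = (\<integral>x. \<gamma> x * cnj (\<delta> x) \<partial>m)"
    by (rule integral_translate[OF continuous_measurable])
  moreover have "(\<lambda>x. \<gamma> (y + x) * cnj (\<delta> (y + x))) = (\<lambda>x. \<gamma> y * cnj (\<delta> y) * (\<gamma> x * cnj (\<delta> x)))"
    by (simp add: characterD(3)[OF \<gamma>] characterD(3)[OF \<delta>] fun_eq_iff)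
  ultimately have "\<gamma> y * cnj (\<delta> y) * (\<integral>x. \<gamma> x * cnj (\<delta> x) \<partial>m) = (\<integral>x. \<gamma> x * cnj (\<delta> x) \<partial>m)"
    by simp
  moreover have "\<gamma> y * cnj (\<delta> y) \<noteq> 1"
  proof
    assume "\<gamma> y * cnj (\<delta> y) = 1"
    then have "\<gamma> y * (\<delta> y * cnj (\<delta> y)) = \<delta> y"
      by (simp add: mult_ac)
    with y show False
      by (simp add: characterD(7)[OF \<delta>])
  qed
  ultimately show ?thesis
    using False by simp
qed

end

section \<open>From bounded extensions to functions on the group\<close>

locale dirichlet_setting = compact_haar m
  for m :: "'g::{topological_ab_group_add, t2_space} measure" +
  fixes lam :: "nat \<Rightarrow> real" and \<beta> :: "real \<Rightarrow> 'g"
  assumes freq: "frequency lam" and group: "lam_dirichlet_group lam \<beta>"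
    and L_finite: "freq_L lam < \<infinity>"
begin

lemma lam_nonneg: "0 \<le> lam n"
  using freq by (simp add: frequency_def)

abbreviation h :: "nat \<Rightarrow> 'g \<Rightarrow> complex" where
  "h n \<equiv> h_char \<beta> (lam n)"

lemma range_dense:
  assumes "closed S" "\<And>t. \<beta> t \<in> S"
  shows "x \<in> S"
proof -
  have "closure (range \<beta>) \<subseteq> S"
    using assms by (intro closure_minimal) auto
  moreover have "closure (range \<beta>) = UNIV"
    using group by (simp add: lam_dirichlet_group_def dirichlet_group_def)
  ultimately show ?thesis
    by blast
qed

lemma represents_unique:
  assumes "represents \<beta> \<mu> \<gamma>" "represents \<beta> \<mu> \<delta>"
  shows "\<gamma> = \<delta>"
proof
  fix x
  have "closed {x. \<gamma> x = \<delta> x}"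
    using assms by (intro closed_Collect_eq) (auto simp: represents_def character_def)
  moreover have "\<beta> t \<in> {x. \<gamma> x = \<delta> x}" for t
    using assms by (simp add: represents_def)
  ultimately have "x \<in> {x. \<gamma> x = \<delta> x}"
    by (rule range_dense)
  then show "\<gamma> x = \<delta> x"
    by simp
qed

lemma h_represents: "represents \<beta> (lam n) (h n)"
proof -
  obtain \<gamma> where \<gamma>: "represents \<beta> (lam n) \<gamma>"
    using group by (auto simp: lam_dirichlet_group_def)
  show ?thesis
    unfolding h_char_def
    by (rule theI[of "represents \<beta> (lam n)", OF \<gamma>]) (rule represents_unique[OF _ \<gamma>])
qed

lemma h_character: "character (h n)"
  using h_represents by (simp add: represents_def)

lemma h_beta: "h n (\<beta> t) = exp (- (\<i> * complex_of_real (lam n) * complex_of_real t))"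
  using h_represents by (simp add: represents_def)

lemma h_inject: "h n = h k \<longleftrightarrow> n = k"
proof
  assume eq: "h n = h k"
  show "n = k"
  proof (rule ccontr)
    assume "n \<noteq> k"
    then have ne: "lam n - lam k \<noteq> 0"
      using freq strict_mono_eq[of lam n k] by (simp add: frequency_def)
    \<comment> \<open>At this time the two exponentials have opposite signs.\<close>
    define t where "t = pi / (lam n - lam k)"
    have t: "lam n * t = lam k * t + pi"
      using ne by (simp add: t_def field_simps)
    have "h n (\<beta> t) = exp (- (\<i> * complex_of_real (lam n * t)))"
      unfolding h_beta by (simp add: mult.assoc)
    also have "\<dots> = exp (- (\<i> * complex_of_real (lam k * t)) + - (\<i> * complex_of_real pi))"
      unfolding t by (simp add: algebra_simps)
    also have "\<dots> = h k (\<beta> t) * exp (- (\<i> * complex_of_real pi))"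
      unfolding exp_add h_beta by (simp add: mult.assoc)
    also have "exp (- (\<i> * complex_of_real pi)) = - 1"
      by (simp add: exp_minus)
    finally have "h k (\<beta> t) = 0"
      using eq by simp
    then show False
      by (simp add: h_beta)
  qed
qed simp

text \<open>
  The transfer of a series from the half plane to the group: its values along \<open>\<beta>\<close> are those of the Dirichlet
  series on the imaginary axis (\<open>group_series_beta\<close>).
\<close>

definition group_series :: "dseries \<Rightarrow> 'g \<Rightarrow> complex" where
  "group_series c x = (\<Sum>n. c n * h n x)"

lemma norm_h [simp]: "norm (h n x) = 1"
  by (rule characterD(2)[OF h_character])

lemma group_series_sums:
  assumes "summable (\<lambda>n. norm (c n))"
  shows "(\<lambda>n. c n * h n x) sums group_series c x"
  unfolding group_series_def
  by (rule summable_sums, rule summable_norm_cancel) (simp add: norm_mult assms)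

lemma continuous_group_series:
  assumes "summable (\<lambda>n. norm (c n))"
  shows "continuous_on UNIV (group_series c)"
proof -
  have "uniform_limit UNIV (\<lambda>n x. \<Sum>i<n. c i * h i x) (\<lambda>x. \<Sum>i. c i * h i x) sequentially"
    by (rule Weierstrass_m_test[OF _ assms]) (simp add: norm_mult)
  then show ?thesis
    unfolding group_series_def[abs_def]
    by (rule uniform_limit_theorem[rotated])
      (auto intro!: always_eventually continuous_intros characterD(1)[OF h_character])
qed

lemma group_series_beta: "group_series c (\<beta> t) = dlimit lam c (\<i> * complex_of_real t)"
  by (simp add: group_series_def dlimit_def dterm_def h_beta mult_ac)

lemma integral_group_series:
  assumes c: "summable (\<lambda>n. norm (c n))" and k: "continuous_on UNIV k"
  shows "(\<lambda>n. c n * (\<integral>x. h n x * k x \<partial>m)) sums (\<integral>x. group_series c x * k x \<partial>m)"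
proof -
  obtain B where B: "0 < B" "\<And>x. norm (k x) \<le> B"
    by (rule continuous_bounded[OF k]) (rule that)
  have cont: "continuous_on UNIV (\<lambda>x. c n * (h n x * k x))" for n
    by (intro continuous_intros characterD(1)[OF h_character] k)
  have bound: "norm (c n * (h n x * k x)) \<le> norm (c n) * B" for n x
    by (simp add: norm_mult mult_left_mono B(2))
  have sm: "summable (\<lambda>n. norm (c n) * B)"
    by (intro summable_mult2 c)
  have "(\<lambda>n. \<integral>x. c n * (h n x * k x) \<partial>m) sums (\<integral>x. (\<Sum>n. c n * (h n x * k x)) \<partial>m)"
  proof (rule sums_integral)
    show "integrable m (\<lambda>x. c n * (h n x * k x))" for n
      by (rule continuous_integrable[OF cont])
    show "AE x in m. summable (\<lambda>n. norm (c n * (h n x * k x)))"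
      by (intro always_eventually allI summable_comparison_test'[OF sm]) (simp only: real_norm_def abs_norm_cancel bound)
    show "summable (\<lambda>n. \<integral>x. norm (c n * (h n x * k x)) \<partial>m)"
    proof (rule summable_comparison_test'[OF sm])
      fix n
      have "(\<integral>x. norm (c n * (h n x * k x)) \<partial>m) \<le> (\<integral>x. norm (c n) * B \<partial>m)"
        by (intro integral_mono continuous_integrable continuous_on_norm cont bound) simp
      then show "norm (\<integral>x. norm (c n * (h n x * k x)) \<partial>m) \<le> norm (c n) * B"
        by simp
    qed
  qed
  moreover have "(\<Sum>n. c n * (h n x * k x)) = group_series c x * k x" for x
    using sums_mult2[OF group_series_sums[OF c, of x], of "k x"] by (simp add: sums_iff mult.assoc)
  ultimately show ?thesis
    by simp
qed

lemma group_series_coefficient: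
  assumes c: "summable (\<lambda>n. norm (c n))" and \<gamma>: "character \<gamma>"
  shows "(\<integral>x. group_series c x * cnj (\<gamma> x) \<partial>m) = (\<Sum>n. c n * (if h n = \<gamma> then 1 else 0))"
proof -
  have "continuous_on UNIV (\<lambda>x. cnj (\<gamma> x))"
    by (intro continuous_intros characterD(1)[OF \<gamma>])
  from integral_group_series[OF c this] show ?thesis
    by (simp only: character_orthogonal[OF h_character \<gamma>] sums_iff)
qed

lemma group_series_coefficient_h:
  assumes c: "summable (\<lambda>n. norm (c n))"
  shows "(\<integral>x. group_series c x * cnj (h k x) \<partial>m) = c k"
proof -
  have "(\<lambda>n. c n * (if h n = h k then 1 else 0)) = (\<lambda>n. if n = k then c k else 0)"
    by (auto simp: h_inject)
  then show ?thesis
    unfolding group_series_coefficient[OF c h_character] using sums_single[of k "\<lambda>_. c k"]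
    by (simp add: sums_iff)
qed

lemma group_series_coefficient_other:
  assumes c: "summable (\<lambda>n. norm (c n))" and \<gamma>: "character \<gamma>" "\<And>n. \<gamma> \<noteq> h n"
  shows "(\<integral>x. group_series c x * cnj (\<gamma> x) \<partial>m) = 0"
proof -
  have "(\<lambda>n. c n * (if h n = \<gamma> then 1 else 0)) = (\<lambda>n. 0)"
    using \<gamma>(2)[symmetric] by simp
  then show ?thesis
    unfolding group_series_coefficient[OF c \<gamma>(1)] by simp
qed

lemma sqnorm_group_series:
  assumes c: "summable (\<lambda>n. norm (c n))"
  shows "(\<lambda>n. (norm (c n))\<^sup>2) sums sqnorm (group_series c)"
proof -
  note cont = continuous_group_series[OF c]
  have "(\<integral>x. h n x * cnj (group_series c x) \<partial>m) = cnj (c n)" for n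
  proof -
    have "(\<integral>x. h n x * cnj (group_series c x) \<partial>m) = (\<integral>x. cnj (group_series c x * cnj (h n x)) \<partial>m)"
      by (simp add: mult.commute)
    also have "\<dots> = cnj (c n)"
      unfolding Bochner_Integration.integral_cnj group_series_coefficient_h[OF c] ..
    finally show ?thesis .
  qed
  moreover have "continuous_on UNIV (\<lambda>x. cnj (group_series c x))"
    by (intro continuous_intros cont)
  ultimately have "(\<lambda>n. c n * cnj (c n)) sums (\<integral>x. group_series c x * cnj (group_series c x) \<partial>m)"
    using integral_group_series[OF c, of "\<lambda>x. cnj (group_series c x)"] by simp
  then have "(\<lambda>n. complex_of_real ((norm (c n))\<^sup>2)) sums complex_of_real (sqnorm (group_series c))"
    unfolding complex_norm_square inner_self[symmetric] inner_m_def .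
  then show ?thesis
    by (simp only: sums_of_real_iff)
qed

lemma summable_rho:
  obtains \<rho> where "0 < \<rho>" "summable (\<lambda>n. exp (- (\<rho> * lam n)))"
  by (rule frequency_summable[OF freq L_finite])

lemma gauss_difference:
  "gauss lam a d n - gauss lam a d' n =
    a n * complex_of_real (exp (- ((d * lam n)\<^sup>2 / 2)) - exp (- ((d' * lam n)\<^sup>2 / 2)))"
  by (simp add: gauss_def algebra_simps)

text \<open>
  For weights \<open>0 \<le> y \<le> x\<close> one has \<open>(x - y)\<^sup>2 \<le> x\<^sup>2 - y\<^sup>2\<close>, so Parseval's identity bounds the distance by a
  difference of squared norms. As these are monotone in \<open>d\<close>, boundedness is enough for a
  Cauchy sequence.
\<close>

lemma gauss_sqnorm_Cauchy:
  assumes d: "0 < d" "d \<le> d'"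
    and c: "summable (\<lambda>n. norm (gauss lam a d n))" and c': "summable (\<lambda>n. norm (gauss lam a d' n))"
  shows "sqnorm (\<lambda>x. group_series (gauss lam a d) x - group_series (gauss lam a d') x) \<le>
    sqnorm (group_series (gauss lam a d)) - sqnorm (group_series (gauss lam a d'))"
proof -
  define e where "e n = gauss lam a d n - gauss lam a d' n" for n
  have e: "summable (\<lambda>n. norm (e n))"
    by (rule summable_comparison_test'[OF summable_add[OF c c']]) (simp add: e_def norm_triangle_ineq4)
  have "group_series e x = group_series (gauss lam a d) x - group_series (gauss lam a d') x" for x
  proof -
    have "(\<lambda>n. e n * h n x) sums (group_series (gauss lam a d) x - group_series (gauss lam a d') x)"
      using sums_diff[OF group_series_sums[OF c] group_series_sums[OF c']]
      by (simp add: e_def left_diff_distrib)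
    then show ?thesis
      using group_series_sums[OF e] sums_unique2 by blast
  qed
  then have eq: "group_series e = (\<lambda>x. group_series (gauss lam a d) x - group_series (gauss lam a d') x)"
    by blast
  have "(norm (e n))\<^sup>2 \<le> (norm (gauss lam a d n))\<^sup>2 - (norm (gauss lam a d' n))\<^sup>2" for n
  proof -
    define x where "x = exp (- ((d * lam n)\<^sup>2 / 2))"
    define y where "y = exp (- ((d' * lam n)\<^sup>2 / 2))"
    have "(d * lam n)\<^sup>2 \<le> (d' * lam n)\<^sup>2"
      using d lam_nonneg[of n] by (intro power_mono mult_right_mono) auto
    then have xy: "0 \<le> y" "y \<le> x"
      by (simp_all add: x_def y_def)
    then have "y * y \<le> x * y"
      by (intro mult_right_mono) auto
    then have "(x - y)\<^sup>2 \<le> x\<^sup>2 - y\<^sup>2"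
      by (simp add: power2_eq_square algebra_simps)
    then have "(norm (a n))\<^sup>2 * (x - y)\<^sup>2 \<le> (norm (a n))\<^sup>2 * (x\<^sup>2 - y\<^sup>2)"
      by (intro mult_left_mono) auto
    moreover have "(norm (e n))\<^sup>2 = (norm (a n))\<^sup>2 * (x - y)\<^sup>2"
      unfolding e_def gauss_difference x_def[symmetric] y_def[symmetric] norm_mult norm_of_real
      by (simp add: power_mult_distrib)
    moreover have "(norm (gauss lam a d n))\<^sup>2 = (norm (a n))\<^sup>2 * x\<^sup>2"
      "(norm (gauss lam a d' n))\<^sup>2 = (norm (a n))\<^sup>2 * y\<^sup>2"
      unfolding gauss_def x_def[symmetric] y_def[symmetric] norm_mult norm_of_real
      by (simp_all add: power_mult_distrib)
    ultimately show ?thesis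
      by (simp add: right_diff_distrib)
  qed
  from sums_le[OF this sqnorm_group_series[OF e]
      sums_diff[OF sqnorm_group_series[OF c] sqnorm_group_series[OF c']]]
  show ?thesis
    unfolding eq .
qed

text \<open>
  The damped series are bounded by the norm of the extension along \<open>\<beta>\<close>, hence on the group. They are
  Cauchy in \<open>L\<^sub>2\<close>, hence in \<open>L\<^sub>1\<close>, and a subsequence converges almost everywhere. Bound and
  Fourier coefficients pass to the limit by dominated convergence.
\<close>

lemma D_ext_imp_H_inf:
  assumes a: "a \<in> D_ext lam"
  obtains u where "u \<in> H_inf_group lam \<beta> m" "\<And>n. fourier_coeff m u (h n) = a n"
    "Linf_norm m u \<le> D_norm lam a"
proof -
  obtain \<rho> where \<rho>: "summable (\<lambda>n. exp (- (\<rho> * lam n)))"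
    by (rule summable_rho) (rule that)
  obtain F s0 where F: "dconv lam a s0" "bdd_extension lam a F"
    "\<And>s. s \<in> right_half_plane 0 \<Longrightarrow> norm (F s) \<le> D_norm lam a"
    by (rule D_norm_attains[OF a]) (rule that)
  define C where "C = D_norm lam a"
  obtain A where A: "\<And>n. norm (a n) \<le> A * exp (Re s0 * lam n)"
    by (rule dconv_coefficient_bound[OF F(1)]) (rule that)
  define d where "d k = inverse (real (Suc k))" for k
  have d: "0 < d k" for k
    by (simp add: d_def)
  have d_mono: "d j \<le> d k" if "k \<le> j" for j k
    using that by (simp add: d_def)
  have d0: "d \<longlonglongrightarrow> 0"
    unfolding d_def by (rule LIMSEQ_inverse_real_of_nat)
  note sm = gauss_summable[OF freq \<rho> A d]
  define g where "g k = group_series (gauss lam a (d k))" for k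
  have cg: "continuous_on UNIV (g k)" for k
    unfolding g_def by (rule continuous_group_series[OF sm])
  have gC: "norm (g k x) \<le> C" for k x
  proof -
    have "closed {x. norm (g k x) \<le> C}"
      by (intro closed_Collect_le continuous_intros cg)
    moreover have "\<beta> t \<in> {x. norm (g k x) \<le> C}" for t
      using extension_imp_gauss_bound[OF freq \<rho> F(1,2) F(3)[folded C_def] d] by (simp add: g_def group_series_beta)
    ultimately have "x \<in> {x. norm (g k x) \<le> C}"
      by (rule range_dense)
    then show ?thesis
      by simp
  qed
  define Q where "Q k = sqnorm (g k)" for k
  have diff: "sqnorm (\<lambda>x. g j x - g k x) \<le> Q j - Q k" if "k \<le> j" for j k
    unfolding g_def Q_def by (rule gauss_sqnorm_Cauchy[OF d d_mono[OF that] sm sm])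
  have "mono Q"
    using diff sqnorm_nonneg by (intro monoI) (meson diff_ge_0_iff_ge order_trans)
  moreover have "Q k \<le> C\<^sup>2" for k
    unfolding Q_def by (rule sqnorm_le_bound[OF gC cg])
  ultimately have "convergent Q"
    using sqnorm_nonneg by (intro Bseq_mono_convergent BseqI'[of _ "C\<^sup>2"]) (auto simp: mono_def Q_def)
  then have CQ: "Cauchy Q"
    by (rule convergent_Cauchy)
  have L1: "(\<integral>x. norm (g j x - g k x) \<partial>m) \<le> sqrt \<bar>Q j - Q k\<bar>" for j k
  proof -
    have *: "(\<integral>x. norm (g j x - g k x) \<partial>m) \<le> sqrt \<bar>Q j - Q k\<bar>" if "k \<le> j" for j k
    proof -
      have "(\<integral>x. norm (g j x - g k x) \<partial>m) \<le> sqrt (sqnorm (\<lambda>x. g j x - g k x))"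
        by (intro integral_norm_le_sqrt_sqnorm continuous_intros cg)
      also have "\<dots> \<le> sqrt \<bar>Q j - Q k\<bar>"
        using diff[OF that] by (intro real_sqrt_le_mono) simp
      finally show ?thesis .
    qed
    show ?thesis
    proof (cases "k \<le> j")
      case False
      then show ?thesis
        using *[of j k] by (simp add: norm_minus_commute abs_minus_commute)
    qed (rule *)
  qed
  have L1_Cauchy: "\<exists>N. \<forall>i\<ge>N. \<forall>j\<ge>N. (\<integral>x. norm (g i x - g j x) \<partial>m) < e" if "0 < e" for e
  proof -
    have "0 < e\<^sup>2"
      using that by simp
    from metric_CauchyD[OF CQ this] obtain N where N: "\<forall>i\<ge>N. \<forall>j\<ge>N. dist (Q i) (Q j) < e\<^sup>2" ..
    have "(\<integral>x. norm (g i x - g j x) \<partial>m) < e" if "N \<le> i" "N \<le> j" for i j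
    proof -
      have "\<bar>Q i - Q j\<bar> < e\<^sup>2"
        using N that by (simp add: dist_real_def)
      then have "sqrt \<bar>Q i - Q j\<bar> < e"
        using \<open>0 < e\<close> by (intro real_less_lsqrt) auto
      then show ?thesis
        using L1[of i j] by linarith
    qed
    then show ?thesis
      by blast
  qed
  obtain r where r: "strict_mono r" and AEC: "AE x in m. Cauchy (\<lambda>i. g (r i) x)"
    by (rule cauchy_L1_AE_cauchy_subseq[of m g, OF continuous_integrable[OF cg] L1_Cauchy]) (assumption, rule that)
  define f where "f x = lim (\<lambda>i. g (r i) x)" for x
  have f: "f \<in> borel_measurable m"
    unfolding f_def by (intro borel_measurable_lim_metric continuous_measurable cg)
  have lim: "AE x in m. (\<lambda>i. g (r i) x) \<longlonglongrightarrow> f x"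
    using AEC
  proof eventually_elim
    case (elim x)
    then show ?case
      unfolding f_def by (simp add: Cauchy_convergent convergent_LIMSEQ_iff[symmetric])
  qed
  have fC: "AE x in m. norm (f x) \<le> C"
    using lim
  proof eventually_elim
    case (elim x)
    from tendsto_norm[OF elim] show ?case
      by (rule tendsto_upperbound) (simp_all add: gC)
  qed
  have coeff: "(\<lambda>i. \<integral>x. g (r i) x * cnj (\<gamma> x) \<partial>m) \<longlonglongrightarrow> (\<integral>x. f x * cnj (\<gamma> x) \<partial>m)"
    if \<gamma>: "character \<gamma>" for \<gamma>
  proof (rule integral_dominated_convergence[where w = "\<lambda>_. C"])
    have m\<gamma>: "(\<lambda>x. cnj (\<gamma> x)) \<in> borel_measurable m"
      by (intro continuous_measurable continuous_intros characterD(1)[OF \<gamma>])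
    show "(\<lambda>x. f x * cnj (\<gamma> x)) \<in> borel_measurable m"
      by (intro borel_measurable_times f m\<gamma>)
    show "(\<lambda>x. g (r i) x * cnj (\<gamma> x)) \<in> borel_measurable m" for i
      by (intro borel_measurable_times continuous_measurable cg m\<gamma>)
    show "AE x in m. (\<lambda>i. g (r i) x * cnj (\<gamma> x)) \<longlonglongrightarrow> f x * cnj (\<gamma> x)"
      using lim by eventually_elim (intro tendsto_intros)
    show "AE x in m. norm (g (r i) x * cnj (\<gamma> x)) \<le> C" for i
      using gC by (simp add: norm_mult characterD(2)[OF \<gamma>])
  qed simp
  define u where "u = ae_class m f"
  have coeff_u: "fourier_coeff m u \<gamma> = (\<integral>x. f x * cnj (\<gamma> x) \<partial>m)" if "character \<gamma>" for \<gamma>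
    unfolding u_def by (rule fourier_coeff_ae_class[OF f that])
  have coeff_h: "fourier_coeff m u (h n) = a n" for n
  proof -
    have "(\<lambda>i. gauss lam a (d (r i)) n) \<longlonglongrightarrow> (\<integral>x. f x * cnj (h n x) \<partial>m)"
      using coeff[OF h_character, of n] by (simp only: g_def group_series_coefficient_h[OF sm])
    moreover have "(\<lambda>i. gauss lam a (d (r i)) n) \<longlonglongrightarrow> a n * complex_of_real (exp (- ((0 * lam n)\<^sup>2 / 2)))"
      unfolding gauss_def using LIMSEQ_subseq_LIMSEQ[OF d0 r]
      by (intro tendsto_intros) (simp_all add: o_def)
    ultimately show ?thesis
      unfolding coeff_u[OF h_character] using LIMSEQ_unique by fastforce
  qed
  have "\<exists>n. \<gamma> = h n" if \<gamma>: "character \<gamma>" "fourier_coeff m u \<gamma> \<noteq> 0" for \<gamma>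
  proof (rule ccontr)
    assume "\<nexists>n. \<gamma> = h n"
    then have "(\<integral>x. g (r i) x * cnj (\<gamma> x) \<partial>m) = 0" for i
      unfolding g_def using \<gamma>(1) by (intro group_series_coefficient_other[OF sm]) auto
    then have "(\<integral>x. f x * cnj (\<gamma> x) \<partial>m) = 0"
      using coeff[OF \<gamma>(1)] by (simp add: LIMSEQ_const_iff)
    then show False
      using \<gamma> coeff_u by simp
  qed
  then have "u \<in> H_inf_group lam \<beta> m"
    using ae_class_Linf(1)[OF f fC] by (auto simp: H_inf_group_def u_def)
  moreover have "Linf_norm m u \<le> D_norm lam a"
    using ae_class_Linf(2)[OF f fC] by (simp add: u_def C_def)
  ultimately show ?thesis
    using coeff_h by (intro that)
qed

section \<open>From functions on the group to bounded extensions\<close>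

lemma AE_bounded_integrable:
  assumes "f \<in> borel_measurable m" "AE x in m. norm (f x) \<le> C" "trig_poly p"
  shows "integrable m (\<lambda>x. f x * cnj (p x))"
proof -
  note cp = trig_poly_continuous[OF assms(3)]
  obtain B where B: "0 < B" "\<And>x. norm (p x) \<le> B"
    by (rule continuous_bounded[OF cp]) (rule that)
  then show ?thesis
    by (intro bounded_mult_integrable[OF assms(1,2), where B = B] continuous_measurable continuous_intros cp) simp
qed

text \<open>
  Averaging over translations along \<open>\<beta>\<close>. It is applied to trigonometric polynomials only: for these the
  integrand is jointly measurable because characters separate the variables, whereas for a Borel
  function on a group without countable base this would need an argument of its own.
\<close>

definition smoothed :: "real \<Rightarrow> ('g \<Rightarrow> complex) \<Rightarrow> 'g \<Rightarrow> complex" where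
  "smoothed d p x = (LINT v|std_normal_distribution. p (x + \<beta> (d * v)))"

lemma beta_continuous: "continuous_on UNIV \<beta>"
  using group by (simp add: lam_dirichlet_group_def dirichlet_group_def)

lemma line_integrable:
  assumes "trig_poly p"
  shows "integrable std_normal_distribution (\<lambda>v. p (x + \<beta> (d * v)))"
proof -
  interpret N: prob_space std_normal_distribution
    by (rule prob_space_std_normal)
  note cp = trig_poly_continuous[OF assms]
  obtain B where B: "0 < B" "\<And>x. norm (p x) \<le> B"
    by (rule continuous_bounded[OF cp]) (rule that)
  have "continuous_on UNIV (\<lambda>v. p (x + \<beta> (d * v)))"
    by (intro continuous_on_compose2[OF cp] continuous_intros continuous_on_compose2[OF beta_continuous]) auto
  then have "(\<lambda>v. p (x + \<beta> (d * v))) \<in> borel_measurable std_normal_distribution"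
    by (simp add: borel_measurable_continuous_onI)
  then show ?thesis
    using B(2) by (intro N.integrable_const_bound[where B = B]) auto
qed

lemma smoothed_character:
  assumes "character \<gamma>"
  shows "smoothed d \<gamma> = (\<lambda>x. smoothed d \<gamma> 0 * \<gamma> x)"
  by (simp add: smoothed_def characterD(3,4)[OF assms] fun_eq_iff mult.commute)

lemma smoothed_h: "smoothed d (h n) 0 = complex_of_real (exp (- ((d * lam n)\<^sup>2 / 2)))"
proof -
  have "smoothed d (h n) 0 = char std_normal_distribution (- (d * lam n))"
    by (simp add: smoothed_def char_def h_beta mult_ac)
  then show ?thesis
    unfolding char_std_normal_distribution by simp
qed

lemma smoothed_scale: "smoothed d (\<lambda>x. c * p x) = (\<lambda>x. c * smoothed d p x)"
  by (rule ext) (simp add: smoothed_def)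

lemma smoothed_add:
  assumes "trig_poly p" "trig_poly q"
  shows "smoothed d (\<lambda>x. p x + q x) = (\<lambda>x. smoothed d p x + smoothed d q x)"
  by (rule ext) (simp add: smoothed_def line_integrable assms)

lemma trig_poly_smoothed:
  assumes "trig_poly p"
  shows "trig_poly (smoothed d p)"
  using assms
proof (induction rule: trig_poly.induct)
  case (character \<gamma>)
  show ?case
    by (subst smoothed_character[OF character]) (intro trig_poly.scale trig_poly.character character)
next
  case (scale p c)
  then show ?case
    unfolding smoothed_scale by (intro trig_poly.scale)
next
  case (add p q)
  then show ?case
    unfolding smoothed_add[OF add.hyps] by (intro trig_poly.add)
qed

lemma trig_poly_joint_measurable:
  assumes "trig_poly p"
  shows "(\<lambda>z. p (fst z + \<beta> (d * snd z))) \<in> borel_measurable (m \<Otimes>\<^sub>M std_normal_distribution)"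
  using assms
proof (induction rule: trig_poly.induct)
  case (character \<gamma>)
  note c\<gamma> = characterD(1)[OF character]
  have "continuous_on UNIV (\<lambda>v. \<gamma> (\<beta> (d * v)))"
    by (intro continuous_on_compose2[OF c\<gamma>] continuous_intros continuous_on_compose2[OF beta_continuous]) auto
  then have 1: "(\<lambda>v. \<gamma> (\<beta> (d * v))) \<in> borel_measurable std_normal_distribution"
    by (simp add: borel_measurable_continuous_onI)
  have 2: "\<gamma> \<in> borel_measurable m"
    by (rule continuous_measurable[OF c\<gamma>])
  have "(\<lambda>z. \<gamma> (fst z) * \<gamma> (\<beta> (d * snd z))) \<in> borel_measurable (m \<Otimes>\<^sub>M std_normal_distribution)"
    by (intro borel_measurable_times measurable_compose[OF measurable_fst 2] measurable_compose[OF measurable_snd 1])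
  then show ?case
    by (simp only: characterD(3)[OF character])
next
  case (scale p c)
  then show ?case
    by (intro borel_measurable_times measurable_const) simp
next
  case (add p q)
  then show ?case
    by (intro borel_measurable_add)
qed

lemma smoothed_L1_contraction:
  assumes p: "trig_poly p"
  shows "(\<integral>x. norm (smoothed d p x) \<partial>m) \<le> (\<integral>x. norm (p x) \<partial>m)"
proof -
  interpret N: prob_space std_normal_distribution
    by (rule prob_space_std_normal)
  interpret mN: pair_prob_space m std_normal_distribution ..
  note cp = trig_poly_continuous[OF p]
  obtain B where B: "0 < B" "\<And>x. norm (p x) \<le> B"
    by (rule continuous_bounded[OF cp]) (rule that)
  have int: "integrable (m \<Otimes>\<^sub>M std_normal_distribution) (\<lambda>z. norm (p (fst z + \<beta> (d * snd z))))"
    by (intro integrable_norm mN.integrable_const_bound[where B = B, OF _ trig_poly_joint_measurable[OF p]])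
      (simp add: B(2))
  then have int': "integrable (m \<Otimes>\<^sub>M std_normal_distribution) (case_prod (\<lambda>x v. norm (p (x + \<beta> (d * v)))))"
    by (simp add: case_prod_unfold)
  have "(\<integral>x. norm (smoothed d p x) \<partial>m) \<le>
      (\<integral>x. (LINT v|std_normal_distribution. norm (p (x + \<beta> (d * v)))) \<partial>m)"
  proof (rule integral_mono)
    show "integrable m (\<lambda>x. norm (smoothed d p x))"
      by (intro continuous_integrable continuous_intros trig_poly_continuous trig_poly_smoothed p)
    show "integrable m (\<lambda>x. LINT v|std_normal_distribution. norm (p (x + \<beta> (d * v))))"
      using mN.integrable_fst'[OF int] by simp
    show "norm (smoothed d p x) \<le> (LINT v|std_normal_distribution. norm (p (x + \<beta> (d * v))))" for x
      unfolding smoothed_def by (rule integral_norm_bound)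
  qed
  also have "\<dots> = (LINT v|std_normal_distribution. (\<integral>x. norm (p (x + \<beta> (d * v))) \<partial>m))"
    using mN.Fubini_integral[OF int'] by simp
  also have "\<dots> = (LINT v|std_normal_distribution. (\<integral>x. norm (p x) \<partial>m))"
  proof (rule Bochner_Integration.integral_cong[OF refl])
    fix v
    have "(\<integral>x. norm (p (\<beta> (d * v) + x)) \<partial>m) = (\<integral>x. norm (p x) \<partial>m)"
      by (intro integral_translate continuous_measurable continuous_intros cp)
    then show "(\<integral>x. norm (p (x + \<beta> (d * v))) \<partial>m) = (\<integral>x. norm (p x) \<partial>m)"
      by (simp only: add.commute)
  qed
  also have "\<dots> = (\<integral>x. norm (p x) \<partial>m)"
    using N.prob_space by simp
  finally show ?thesis .
qed

text \<open>
  Test with \<open>q = max 0 (|g| - M) g\<close>, approximated by trigonometric polynomials. The hypothesis gives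
  \<open>\<integral> max 0 (|g| - M) |g| (|g| - M) \<le> 0\<close>, and the integrand is continuous and non-negative.
\<close>

lemma bounded_pairing_imp_bounded:
  assumes g: "continuous_on UNIV g" and M: "0 \<le> M"
    and pair: "\<And>p. trig_poly p \<Longrightarrow> norm (\<integral>x. g x * cnj (p x) \<partial>m) \<le> M * (\<integral>x. norm (p x) \<partial>m)"
  shows "norm (g x) \<le> M"
proof -
  obtain B where B: "0 < B" "\<And>x. norm (g x) \<le> B"
    by (rule continuous_bounded[OF g]) (rule that)
  define q where "q x = complex_of_real (max 0 (norm (g x) - M)) * g x" for x
  have q: "continuous_on UNIV q"
    unfolding q_def by (intro continuous_intros g)
  define I where "I = (\<integral>x. max 0 (norm (g x) - M) * (norm (g x))\<^sup>2 \<partial>m)"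
  define J where "J = (\<integral>x. max 0 (norm (g x) - M) * norm (g x) \<partial>m)"
  have int: "integrable m (\<lambda>x. max 0 (norm (g x) - M) * (norm (g x))\<^sup>2)"
    "integrable m (\<lambda>x. max 0 (norm (g x) - M) * norm (g x))"
    by (intro continuous_integrable continuous_intros g)+
  have gq: "(\<integral>x. g x * cnj (q x) \<partial>m) = complex_of_real I"
  proof -
    have "g x * cnj (q x) = complex_of_real (max 0 (norm (g x) - M) * (norm (g x))\<^sup>2)" for x
      unfolding q_def of_real_mult complex_norm_square by simp
    then show ?thesis
      by (simp only: I_def integral_complex_of_real)
  qed
  have nq: "(\<integral>x. norm (q x) \<partial>m) = J"
    unfolding J_def q_def by (simp add: norm_mult)
  have "I - M * J \<le> (B + M) * e" if "0 < e" for e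
  proof -
    obtain p where p: "trig_poly p" "\<And>x. norm (q x - p x) < e"
      by (rule trig_poly_dense[OF q \<open>0 < e\<close>]) (rule that)
    note cp = trig_poly_continuous[OF p(1)]
    have ip: "integrable m (\<lambda>x. g x * cnj (p x))" "integrable m (\<lambda>x. g x * cnj (q x))"
      "integrable m (\<lambda>x. g x * cnj (q x - p x))" "integrable m (\<lambda>x. norm (p x))" "integrable m (\<lambda>x. norm (q x))"
      by (intro continuous_integrable continuous_intros g q cp)+
    have split: "(\<integral>x. g x * cnj (q x) \<partial>m) = (\<integral>x. g x * cnj (p x) \<partial>m) + (\<integral>x. g x * cnj (q x - p x) \<partial>m)"
      using ip by (simp add: right_diff_distrib)
    have "norm (\<integral>x. g x * cnj (q x - p x) \<partial>m) \<le> (\<integral>x. norm (g x * cnj (q x - p x)) \<partial>m)"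
      by (rule integral_norm_bound)
    also have "\<dots> \<le> (\<integral>x. B * e \<partial>m)"
    proof (rule integral_mono)
      show "norm (g x * cnj (q x - p x)) \<le> B * e" for x
        unfolding norm_mult complex_mod_cnj using B p(2)[of x] by (intro mult_mono) auto
    qed (use ip(3) in auto)
    finally have 1: "norm (\<integral>x. g x * cnj (q x - p x) \<partial>m) \<le> B * e"
      by simp
    have "(\<integral>x. norm (p x) \<partial>m) \<le> (\<integral>x. norm (q x) + e \<partial>m)"
    proof (rule integral_mono)
      show "norm (p x) \<le> norm (q x) + e" for x
        using norm_triangle_ineq3[of "q x" "p x"] p(2)[of x] by linarith
    qed (use ip in auto)
    then have "(\<integral>x. norm (p x) \<partial>m) \<le> J + e"
      using ip by (simp add: nq)
    then have "M * (\<integral>x. norm (p x) \<partial>m) \<le> M * (J + e)"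
      using M by (rule mult_left_mono)
    then have 2: "norm (\<integral>x. g x * cnj (p x) \<partial>m) \<le> M * (J + e)"
      using pair[OF p(1)] by linarith
    have "I \<le> norm (\<integral>x. g x * cnj (q x) \<partial>m)"
      unfolding gq by simp
    also have "\<dots> \<le> norm (\<integral>x. g x * cnj (p x) \<partial>m) + norm (\<integral>x. g x * cnj (q x - p x) \<partial>m)"
      unfolding split by (rule norm_triangle_ineq)
    also have "\<dots> \<le> M * (J + e) + B * e"
      by (rule add_mono[OF 2 1])
    finally show ?thesis
      by (simp add: algebra_simps)
  qed
  then have "I - M * J \<le> 0"
    using B(1) M by (intro le_zero_if_le_mult_eps[of "B + M"]) auto
  moreover have "I - M * J = (\<integral>x. max 0 (norm (g x) - M) * norm (g x) * (norm (g x) - M) \<partial>m)"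
    unfolding I_def J_def using int by (simp add: power2_eq_square algebra_simps)
  ultimately have "(\<integral>x. max 0 (norm (g x) - M) * norm (g x) * (norm (g x) - M) \<partial>m) \<le> 0"
    by simp
  moreover have "0 \<le> max 0 (norm (g x) - M) * norm (g x) * (norm (g x) - M)" for x
    by (cases "M \<le> norm (g x)") auto
  moreover have "continuous_on UNIV (\<lambda>x. max 0 (norm (g x) - M) * norm (g x) * (norm (g x) - M))"
    by (intro continuous_intros g)
  ultimately have zero: "max 0 (norm (g x) - M) * norm (g x) * (norm (g x) - M) = 0"
    using integral_zero_imp_zero[of "\<lambda>x. max 0 (norm (g x) - M) * norm (g x) * (norm (g x) - M)" x] by blast
  show ?thesis
  proof (rule ccontr)
    assume "\<not> norm (g x) \<le> M"
    then have "0 < norm (g x) - M" "0 < norm (g x)"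
      using M by linarith+
    with zero show False
      by (auto simp: max_def)
  qed
qed

text \<open>
  Pairing the damped series with a trigonometric polynomial \<open>p\<close> equals pairing \<open>f\<close> with the average of \<open>p\<close>: on
  characters both sides multiply the Fourier coefficient of \<open>f\<close> by the same Gaussian factor, or
  vanish. Since averaging contracts \<open>L\<^sub>1\<close>, the pairing is bounded by the norm of \<open>f\<close> times that of \<open>p\<close>.
\<close>

lemma H_inf_imp_gauss_bound:
  assumes u: "u \<in> H_inf_group lam \<beta> m" and d: "0 < d"
  shows "norm (dlimit lam (gauss lam (bohr_map lam \<beta> m u) d) (\<i> * complex_of_real t)) \<le> Linf_norm m u"
    "norm (bohr_map lam \<beta> m u n) \<le> Linf_norm m u"
proof -
  define f where "f = rep u"
  define M where "M = Linf_norm m u"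
  define a where "a = bohr_map lam \<beta> m u"
  have L: "u \<in> Linf m" and spec: "\<And>\<gamma>. character \<gamma> \<Longrightarrow> fourier_coeff m u \<gamma> \<noteq> 0 \<Longrightarrow> \<exists>n. \<gamma> = h n"
    using u by (auto simp: H_inf_group_def)
  have f: "f \<in> borel_measurable m" and fM: "AE x in m. norm (f x) \<le> M" and M: "0 \<le> M"
    using Linf_rep[OF L] by (simp_all add: f_def M_def)
  have coeff: "(\<integral>x. f x * cnj (h n x) \<partial>m) = a n" for n
    by (simp add: a_def bohr_map_def fourier_coeff_def f_def)
  have a: "norm (a n) \<le> M" for n
  proof -
    have "norm (\<integral>x. f x * cnj (h n x) \<partial>m) \<le> M * (\<integral>x. norm (cnj (h n x)) \<partial>m)"
      by (rule integral_mult_bound[OF f fM, where B = 1])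
        (auto intro!: continuous_measurable continuous_intros characterD(1)[OF h_character])
    then show ?thesis
      unfolding coeff by simp
  qed
  then show "norm (bohr_map lam \<beta> m u n) \<le> Linf_norm m u"
    by (simp add: a_def M_def)
  obtain \<rho> where \<rho>: "summable (\<lambda>n. exp (- (\<rho> * lam n)))"
    by (rule summable_rho) (rule that)
  have sm: "summable (\<lambda>n. norm (gauss lam a d n))"
    by (rule gauss_summable[OF freq \<rho>, of a M 0]) (simp_all add: a d)
  define g where "g = group_series (gauss lam a d)"
  have cg: "continuous_on UNIV g"
    unfolding g_def by (rule continuous_group_series[OF sm])
  have gint: "integrable m (\<lambda>x. g x * cnj (p x))" if "trig_poly p" for p
    by (intro continuous_integrable continuous_intros cg trig_poly_continuous that)
  have fint: "integrable m (\<lambda>x. f x * cnj (p x))" if "trig_poly p" for p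
    by (rule AE_bounded_integrable[OF f fM that])
  have dual: "(\<integral>x. g x * cnj (p x) \<partial>m) = (\<integral>x. f x * cnj (smoothed d p x) \<partial>m)" if "trig_poly p" for p
    using that
  proof (induction rule: trig_poly.induct)
    case (character \<gamma>)
    have eq: "(\<integral>x. f x * cnj (smoothed d \<gamma> x) \<partial>m) = cnj (smoothed d \<gamma> 0) * (\<integral>x. f x * cnj (\<gamma> x) \<partial>m)"
    proof -
      have "f x * cnj (smoothed d \<gamma> x) = cnj (smoothed d \<gamma> 0) * (f x * cnj (\<gamma> x))" for x
        by (subst smoothed_character[OF character]) (simp add: mult_ac)
      then show ?thesis
        by (simp only: integral_mult_right_zero)
    qed
    show ?case
    proof (cases "\<exists>n. \<gamma> = h n")
      case True
      then obtain n where n: "\<gamma> = h n" ..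
      show ?thesis
        unfolding n eq[unfolded n] coeff smoothed_h g_def group_series_coefficient_h[OF sm]
        by (simp add: gauss_def mult.commute)
    next
      case False
      then have "(\<integral>x. f x * cnj (\<gamma> x) \<partial>m) = 0"
        using spec[OF character] by (auto simp: fourier_coeff_def f_def)
      moreover have "(\<integral>x. g x * cnj (\<gamma> x) \<partial>m) = 0"
        unfolding g_def using False by (intro group_series_coefficient_other[OF sm character]) auto
      ultimately show ?thesis
        unfolding eq by simp
    qed
  next
    case (scale p c)
    then show ?case
      unfolding smoothed_scale by (simp add: mult.left_commute)
  next
    case (add p q)
    then show ?case
      unfolding smoothed_add[OF add.hyps]
      by (simp add: distrib_left gint fint trig_poly_smoothed)
  qed
  have "norm (g x) \<le> M" for x
  proof (rule bounded_pairing_imp_bounded[OF cg M])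
    fix p :: "'g \<Rightarrow> complex" assume p: "trig_poly p"
    note cs = trig_poly_continuous[OF trig_poly_smoothed[OF p, of d]]
    obtain B where B: "0 < B" "\<And>x. norm (smoothed d p x) \<le> B"
      by (rule continuous_bounded[OF cs]) (rule that)
    have "norm (\<integral>x. f x * cnj (smoothed d p x) \<partial>m) \<le> M * (\<integral>x. norm (cnj (smoothed d p x)) \<partial>m)"
      by (rule integral_mult_bound[OF f fM, where B = B])
        (use B in \<open>auto intro!: continuous_measurable continuous_intros cs\<close>)
    also have "\<dots> \<le> M * (\<integral>x. norm (p x) \<partial>m)"
      using smoothed_L1_contraction[OF p, of d] M by (simp add: mult_left_mono)
    finally show "norm (\<integral>x. g x * cnj (p x) \<partial>m) \<le> M * (\<integral>x. norm (p x) \<partial>m)"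
      unfolding dual[OF p] .
  qed
  from this[of "\<beta> t"]
  show "norm (dlimit lam (gauss lam (bohr_map lam \<beta> m u) d) (\<i> * complex_of_real t)) \<le> Linf_norm m u"
    by (simp add: g_def group_series_beta a_def M_def)
qed

lemma H_inf_imp_D_ext:
  assumes u: "u \<in> H_inf_group lam \<beta> m"
  shows "bohr_map lam \<beta> m u \<in> D_ext lam" "D_norm lam (bohr_map lam \<beta> m u) \<le> Linf_norm m u"
proof -
  define a where "a = bohr_map lam \<beta> m u"
  define M where "M = Linf_norm m u"
  obtain \<rho> where \<rho>: "0 < \<rho>" "summable (\<lambda>n. exp (- (\<rho> * lam n)))"
    by (rule summable_rho) (rule that)
  have a: "norm (a n) \<le> M * exp (0 * lam n)" for n
    using H_inf_imp_gauss_bound(2)[OF u zero_less_one] by (simp add: a_def M_def)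
  have bound: "norm (dlimit lam (gauss lam a d) (\<i> * complex_of_real t)) \<le> M" if "0 < d" for d t
    unfolding a_def M_def by (rule H_inf_imp_gauss_bound(1)[OF u that])
  obtain F where F: "bdd_extension lam a F" "\<And>s. s \<in> right_half_plane 0 \<Longrightarrow> norm (F s) \<le> M"
    by (rule gauss_bound_imp_extension[OF freq \<rho>(2) a bound]) (assumption, rule that)
  have "summable (\<lambda>n. norm (dterm lam a (complex_of_real \<rho>) n))"
    by (rule dterm_abs_summable[OF lam_nonneg \<rho>(2) a]) simp
  then have conv: "dconv lam a (complex_of_real \<rho>)"
    unfolding dconv_def by (rule summable_norm_cancel)
  then show "bohr_map lam \<beta> m u \<in> D_ext lam"
    using F(1) by (auto simp: D_ext_def a_def)
  show "D_norm lam (bohr_map lam \<beta> m u) \<le> Linf_norm m u"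
    using D_norm_le[OF lam_nonneg \<rho>(2) conv F] by (simp add: a_def M_def)
qed

section \<open>The Bohr map\<close>

lemma H_inf_unique:
  assumes u: "u \<in> H_inf_group lam \<beta> m" and v: "v \<in> H_inf_group lam \<beta> m"
    and eq: "\<And>n. fourier_coeff m u (h n) = fourier_coeff m v (h n)"
  shows "u = v"
proof -
  have Lu: "u \<in> Linf m" and Lv: "v \<in> Linf m"
    using u v by (auto simp: H_inf_group_def)
  note ru = Linf_rep[OF Lu] and rv = Linf_rep[OF Lv]
  have coeff: "fourier_coeff m u \<gamma> = fourier_coeff m v \<gamma>" if "character \<gamma>" for \<gamma>
  proof (cases "\<exists>n. \<gamma> = h n")
    case True
    then show ?thesis
      using eq by blast
  next
    case False
    then have "fourier_coeff m u \<gamma> = 0" "fourier_coeff m v \<gamma> = 0"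
      using u v that unfolding H_inf_group_def by blast+
    then show ?thesis
      by simp
  qed
  have "AE x in m. rep u x - rep v x = 0"
  proof (rule fourier_uniqueness)
    show "(\<lambda>x. rep u x - rep v x) \<in> borel_measurable m"
      by (intro borel_measurable_diff ru(1) rv(1))
    show "AE x in m. norm (rep u x - rep v x) \<le> Linf_norm m u + Linf_norm m v"
      using ru(3) rv(3)
    proof eventually_elim
      case (elim x)
      then show ?case
        using norm_triangle_ineq4[of "rep u x" "rep v x"] by linarith
    qed
    fix \<gamma> :: "'g \<Rightarrow> complex" assume \<gamma>: "character \<gamma>"
    have "(\<integral>x. rep u x * cnj (\<gamma> x) \<partial>m) = (\<integral>x. rep v x * cnj (\<gamma> x) \<partial>m)"
      using coeff[OF \<gamma>] by (simp add: fourier_coeff_def)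
    then show "(\<integral>x. (rep u x - rep v x) * cnj (\<gamma> x) \<partial>m) = 0"
      using character_integrable[OF ru(1,3) \<gamma>] character_integrable[OF rv(1,3) \<gamma>]
      by (simp add: left_diff_distrib)
  qed
  then have "AE x in m. rep u x = rep v x"
    by simp
  from ae_class_cong[OF this] show ?thesis
    unfolding ru(2) rv(2) .
qed

lemma Psi_eqI:
  assumes "u \<in> H_inf_group lam \<beta> m" "\<And>n. fourier_coeff m u (h n) = a n"
  shows "Psi lam \<beta> m a = u"
  unfolding Psi_def
proof (rule the_equality)
  show "u \<in> H_inf_group lam \<beta> m \<and> (\<forall>n. fourier_coeff m u (h n) = a n)"
    using assms by blast
  show "v = u" if "v \<in> H_inf_group lam \<beta> m \<and> (\<forall>n. fourier_coeff m v (h n) = a n)" for v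
    using that assms by (intro H_inf_unique) auto
qed

lemma Psi_D_ext:
  assumes "a \<in> D_ext lam"
  shows "Psi lam \<beta> m a \<in> H_inf_group lam \<beta> m" "fourier_coeff m (Psi lam \<beta> m a) (h n) = a n"
    "Linf_norm m (Psi lam \<beta> m a) = D_norm lam a"
proof -
  obtain u where u: "u \<in> H_inf_group lam \<beta> m" "\<And>n. fourier_coeff m u (h n) = a n"
    "Linf_norm m u \<le> D_norm lam a"
    by (rule D_ext_imp_H_inf[OF assms]) (rule that)
  have P: "Psi lam \<beta> m a = u"
    by (rule Psi_eqI[OF u(1,2)])
  show "Psi lam \<beta> m a \<in> H_inf_group lam \<beta> m" "fourier_coeff m (Psi lam \<beta> m a) (h n) = a n"
    unfolding P by (rule u)+
  have "bohr_map lam \<beta> m u = a"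
    using u(2) by (simp add: bohr_map_def fun_eq_iff)
  then show "Linf_norm m (Psi lam \<beta> m a) = D_norm lam a"
    unfolding P using u(3) H_inf_imp_D_ext(2)[OF u(1)] by simp
qed

lemma Psi_bohr:
  assumes "u \<in> H_inf_group lam \<beta> m"
  shows "Psi lam \<beta> m (bohr_map lam \<beta> m u) = u"
  by (rule Psi_eqI[OF assms]) (simp add: bohr_map_def)

lemma H_inf_combination:
  assumes u: "u \<in> H_inf_group lam \<beta> m" and v: "v \<in> H_inf_group lam \<beta> m"
  shows "ae_class m (\<lambda>x. c * rep u x + e * rep v x) \<in> H_inf_group lam \<beta> m"
    "character \<gamma> \<Longrightarrow> fourier_coeff m (ae_class m (\<lambda>x. c * rep u x + e * rep v x)) \<gamma> =
      c * fourier_coeff m u \<gamma> + e * fourier_coeff m v \<gamma>"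
proof -
  have Lu: "u \<in> Linf m" and Lv: "v \<in> Linf m"
    using u v by (auto simp: H_inf_group_def)
  note ru = Linf_rep[OF Lu] and rv = Linf_rep[OF Lv]
  define f where "f x = c * rep u x + e * rep v x" for x
  have f: "f \<in> borel_measurable m"
    unfolding f_def by (intro borel_measurable_add borel_measurable_times measurable_const ru(1) rv(1)) simp_all
  have fC: "AE x in m. norm (f x) \<le> norm c * Linf_norm m u + norm e * Linf_norm m v"
    using ru(3) rv(3)
  proof eventually_elim
    case (elim x)
    have "norm (f x) \<le> norm (c * rep u x) + norm (e * rep v x)"
      unfolding f_def by (rule norm_triangle_ineq)
    also have "\<dots> \<le> norm c * Linf_norm m u + norm e * Linf_norm m v"
      unfolding norm_mult by (intro add_mono mult_left_mono elim) auto
    finally show ?case .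
  qed
  have coeff: "fourier_coeff m (ae_class m f) \<gamma> = c * fourier_coeff m u \<gamma> + e * fourier_coeff m v \<gamma>"
    if \<gamma>: "character \<gamma>" for \<gamma>
  proof -
    have "(\<integral>x. f x * cnj (\<gamma> x) \<partial>m) =
        (\<integral>x. c * (rep u x * cnj (\<gamma> x)) + e * (rep v x * cnj (\<gamma> x)) \<partial>m)"
      by (simp add: f_def algebra_simps)
    also have "\<dots> = c * fourier_coeff m u \<gamma> + e * fourier_coeff m v \<gamma>"
      using character_integrable[OF ru(1,3) \<gamma>] character_integrable[OF rv(1,3) \<gamma>]
      by (simp add: fourier_coeff_def)
    finally show ?thesis
      unfolding fourier_coeff_ae_class[OF f \<gamma>] .
  qed
  have "ae_class m f \<in> H_inf_group lam \<beta> m"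
    unfolding H_inf_group_def
  proof (intro CollectI conjI allI impI)
    show "ae_class m f \<in> Linf m"
      by (rule ae_class_Linf(1)[OF f fC])
    fix \<gamma> :: "'g \<Rightarrow> complex"
    assume \<gamma>: "character \<gamma>" "fourier_coeff m (ae_class m f) \<gamma> \<noteq> 0"
    then have "fourier_coeff m u \<gamma> \<noteq> 0 \<or> fourier_coeff m v \<gamma> \<noteq> 0"
      using coeff[OF \<gamma>(1)] by auto
    then show "\<exists>n. \<gamma> = h n"
      using u v \<gamma>(1) unfolding H_inf_group_def by blast
  qed
  then show "ae_class m (\<lambda>x. c * rep u x + e * rep v x) \<in> H_inf_group lam \<beta> m"
    by (simp only: f_def[abs_def])
  show "fourier_coeff m (ae_class m (\<lambda>x. c * rep u x + e * rep v x)) \<gamma> =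
      c * fourier_coeff m u \<gamma> + e * fourier_coeff m v \<gamma>" if "character \<gamma>"
    using coeff[OF that] by (simp only: f_def[abs_def])
qed

lemma Psi_add:
  assumes "a \<in> D_ext lam" "b \<in> D_ext lam"
  shows "Psi lam \<beta> m (\<lambda>n. a n + b n) = Linf_add m (Psi lam \<beta> m a) (Psi lam \<beta> m b)"
  using H_inf_combination[OF Psi_D_ext(1)[OF assms(1)] Psi_D_ext(1)[OF assms(2)], where c = 1 and e = 1]
    Psi_D_ext(2)[OF assms(1)] Psi_D_ext(2)[OF assms(2)] h_character
  by (intro Psi_eqI) (simp_all add: Linf_add_def)

lemma Psi_scale:
  assumes "a \<in> D_ext lam"
  shows "Psi lam \<beta> m (\<lambda>n. c * a n) = Linf_scale m c (Psi lam \<beta> m a)"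
  using H_inf_combination[OF Psi_D_ext(1)[OF assms(1)] Psi_D_ext(1)[OF assms(1)], where c = c and e = 0]
    Psi_D_ext(2)[OF assms(1)] h_character
  by (intro Psi_eqI) (simp_all add: Linf_scale_def)

lemma bohr_Psi:
  assumes "a \<in> D_ext lam"
  shows "bohr_map lam \<beta> m (Psi lam \<beta> m a) = a"
  using Psi_D_ext(2)[OF assms] by (simp add: bohr_map_def fun_eq_iff)

lemma Psi_bij: "bij_betw (Psi lam \<beta> m) (D_ext lam) (H_inf_group lam \<beta> m)"
proof (rule bij_betw_byWitness[where f' = "bohr_map lam \<beta> m"])
  show "\<forall>a\<in>D_ext lam. bohr_map lam \<beta> m (Psi lam \<beta> m a) = a"
    using bohr_Psi by blast
  show "\<forall>u\<in>H_inf_group lam \<beta> m. Psi lam \<beta> m (bohr_map lam \<beta> m u) = u"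
    using Psi_bohr by blast
  show "Psi lam \<beta> m ` D_ext lam \<subseteq> H_inf_group lam \<beta> m"
    using Psi_D_ext(1) by blast
  show "bohr_map lam \<beta> m ` H_inf_group lam \<beta> m \<subseteq> D_ext lam"
    using H_inf_imp_D_ext(1) by blast
qed

lemma H_inf_series_eq: "H_inf_series lam \<beta> m = D_ext lam"
proof
  show "H_inf_series lam \<beta> m \<subseteq> D_ext lam"
  proof
    fix a assume "a \<in> H_inf_series lam \<beta> m"
    then obtain u where u: "u \<in> H_inf_group lam \<beta> m" "\<forall>n. fourier_coeff m u (h n) = a n"
      by (auto simp: H_inf_series_def)
    then have "bohr_map lam \<beta> m u = a"
      by (simp add: bohr_map_def fun_eq_iff)
    then show "a \<in> D_ext lam"
      using H_inf_imp_D_ext(1)[OF u(1)] by simp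
  qed
  show "D_ext lam \<subseteq> H_inf_series lam \<beta> m"
    using Psi_D_ext(1,2) unfolding H_inf_series_def by blast
qed

lemma H_inf_series_norm_eq:
  assumes "a \<in> D_ext lam"
  shows "H_inf_series_norm lam \<beta> m a = D_norm lam a"
  using Psi_D_ext(3)[OF assms] unfolding H_inf_series_norm_def Psi_def .

end

theorem theorem4p12:
  fixes lam :: "nat \<Rightarrow> real"
    and \<beta> :: "real \<Rightarrow> 'g::{topological_ab_group_add, t2_space}"
    and m :: "'g measure"
  assumes "frequency lam"
    and "lam_dirichlet_group lam \<beta>"
    and "normalized_haar m"
    and "freq_L lam < \<infinity>"
    and "D_ext lam = D_inf lam"
  shows
    "(\<forall>a\<in>D_ext lam. Psi lam \<beta> m a \<in> H_inf_group lam \<beta> m \<and>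
        (\<forall>n. fourier_coeff m (Psi lam \<beta> m a) (h_char \<beta> (lam n)) = a n)) \<and>
     (\<forall>a\<in>D_ext lam. \<forall>b\<in>D_ext lam. Psi lam \<beta> m (\<lambda>n. a n + b n) =
        Linf_add m (Psi lam \<beta> m a) (Psi lam \<beta> m b)) \<and>
     (\<forall>a\<in>D_ext lam. \<forall>c. Psi lam \<beta> m (\<lambda>n. c * a n) = Linf_scale m c (Psi lam \<beta> m a)) \<and>
     bij_betw (Psi lam \<beta> m) (D_ext lam) (H_inf_group lam \<beta> m) \<and>
     (\<forall>a\<in>D_ext lam. Linf_norm m (Psi lam \<beta> m a) = D_norm lam a) \<and>
     bohr_map lam \<beta> m ` H_inf_group lam \<beta> m \<subseteq> D_inf lam \<and>
     (\<forall>u\<in>H_inf_group lam \<beta> m. Psi lam \<beta> m (bohr_map lam \<beta> m u) = u) \<and>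
     (\<forall>a\<in>D_ext lam. bohr_map lam \<beta> m (Psi lam \<beta> m a) = a) \<and>
     D_inf lam = H_inf_series lam \<beta> m \<and>
     (\<forall>a\<in>D_inf lam. D_norm lam a = H_inf_series_norm lam \<beta> m a)"
proof -
  interpret dirichlet_setting m lam \<beta>
    by standard (use assms in \<open>auto simp: lam_dirichlet_group_def dirichlet_group_def\<close>)
  have "bohr_map lam \<beta> m ` H_inf_group lam \<beta> m \<subseteq> D_inf lam"
    using H_inf_imp_D_ext(1) assms(5) by blast
  moreover have "D_inf lam = H_inf_series lam \<beta> m"
    using H_inf_series_eq assms(5) by simp
  ultimately show ?thesis
    using Psi_D_ext Psi_add Psi_scale Psi_bij Psi_bohr bohr_Psi H_inf_series_norm_eq assms(5)
    by (intro conjI) simp_all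
qed

end
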